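(* Let $S$ be a compact spacelike codimension-two embedded submanifold of an orientable spacetime $(M,g)$ of dimension $n+2\ge4$, admitting a lightlike normal vector field $\xi$. Let $\Sigma=\Phi(\mathscr O)$ be the lightlike hypersurface emanating from $S$ by the normal exponential construction along $\xi$ (see context), and assume that $\Sigma$ is totally umbilical. Then, for each $t\in D$, the volume of the leaf $S_t$ of the screen distribution $\mathcal S$, induced by the metric of $M$, is given by $$\operatorname{Vol}(S_t)=\int_S\exp\left(\int_0^t\theta\bigl(\Phi(p,s)\bigr)\,ds\right)\mathrm dV,$$ where $\theta$ denotes the lightlike expansion scalar associated with the lightlike geodesic extension $U$ of $\xi$ to $\Sigma$, and $\mathrm dV$ is the induced volume element on $S$.
   Context: A spacetime is a connected time-oriented Lorentzian manifold of signature $(-,+,\dots,+)$, with Levi-Civita connection $\widetilde\nabla$; lightlike vectors are nonzero null vectors; $S$ is connected of dimension $n$ with induced Riemannian metric. Normal exponential construction: choose an open neighborhood $\mathscr V$ of the zero section of the normal bundle $T^\perp S$, fiberwise star-shaped about $0$, such that the normal exponential map $\exp^\perp$ restricts to a diffeomorphism from $\mathscr V$ onto an open neighborhood of $S$ in $M$. Put $\mathscr O=\{(p,t)\in S\times\mathbb R: t\xi_p\in\mathscr V\}$, $\Phi\colon\mathscr O\to M$, $\Phi(p,t)=\exp^\perp_p(t\xi_p)$, and $\Sigma=\Phi(\mathscr O)$. Then $\Phi$ is an embedding, $\Sigma$ is a lightlike hypersurface (the induced metric is everywhere degenerate) containing $S=\Phi(S\times\{0\})$; $U=\Phi_*(\partial_t)$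 is a lightlike vector field on $\Sigma$ with $\widetilde\nabla_UU=0$, $U|_S=\xi$, spanning the radical of the induced metric; $\mathcal S$ is the integrable screen distribution (complementary to $\operatorname{span}\{U\}$) given by the images under $\Phi_*$ of the tangent spaces to the slices $\{t=\text{const}\}$ of $\mathscr O$. $I_p=\{t:(p,t)\in\mathscr O\}$ is an open interval containing $0$, $D=\bigcap_{p\in S}I_p$, and for $t\in D$, $S_t=\Phi(S\times\{t\})$ is a leaf of $\mathcal S$ (with $S_0=S$). $B_U(X,Y)=-g(\widetilde\nabla_XU,Y)$ on $\Sigma$; $\Sigma$ is totally umbilical if $B_U=\mu g$ for a smooth function $\mu$ on $\Sigma$. The screen shape operator $A_U^*$ is the $\mathcal S$-valued endomorphism with $B_U(X,Y)=g(A_U^*X,Y)$, and the lightlike expansion scalar is $\theta=\theta_U=-\operatorname{trace}(A_U^*|_{\mathcal S})$ (so $\theta=-n\mu$ in the totally umbilical case). *)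

theory Defs
  imports "HOL-Analysis.Analysis"
begin

section \<open>Smooth maps between open subsets of Euclidean spaces\<close>

primrec Ck_on :: "nat \<Rightarrow> 'e::euclidean_space set \<Rightarrow> ('e \<Rightarrow> 'h::euclidean_space) \<Rightarrow> bool" where
  "Ck_on 0 W f \<longleftrightarrow> continuous_on W f"
| "Ck_on (Suc k) W f \<longleftrightarrow> (\<forall>x\<in>W. f differentiable (at x)) \<and>
     (\<forall>v. Ck_on k W (\<lambda>x. frechet_derivative f (at x) v))"

definition smooth_on :: "'e::euclidean_space set \<Rightarrow> ('e \<Rightarrow> 'h::euclidean_space) \<Rightarrow> bool" where
  "smooth_on W f \<longleftrightarrow> (\<forall>k. Ck_on k W f)"


section \<open>Smooth manifolds\<close>

text \<open>
  A chart is a pair of its domain and its coordinate map. A manifold is given by an atlas;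
  its underlying set is the union of the chart domains, and its topology is the one induced
  by the charts.
\<close>

type_synonym ('a, 'e) chart = "'a set \<times> ('a \<Rightarrow> 'e)"
type_synonym ('a, 'e) atlas = "('a, 'e) chart set"

definition chart_inv :: "('a, 'e) chart \<Rightarrow> 'e \<Rightarrow> 'a" where
  "chart_inv c = inv_into (fst c) (snd c)"

definition carrier_of :: "('a, 'e) atlas \<Rightarrow> 'a set" where
  "carrier_of A = (\<Union>c\<in>A. fst c)"

definition atlas_topology :: "('a, 'e::euclidean_space) atlas \<Rightarrow> 'a topology" where
  "atlas_topology A = topology_generated_by {fst c \<inter> snd c -` W | c W. c \<in> A \<and> open W}"

definition smooth_atlas :: "('a, 'e::euclidean_space) atlas \<Rightarrow> bool" where
  "smooth_atlas A \<longleftrightarrow>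
     (\<forall>c\<in>A. inj_on (snd c) (fst c) \<and> open (snd c ` fst c)) \<and>
     (\<forall>c\<in>A. \<forall>d\<in>A. open (snd c ` (fst c \<inter> fst d)) \<and>
        smooth_on (snd c ` (fst c \<inter> fst d)) (snd d \<circ> chart_inv c))"

definition smooth_manifold :: "('a, 'e::euclidean_space) atlas \<Rightarrow> bool" where
  "smooth_manifold A \<longleftrightarrow> smooth_atlas A \<and>
     Hausdorff_space (atlas_topology A) \<and> second_countable (atlas_topology A)"

definition orientable :: "('a, real^'m) atlas \<Rightarrow> bool" where
  "orientable A \<longleftrightarrow> (\<exists>B. carrier_of B = carrier_of A \<and> smooth_atlas (A \<union> B) \<and>
     (\<forall>c\<in>B. \<forall>d\<in>B. \<forall>x\<in>snd c ` (fst c \<inter> fst d).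
        0 < det (matrix (frechet_derivative (snd d \<circ> chart_inv c) (at x)))))"

abbreviation euclidean_atlas :: "('e, 'e) atlas" where
  "euclidean_atlas \<equiv> {(UNIV, \<lambda>x. x)}"

definition smooth_map ::
  "('a, 'e::euclidean_space) atlas \<Rightarrow> ('b, 'h::euclidean_space) atlas \<Rightarrow> 'a set \<Rightarrow> ('a \<Rightarrow> 'b) \<Rightarrow> bool" where
  "smooth_map A B U f \<longleftrightarrow> openin (atlas_topology A) U \<and>
     continuous_map (subtopology (atlas_topology A) U) (atlas_topology B) f \<and>
     (\<forall>c\<in>A. \<forall>d\<in>B. smooth_on (snd c ` (U \<inter> fst c \<inter> f -` fst d)) (snd d \<circ> f \<circ> chart_inv c))"

text \<open>Smoothness on an arbitrary subset: locally the restriction of a smooth map on an open set.\<close>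

definition smooth_map_on ::
  "('a, 'e::euclidean_space) atlas \<Rightarrow> ('b, 'h::euclidean_space) atlas \<Rightarrow> 'a set \<Rightarrow> ('a \<Rightarrow> 'b) \<Rightarrow> bool" where
  "smooth_map_on A B N f \<longleftrightarrow>
     (\<forall>p\<in>N. \<exists>U F. p \<in> U \<and> smooth_map A B U F \<and> (\<forall>q\<in>N \<inter> U. F q = f q))"

definition diffeomorphism ::
  "('a, 'e::euclidean_space) atlas \<Rightarrow> ('b, 'h::euclidean_space) atlas \<Rightarrow> 'a set \<Rightarrow> 'b set \<Rightarrow> ('a \<Rightarrow> 'b) \<Rightarrow> bool" where
  "diffeomorphism A B X Y f \<longleftrightarrow> bij_betw f X Y \<and>
     smooth_map_on A B X f \<and> smooth_map_on B A Y (inv_into X f)"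


section \<open>Tangent vectors\<close>

text \<open>
  Every point \<open>p\<close> gets a preferred chart, and the tangent space at \<open>p\<close> is the model space
  \<open>'e\<close>: a vector \<open>v :: 'e\<close> stands for the tangent vector whose components in the preferred
  chart at \<open>p\<close> are \<open>v\<close>. With this convention \<open>tangent_map A B f p\<close> is the differential of
  \<open>f\<close> at \<open>p\<close>. In particular \<open>tangent_map A euclidean_atlas (snd c) p v\<close> are the components of
  \<open>v\<close> in an arbitrary chart \<open>c\<close> around \<open>p\<close>, and
  \<open>tangent_map euclidean_atlas A (chart_inv c) x u\<close> is the tangent vector with components \<open>u\<close>
  in \<open>c\<close>. The preferred chart may jump from point to point, so regularity of vector fields
  is always expressed through the atlas of the tangent bundle or through components in a fixed
  chart, and never through a map into \<open>'e\<close>.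
\<close>

definition chart_at :: "('a, 'e) atlas \<Rightarrow> 'a \<Rightarrow> ('a, 'e) chart" where
  "chart_at A p = (SOME c. c \<in> A \<and> p \<in> fst c)"

definition tangent_map ::
  "('a, 'e::euclidean_space) atlas \<Rightarrow> ('b, 'h::euclidean_space) atlas \<Rightarrow> ('a \<Rightarrow> 'b) \<Rightarrow> 'a \<Rightarrow> 'e \<Rightarrow> 'h" where
  "tangent_map A B f p v =
     frechet_derivative (snd (chart_at B (f p)) \<circ> f \<circ> chart_inv (chart_at A p))
       (at (snd (chart_at A p) p)) v"

definition velocity :: "('a, 'e::euclidean_space) atlas \<Rightarrow> (real \<Rightarrow> 'a) \<Rightarrow> real \<Rightarrow> 'e" where
  "velocity A \<gamma> t = tangent_map euclidean_atlas A \<gamma> t 1"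

definition tangent_atlas :: "('a, 'e::euclidean_space) atlas \<Rightarrow> ('a \<times> 'e, 'e \<times> 'e) atlas" where
  "tangent_atlas A =
     (\<lambda>c. (fst c \<times> UNIV, \<lambda>(p, v). (snd c p, tangent_map A euclidean_atlas (snd c) p v))) ` A"

definition curve_through :: "('a, 'e::euclidean_space) atlas \<Rightarrow> 'a set \<Rightarrow> 'a \<Rightarrow> (real \<Rightarrow> 'a) \<Rightarrow> bool" where
  "curve_through A N p \<gamma> \<longleftrightarrow> (\<exists>\<epsilon>>0. smooth_map euclidean_atlas A {-\<epsilon><..<\<epsilon>} \<gamma> \<and>
     \<gamma> ` {-\<epsilon><..<\<epsilon>} \<subseteq> N \<and> \<gamma> 0 = p)"

definition tangent_space :: "('a, 'e::euclidean_space) atlas \<Rightarrow> 'a set \<Rightarrow> 'a \<Rightarrow> 'e set" where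
  "tangent_space A N p = {velocity A \<gamma> 0 | \<gamma>. curve_through A N p \<gamma>}"


section \<open>Embedded submanifolds\<close>

definition local_parametrization ::
  "('a, 'e::euclidean_space) atlas \<Rightarrow> 'a set \<Rightarrow> 'f::euclidean_space set \<Rightarrow> ('f \<Rightarrow> 'a) \<Rightarrow> bool" where
  "local_parametrization A N W \<psi> \<longleftrightarrow>
     smooth_map euclidean_atlas A W \<psi> \<and>
     (\<forall>x\<in>W. inj (tangent_map euclidean_atlas A \<psi> x)) \<and>
     openin (subtopology (atlas_topology A) N) (\<psi> ` W) \<and>
     homeomorphic_map (top_of_set W) (subtopology (atlas_topology A) (\<psi> ` W)) \<psi>"

text \<open>The first argument fixes the model space, hence the dimension, of the submanifold.\<close>

definition embedded_submanifold ::
  "'f::euclidean_space itself \<Rightarrow> ('a, 'e::euclidean_space) atlas \<Rightarrow> 'a set \<Rightarrow> bool" where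
  "embedded_submanifold TYPE('f) A N \<longleftrightarrow> N \<subseteq> carrier_of A \<and>
     (\<forall>p\<in>N. \<exists>(W :: 'f set) \<psi>. local_parametrization A N W \<psi> \<and> p \<in> \<psi> ` W)"


section \<open>Lorentzian metrics and spacetimes\<close>

type_synonym ('a, 'e) metric = "'a \<Rightarrow> 'e \<Rightarrow> 'e \<Rightarrow> real"

definition pullback_metric ::
  "('a, 'e::euclidean_space) atlas \<Rightarrow> ('a, 'e) metric \<Rightarrow> ('f::euclidean_space \<Rightarrow> 'a) \<Rightarrow> ('f, 'f) metric" where
  "pullback_metric A g \<psi> x u v =
     g (\<psi> x) (tangent_map euclidean_atlas A \<psi> x u) (tangent_map euclidean_atlas A \<psi> x v)"

definition lorentzian_metric :: "('a, 'e::euclidean_space) atlas \<Rightarrow> ('a, 'e) metric \<Rightarrow> bool" where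
  "lorentzian_metric A g \<longleftrightarrow>
     (\<forall>p\<in>carrier_of A. bilinear (g p) \<and> (\<forall>u v. g p u v = g p v u) \<and>
        (\<exists>(L :: 'e \<Rightarrow> 'e) b0. linear L \<and> bij L \<and> b0 \<in> Basis \<and>
           (\<forall>b\<in>Basis. \<forall>b'\<in>Basis.
              g p (L b) (L b') = (if b \<noteq> b' then 0 else if b = b0 then -1 else 1)))) \<and>
     (\<forall>c\<in>A. \<forall>u v. smooth_on (snd c ` fst c) (\<lambda>x. pullback_metric A g (chart_inv c) x u v))"

definition time_orientable :: "('a, 'e::euclidean_space) atlas \<Rightarrow> ('a, 'e) metric \<Rightarrow> bool" where
  "time_orientable A g \<longleftrightarrow> (\<exists>T.
     continuous_map (atlas_topology A) (atlas_topology (tangent_atlas A)) (\<lambda>p. (p, T p)) \<and>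
     (\<forall>p\<in>carrier_of A. g p (T p) (T p) < 0))"

definition spacetime :: "('a, 'e::euclidean_space) atlas \<Rightarrow> ('a, 'e) metric \<Rightarrow> bool" where
  "spacetime A g \<longleftrightarrow> smooth_manifold A \<and> connected_space (atlas_topology A) \<and>
     lorentzian_metric A g \<and> time_orientable A g"

definition spacelike :: "('a, 'e::euclidean_space) atlas \<Rightarrow> ('a, 'e) metric \<Rightarrow> 'a set \<Rightarrow> bool" where
  "spacelike A g N \<longleftrightarrow> (\<forall>p\<in>N. \<forall>v\<in>tangent_space A N p. v \<noteq> 0 \<longrightarrow> 0 < g p v v)"


section \<open>The Levi-Civita connection, geodesics and the exponential map\<close>

text \<open>
  \<open>levi_civita A g c x u v\<close> is the covariant derivative at \<open>x\<close>, in components, of the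
  coordinate-constant vector field \<open>v\<close> in direction \<open>u\<close> in the chart \<open>c\<close> (the Christoffel
  symbols as a bilinear map). Symmetry is vanishing torsion; the last clause is metric
  compatibility.
\<close>

definition levi_civita ::
  "('a, 'e::euclidean_space) atlas \<Rightarrow> ('a, 'e) metric \<Rightarrow> ('a, 'e) chart \<Rightarrow> 'e \<Rightarrow> 'e \<Rightarrow> 'e \<Rightarrow> 'e" where
  "levi_civita A g c x = (THE \<Gamma>. bilinear \<Gamma> \<and> (\<forall>u v. \<Gamma> u v = \<Gamma> v u) \<and>
     (let G = pullback_metric A g (chart_inv c) in
       \<forall>u v w. frechet_derivative (\<lambda>y. G y v w) (at x) u = G x (\<Gamma> u v) w + G x v (\<Gamma> u w)))"

definition cov_deriv ::
  "('a, 'e::euclidean_space) atlas \<Rightarrow> ('a, 'e) metric \<Rightarrow> (real \<Rightarrow> 'a) \<Rightarrow> (real \<Rightarrow> 'e) \<Rightarrow> real \<Rightarrow> 'e" where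
  "cov_deriv A g \<gamma> X t = (let c = chart_at A (\<gamma> t) in
     vector_derivative (\<lambda>s. tangent_map A euclidean_atlas (snd c) (\<gamma> s) (X s)) (at t)
       + levi_civita A g c (snd c (\<gamma> t)) (velocity A \<gamma> t) (X t))"

text \<open>The covariant derivative, at \<open>q\<close> and in direction \<open>X\<close>, of a vector field defined on \<open>N\<close>.\<close>

definition cov_deriv_on ::
  "('a, 'e::euclidean_space) atlas \<Rightarrow> ('a, 'e) metric \<Rightarrow> 'a set \<Rightarrow> ('a \<Rightarrow> 'e) \<Rightarrow> 'a \<Rightarrow> 'e \<Rightarrow> 'e" where
  "cov_deriv_on A g N U q X = (THE w. \<exists>\<gamma>. curve_through A N q \<gamma> \<and> velocity A \<gamma> 0 = X \<and>
     w = cov_deriv A g \<gamma> (\<lambda>s. U (\<gamma> s)) 0)"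

definition geodesic_arc ::
  "('a, 'e::euclidean_space) atlas \<Rightarrow> ('a, 'e) metric \<Rightarrow> 'a \<Rightarrow> 'e \<Rightarrow> (real \<Rightarrow> 'a) \<Rightarrow> bool" where
  "geodesic_arc A g p v \<gamma> \<longleftrightarrow> \<gamma> 0 = p \<and> velocity A \<gamma> 0 = v \<and>
     (\<exists>\<epsilon>>0. smooth_map euclidean_atlas A {-\<epsilon><..<1+\<epsilon>} \<gamma> \<and>
        (\<forall>t\<in>{-\<epsilon><..<1+\<epsilon>}. cov_deriv A g \<gamma> (velocity A \<gamma>) t = 0))"

definition exp_domain :: "('a, 'e::euclidean_space) atlas \<Rightarrow> ('a, 'e) metric \<Rightarrow> ('a \<times> 'e) set" where
  "exp_domain A g = {(p, v). p \<in> carrier_of A \<and> (\<exists>\<gamma>. geodesic_arc A g p v \<gamma>)}"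

definition exp_map :: "('a, 'e::euclidean_space) atlas \<Rightarrow> ('a, 'e) metric \<Rightarrow> 'a \<times> 'e \<Rightarrow> 'a" where
  "exp_map A g = (\<lambda>(p, v). THE q. \<exists>\<gamma>. geodesic_arc A g p v \<gamma> \<and> \<gamma> 1 = q)"


section \<open>The lightlike hypersurface emanating from a submanifold\<close>

definition normal_bundle :: "('a, 'e::euclidean_space) atlas \<Rightarrow> ('a, 'e) metric \<Rightarrow> 'a set \<Rightarrow> ('a \<times> 'e) set" where
  "normal_bundle A g S = {(p, v). p \<in> S \<and> (\<forall>w\<in>tangent_space A S p. g p v w = 0)}"

definition lightlike_normal_field ::
  "('a, 'e::euclidean_space) atlas \<Rightarrow> ('a, 'e) metric \<Rightarrow> 'a set \<Rightarrow> ('a \<Rightarrow> 'e) \<Rightarrow> bool" where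
  "lightlike_normal_field A g S \<xi> \<longleftrightarrow>
     smooth_map_on A (tangent_atlas A) S (\<lambda>p. (p, \<xi> p)) \<and>
     (\<forall>p\<in>S. (p, \<xi> p) \<in> normal_bundle A g S \<and> \<xi> p \<noteq> 0 \<and> g p (\<xi> p) (\<xi> p) = 0)"

definition normal_exp_neighborhood ::
  "('a, 'e::euclidean_space) atlas \<Rightarrow> ('a, 'e) metric \<Rightarrow> 'a set \<Rightarrow> ('a \<times> 'e) set \<Rightarrow> bool" where
  "normal_exp_neighborhood A g S V \<longleftrightarrow>
     openin (subtopology (atlas_topology (tangent_atlas A)) (normal_bundle A g S)) V \<and>
     (\<forall>p\<in>S. (p, 0) \<in> V) \<and>
     (\<forall>p v. (p, v) \<in> V \<longrightarrow> (\<forall>s\<in>{0..1}. (p, s *\<^sub>R v) \<in> V)) \<and>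
     V \<subseteq> exp_domain A g \<and>
     (\<exists>N. openin (atlas_topology A) N \<and> S \<subseteq> N \<and>
        diffeomorphism (tangent_atlas A) A V N (exp_map A g))"

definition flow_domain :: "'a set \<Rightarrow> ('a \<Rightarrow> 'e::real_vector) \<Rightarrow> ('a \<times> 'e) set \<Rightarrow> ('a \<times> real) set" where
  "flow_domain S \<xi> V = {(p, t). p \<in> S \<and> (p, t *\<^sub>R \<xi> p) \<in> V}"

definition normal_flow ::
  "('a, 'e::euclidean_space) atlas \<Rightarrow> ('a, 'e) metric \<Rightarrow> ('a \<Rightarrow> 'e) \<Rightarrow> 'a \<times> real \<Rightarrow> 'a" where
  "normal_flow A g \<xi> = (\<lambda>(p, t). exp_map A g (p, t *\<^sub>R \<xi> p))"

definition emanating_hypersurface ::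
  "('a, 'e::euclidean_space) atlas \<Rightarrow> ('a, 'e) metric \<Rightarrow> 'a set \<Rightarrow> ('a \<Rightarrow> 'e) \<Rightarrow> ('a \<times> 'e) set \<Rightarrow> 'a set" where
  "emanating_hypersurface A g S \<xi> V = normal_flow A g \<xi> ` flow_domain S \<xi> V"

text \<open>
  \<open>flow_coords\<close> inverts the injective map \<open>normal_flow A g \<xi>\<close> on \<open>flow_domain S \<xi> V\<close>.
\<close>

definition flow_coords ::
  "('a, 'e::euclidean_space) atlas \<Rightarrow> ('a, 'e) metric \<Rightarrow> 'a set \<Rightarrow> ('a \<Rightarrow> 'e) \<Rightarrow> ('a \<times> 'e) set \<Rightarrow> 'a \<Rightarrow> 'a \<times> real" where
  "flow_coords A g S \<xi> V = inv_into (flow_domain S \<xi> V) (normal_flow A g \<xi>)"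

definition geodesic_extension ::
  "('a, 'e::euclidean_space) atlas \<Rightarrow> ('a, 'e) metric \<Rightarrow> 'a set \<Rightarrow> ('a \<Rightarrow> 'e) \<Rightarrow> ('a \<times> 'e) set \<Rightarrow> 'a \<Rightarrow> 'e" where
  "geodesic_extension A g S \<xi> V q =
     (case flow_coords A g S \<xi> V q of (p, t) \<Rightarrow> velocity A (\<lambda>s. normal_flow A g \<xi> (p, s)) t)"

definition screen ::
  "('a, 'e::euclidean_space) atlas \<Rightarrow> ('a, 'e) metric \<Rightarrow> 'a set \<Rightarrow> ('a \<Rightarrow> 'e) \<Rightarrow> ('a \<times> 'e) set \<Rightarrow> 'a \<Rightarrow> 'e set" where
  "screen A g S \<xi> V q =
     (case flow_coords A g S \<xi> V q of (p, t) \<Rightarrow>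
        {velocity A (\<lambda>s. normal_flow A g \<xi> (\<gamma> s, t)) 0 | \<gamma>.
           curve_through A {p'. (p', t) \<in> flow_domain S \<xi> V} p \<gamma>})"

definition flow_times :: "'a set \<Rightarrow> ('a \<Rightarrow> 'e::real_vector) \<Rightarrow> ('a \<times> 'e) set \<Rightarrow> real set" where
  "flow_times S \<xi> V = (\<Inter>p\<in>S. {t. (p, t) \<in> flow_domain S \<xi> V})"

definition screen_leaf ::
  "('a, 'e::euclidean_space) atlas \<Rightarrow> ('a, 'e) metric \<Rightarrow> 'a set \<Rightarrow> ('a \<Rightarrow> 'e) \<Rightarrow> real \<Rightarrow> 'a set" where
  "screen_leaf A g S \<xi> t = normal_flow A g \<xi> ` (S \<times> {t})"


section \<open>Null second fundamental form and expansion scalar\<close>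

definition null_sff ::
  "('a, 'e::euclidean_space) atlas \<Rightarrow> ('a, 'e) metric \<Rightarrow> 'a set \<Rightarrow> ('a \<Rightarrow> 'e) \<Rightarrow> ('a \<times> 'e) set \<Rightarrow> 'a \<Rightarrow> 'e \<Rightarrow> 'e \<Rightarrow> real" where
  "null_sff A g S \<xi> V q X Y =
     - g q (cov_deriv_on A g (emanating_hypersurface A g S \<xi> V) (geodesic_extension A g S \<xi> V) q X) Y"

definition totally_umbilical ::
  "('a, 'e::euclidean_space) atlas \<Rightarrow> ('a, 'e) metric \<Rightarrow> 'a set \<Rightarrow> ('a \<Rightarrow> 'e) \<Rightarrow> ('a \<times> 'e) set \<Rightarrow> bool" where
  "totally_umbilical A g S \<xi> V \<longleftrightarrow> (let \<Sigma> = emanating_hypersurface A g S \<xi> V in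
     \<exists>\<mu> :: 'a \<Rightarrow> real. smooth_map_on A euclidean_atlas \<Sigma> \<mu> \<and>
       (\<forall>q\<in>\<Sigma>. \<forall>X\<in>tangent_space A \<Sigma> q. \<forall>Y\<in>tangent_space A \<Sigma> q.
          null_sff A g S \<xi> V q X Y = \<mu> q * g q X Y))"

definition screen_shape_operator ::
  "('a, 'e::euclidean_space) atlas \<Rightarrow> ('a, 'e) metric \<Rightarrow> 'a set \<Rightarrow> ('a \<Rightarrow> 'e) \<Rightarrow> ('a \<times> 'e) set \<Rightarrow> 'a \<Rightarrow> 'e \<Rightarrow> 'e" where
  "screen_shape_operator A g S \<xi> V q X = (THE Z. Z \<in> screen A g S \<xi> V q \<and>
     (\<forall>Y\<in>tangent_space A (emanating_hypersurface A g S \<xi> V) q.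
        null_sff A g S \<xi> V q X Y = g q Z Y))"

definition trace_on :: "'e::euclidean_space set \<Rightarrow> ('e \<Rightarrow> 'e) \<Rightarrow> real" where
  "trace_on L f = (let B = (SOME B. independent B \<and> span B = L) in
     \<Sum>b\<in>B. representation B (f b) b)"

definition expansion_scalar ::
  "('a, 'e::euclidean_space) atlas \<Rightarrow> ('a, 'e) metric \<Rightarrow> 'a set \<Rightarrow> ('a \<Rightarrow> 'e) \<Rightarrow> ('a \<times> 'e) set \<Rightarrow> 'a \<Rightarrow> real" where
  "expansion_scalar A g S \<xi> V q =
     - trace_on (screen A g S \<xi> V q) (screen_shape_operator A g S \<xi> V q)"


section \<open>The induced volume measure\<close>

text \<open>
  The Riemannian measure of a spacelike embedded submanifold \<open>N\<close> with model space \<open>real^'n\<close>: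
  the unique Borel measure on \<open>N\<close> which in every local parametrization is
  \<open>sqrt (det g_ij)\<close> times Lebesgue measure. (Existence follows from the change of variables
  formula, uniqueness from second countability.)
\<close>

definition induced_volume ::
  "'n::finite itself \<Rightarrow> ('a, 'e::euclidean_space) atlas \<Rightarrow> ('a, 'e) metric \<Rightarrow> 'a set \<Rightarrow> 'a measure" where
  "induced_volume TYPE('n) A g N = (THE M.
     sets M = sigma_sets N {U. openin (subtopology (atlas_topology A) N) U} \<and>
     (\<forall>(W :: (real^'n) set) \<psi> E. local_parametrization A N W \<psi> \<and> E \<in> sets borel \<and> E \<subseteq> W \<longrightarrow>
        emeasure M (\<psi> ` E) =
          (\<integral>\<^sup>+ x\<in>E. ennreal (sqrt (det (\<chi> i j. pullback_metric A g \<psi> x (axis i 1) (axis j 1)))) \<partial>lborel)))"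

end

theory Submission
  imports Defs
begin

text \<open>
  Let \<open>h\<^sub>s\<close> be the pullback of the metric along \<open>x \<mapsto> \<Phi> (\<psi> x) s\<close>, where \<open>\<psi>\<close> parametrizes \<open>S\<close>
  locally. Since the connection has no torsion, the covariant derivative of \<open>\<partial>\<^sub>i\<close> along the
  flow equals that of \<open>U\<close> along \<open>\<partial>\<^sub>i\<close>, so \<open>h\<^sub>s\<close> satisfies the linear equation \<open>h' = - 2 \<mu> h\<close> and
  \<open>h\<^sub>t = exp (- 2 \<integral> \<mu>) h\<^sub>0\<close>. In particular the slices stay spacelike; the screen shape
  operator is therefore \<open>\<mu>\<close> times the identity of an \<open>n\<close>-dimensional space, \<open>\<theta> = - n \<mu>\<close>, and
  \<open>sqrt (det h\<^sub>t) = exp (\<integral> \<theta>) sqrt (det h\<^sub>0)\<close>. The initial value \<open>\<Phi> p 0 = p\<close> rests on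
  uniqueness of geodesics with vanishing initial velocity, the only place where the geodesic
  equation enters. Volumes are compared on a finite family of disjoint pieces, each contained in
  one parametrization; change of variables makes the result independent of the family.
\<close>

section \<open>Calculus of smooth maps\<close>

text \<open>Much of the length comes from notions given by definite descriptions: the Christoffel
  symbols, the covariant derivative of a field on \<open>\<Sigma>\<close>, the shape operator and
  the volume measure can be used only after existence and uniqueness are shown. For
  \<open>cov_deriv_on\<close> this is the crux: it picks any curve in the given direction, so
  \<open>U\<close> must be extended differentiably off \<open>\<Sigma>\<close> before its derivative
  can be computed along a convenient curve. The same concern fixes the order of the argument.
  Uniqueness of the shape operator is drawn from definiteness of the metric on the screen, and
  definiteness on the later slices is itself a result of the evolution; so the equation is solved in
  terms of \<open>\<mu>\<close>, and \<open>\<theta>\<close> comes in afterwards. Since umbilicity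
  decouples the entries of the metric, no determinant is ever differentiated. Preferred charts,
  which may jump from point to point, are the other obstacle: vectors are moved to one fixed chart
  before anything is differentiated.\<close>

lemma Ck_on_subset: "Ck_on k W f \<Longrightarrow> W' \<subseteq> W \<Longrightarrow> Ck_on k W' f"
  by (induction k arbitrary: f) (auto intro: continuous_on_subset)

lemma smooth_on_subset: "smooth_on W f \<Longrightarrow> W' \<subseteq> W \<Longrightarrow> smooth_on W' f"
  unfolding smooth_on_def using Ck_on_subset by blast

lemma frechet_derivative_eq: "(f has_derivative f') (at x) \<Longrightarrow> frechet_derivative f (at x) = f'"
  by (metis frechet_derivative_at)

lemma Ck_on_cong:
  assumes "open W" "\<And>x. x \<in> W \<Longrightarrow> f x = g x" "Ck_on k W f"
  shows "Ck_on k W g"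
  using assms(2,3)
proof (induction k arbitrary: f g)
  case 0
  then show ?case using continuous_on_cong by auto
next
  case (Suc k)
  \<comment> \<open>An equivalence for every \<open>D\<close> rather than mere differentiability: it
    makes the choice operators inside the two \<open>frechet_derivative\<close> terms pick the same
    map.\<close>
  have der: "(g has_derivative D) (at x) \<longleftrightarrow> (f has_derivative D) (at x)" if "x \<in> W" for x D
    using that assms(1) Suc.prems(1)
    by (metis (no_types, lifting) has_derivative_transform_within_open)
  have fd: "frechet_derivative g (at x) = frechet_derivative f (at x)" if "x \<in> W" for x
    unfolding frechet_derivative_def using der[OF that] by simp
  have "Ck_on k W (\<lambda>x. frechet_derivative g (at x) v)" for v
    by (rule Suc.IH[of "\<lambda>x. frechet_derivative f (at x) v"]) (use fd Suc.prems in auto)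
  moreover have "g differentiable (at x)" if "x \<in> W" for x
    using that Suc.prems(2) der[OF that] unfolding differentiable_def Ck_on.simps by blast
  ultimately show ?case by auto
qed

lemma smooth_on_cong:
  "open W \<Longrightarrow> (\<And>x. x \<in> W \<Longrightarrow> f x = g x) \<Longrightarrow> smooth_on W f \<Longrightarrow> smooth_on W g"
  unfolding smooth_on_def by (blast intro: Ck_on_cong)

lemma Ck_on_local:
  assumes "\<And>x. x \<in> W \<Longrightarrow> \<exists>T. open T \<and> x \<in> T \<and> Ck_on k T f"
  shows "Ck_on k W f"
  using assms
proof (induction k arbitrary: f)
  case 0
  then have "continuous (at x) f" if "x \<in> W" for x
    using that by (metis Ck_on.simps(1) continuous_on_eq_continuous_at)
  then show ?case by (simp add: continuous_at_imp_continuous_on)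
next
  case (Suc k)
  have "f differentiable at x" if "x \<in> W" for x
    using Suc.prems[OF that] by auto
  moreover have "Ck_on k W (\<lambda>x. frechet_derivative f (at x) v)" for v
    by (rule Suc.IH) (use Suc.prems in \<open>force\<close>)
  ultimately show ?case by simp
qed

lemma smooth_on_local:
  assumes "\<And>x. x \<in> W \<Longrightarrow> \<exists>T. open T \<and> x \<in> T \<and> smooth_on T f"
  shows "smooth_on W f"
  using assms unfolding smooth_on_def by (meson Ck_on_local)

lemma Ck_on_imp_continuous_on: "Ck_on k W f \<Longrightarrow> continuous_on W f"
  by (cases k) (auto intro: continuous_at_imp_continuous_on differentiable_imp_continuous_within)

lemma Ck_on_SucD: "Ck_on (Suc k) W f \<Longrightarrow> Ck_on k W f"
proof (induction k arbitrary: f)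
  case 0
  show ?case using Ck_on_imp_continuous_on[OF 0] by simp
qed (metis Ck_on.simps(2))

lemma smooth_on_continuous_on: "smooth_on W f \<Longrightarrow> continuous_on W f"
  unfolding smooth_on_def using Ck_on.simps(1) by blast

lemma smooth_on_differentiable: "smooth_on W f \<Longrightarrow> x \<in> W \<Longrightarrow> f differentiable (at x)"
  unfolding smooth_on_def using Ck_on.simps(2) by blast

lemma smooth_on_derivative: "smooth_on W f \<Longrightarrow> smooth_on W (\<lambda>x. frechet_derivative f (at x) v)"
  unfolding smooth_on_def using Ck_on.simps(2) by blast

lemma smooth_on_has_derivative:
  "smooth_on W f \<Longrightarrow> x \<in> W \<Longrightarrow> (f has_derivative frechet_derivative f (at x)) (at x)"
  by (simp add: smooth_on_differentiable frechet_derivative_works[THEN iffD1])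

lemma Ck_on_const [simp]: "Ck_on k W (\<lambda>x. a)"
  by (induction k arbitrary: a) auto

lemma Ck_on_bounded_linear:
  assumes "bounded_linear f"
  shows "Ck_on k W f"
proof (cases k)
  case 0
  then show ?thesis using assms by (simp add: linear_continuous_on)
next
  case (Suc j)
  have "(f has_derivative f) (at x)" for x
    by (simp add: assms bounded_linear_imp_has_derivative)
  moreover from this have "frechet_derivative f (at x) = f" for x
    by (simp add: frechet_derivative_eq)
  ultimately show ?thesis using Suc by (auto simp: differentiable_def)
qed

lemma Ck_on_add:
  assumes "open W" "Ck_on k W f" "Ck_on k W g"
  shows "Ck_on k W (\<lambda>x. f x + g x)"
  using assms(2,3)
proof (induction k arbitrary: f g)
  case (Suc k)
  have "frechet_derivative (\<lambda>x. f x + g x) (at x) v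
      = frechet_derivative f (at x) v + frechet_derivative g (at x) v" if "x \<in> W" for x v
    using Suc.prems that
    by (subst frechet_derivative_eq[OF has_derivative_add])
      (auto simp flip: frechet_derivative_works)
  moreover have "Ck_on k W (\<lambda>x. frechet_derivative f (at x) v + frechet_derivative g (at x) v)" for v
    by (rule Suc.IH) (use Suc.prems in auto)
  ultimately have "Ck_on k W (\<lambda>x. frechet_derivative (\<lambda>x. f x + g x) (at x) v)" for v
    by (intro Ck_on_cong[OF assms(1) _ \<open>Ck_on k W (\<lambda>x. frechet_derivative f (at x) v + frechet_derivative g (at x) v)\<close>]) simp
  then show ?case using Suc.prems by auto
qed (auto intro: continuous_intros)

lemma Ck_on_bilinear:
  assumes "bounded_bilinear P" "open W" "Ck_on k W f" "Ck_on k W g"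
  shows "Ck_on k W (\<lambda>x. P (f x) (g x))"
  using assms(3,4)
proof (induction k arbitrary: f g)
  case 0
  then show ?case by (simp add: bounded_bilinear.continuous_on[OF assms(1)])
next
  case (Suc k)
  have D: "((\<lambda>x. P (f x) (g x)) has_derivative
      (\<lambda>h. P (f x) (frechet_derivative g (at x) h) + P (frechet_derivative f (at x) h) (g x))) (at x)"
    if "x \<in> W" for x
    using Suc.prems that
    by (intro bounded_bilinear.FDERIV[OF assms(1)]) (auto intro: frechet_derivative_works[THEN iffD1])
  have "Ck_on k W (\<lambda>x. P (f x) (frechet_derivative g (at x) v)
      + P (frechet_derivative f (at x) v) (g x))" for v
    by (intro Ck_on_add[OF assms(2)] Suc.IH Ck_on_SucD[OF Suc.prems(1)] Ck_on_SucD[OF Suc.prems(2)])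
      (use Suc.prems in auto)
  then have "Ck_on k W (\<lambda>x. frechet_derivative (\<lambda>x. P (f x) (g x)) (at x) v)" for v
    by (rule Ck_on_cong[OF assms(2), rotated]) (simp add: frechet_derivative_eq[OF D])
  then show ?case using D by (auto simp: differentiable_def)
qed

lemma Ck_on_sum:
  assumes "open W" "\<And>i. i \<in> I \<Longrightarrow> Ck_on k W (f i)"
  shows "Ck_on k W (\<lambda>x. \<Sum>i\<in>I. f i x)"
  using assms(2)
  by (induction I rule: infinite_finite_induct) (auto intro!: Ck_on_add[OF assms(1)])

lemma Ck_on_compose_linear:
  assumes "bounded_linear L" "open W" "Ck_on k W f"
  shows "Ck_on k W (\<lambda>x. L (f x))"
  using assms(3)
proof (induction k arbitrary: f)
  case 0
  then show ?case using assms(1) by (simp add: bounded_linear.continuous_on)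
next
  case (Suc k)
  have D: "((\<lambda>x. L (f x)) has_derivative (\<lambda>h. L (frechet_derivative f (at x) h))) (at x)"
    if "x \<in> W" for x
    using Suc.prems that
    by (intro bounded_linear.has_derivative[OF assms(1)]) (auto intro: frechet_derivative_works[THEN iffD1])
  have "Ck_on k W (\<lambda>x. L (frechet_derivative f (at x) v))" for v
    by (intro Suc.IH) (use Suc.prems in auto)
  then have "Ck_on k W (\<lambda>x. frechet_derivative (\<lambda>x. L (f x)) (at x) v)" for v
    by (rule Ck_on_cong[OF assms(2), rotated]) (simp add: frechet_derivative_eq[OF D])
  then show ?case using D by (auto simp: differentiable_def)
qed

lemma linear_expansion:
  fixes L :: "'a::euclidean_space \<Rightarrow> 'b::real_vector"
  assumes "linear L"
  shows "L v = (\<Sum>b\<in>Basis. (v \<bullet> b) *\<^sub>R L b)"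
  by (metis (no_types, lifting) assms euclidean_representation linear_sum linear_cmul sum.cong)

text \<open>The chain rule gives a derivative of \<open>f\<close> at \<open>g x\<close> applied to a
  vector that varies with \<open>x\<close> too. Expanding this vector in the basis leaves a finite
  sum of products, to which the product rule and the induction hypothesis apply.\<close>

lemma Ck_on_compose:
  assumes "open W" "g ` W \<subseteq> W'" "Ck_on k W' f" "Ck_on k W g"
  shows "Ck_on k W (\<lambda>x. f (g x))"
  using assms(3,4)
proof (induction k arbitrary: f)
  case 0
  then show ?case using assms(2) continuous_on_compose2 by auto
next
  case (Suc k)
  have D: "((\<lambda>x. f (g x)) has_derivative
      (\<lambda>h. frechet_derivative f (at (g x)) (frechet_derivative g (at x) h))) (at x)"
    if "x \<in> W" for x
    using Suc.prems that assms(2)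
    by (intro has_derivative_compose[of g _ x UNIV f]) (auto intro: frechet_derivative_works[THEN iffD1])
  have "Ck_on k W (\<lambda>x. \<Sum>b\<in>Basis. (frechet_derivative g (at x) v \<bullet> b) *\<^sub>R frechet_derivative f (at (g x)) b)" for v
  proof (intro Ck_on_sum[OF assms(1)] Ck_on_bilinear[OF bounded_bilinear_scaleR assms(1)])
    fix b
    show "Ck_on k W (\<lambda>x. frechet_derivative g (at x) v \<bullet> b)"
      by (rule Ck_on_compose_linear[OF bounded_linear_inner_left assms(1)]) (use Suc.prems in auto)
    show "Ck_on k W (\<lambda>x. frechet_derivative f (at (g x)) b)"
      by (rule Suc.IH) (use Suc.prems Ck_on_SucD in auto)
  qed
  then have "Ck_on k W (\<lambda>x. frechet_derivative (\<lambda>x. f (g x)) (at x) v)" for v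
  proof (rule Ck_on_cong[OF assms(1), rotated])
    fix x assume x: "x \<in> W"
    then have "linear (frechet_derivative f (at (g x)))"
      using assms(2) Suc.prems by (intro linear_frechet_derivative) auto
    from linear_expansion[OF this, of "frechet_derivative g (at x) v"]
    show "(\<Sum>b\<in>Basis. (frechet_derivative g (at x) v \<bullet> b) *\<^sub>R frechet_derivative f (at (g x)) b)
        = frechet_derivative (\<lambda>x. f (g x)) (at x) v"
      using frechet_derivative_eq[OF D[OF x]] by simp
  qed
  then show ?case using D by (auto simp: differentiable_def)
qed

lemma Ck_on_Pair:
  assumes "open W" "Ck_on k W f" "Ck_on k W g"
  shows "Ck_on k W (\<lambda>x. (f x, g x))"
proof -
  have "Ck_on k W (\<lambda>x. (f x, 0) + (0, g x))"
    by (intro Ck_on_add Ck_on_compose_linear[of "\<lambda>y. (y, 0)"] Ck_on_compose_linear[of "\<lambda>y. (0, y)"] assms)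
      (auto intro!: bounded_linear_intros)
  then show ?thesis by simp
qed

lemma smooth_on_const [simp]: "smooth_on W (\<lambda>x. a)"
  by (simp add: smooth_on_def)

lemma smooth_on_bounded_linear: "bounded_linear f \<Longrightarrow> smooth_on W f"
  by (simp add: smooth_on_def Ck_on_bounded_linear)

lemma smooth_on_ident [simp]: "smooth_on W (\<lambda>x. x)"
  by (rule smooth_on_bounded_linear) (rule bounded_linear_ident)

lemma smooth_on_add:
  "open W \<Longrightarrow> smooth_on W f \<Longrightarrow> smooth_on W g \<Longrightarrow> smooth_on W (\<lambda>x. f x + g x)"
  by (simp add: smooth_on_def Ck_on_add)

lemma smooth_on_sum:
  "open W \<Longrightarrow> (\<And>i. i \<in> I \<Longrightarrow> smooth_on W (f i)) \<Longrightarrow> smooth_on W (\<lambda>x. \<Sum>i\<in>I. f i x)"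
  by (simp add: smooth_on_def Ck_on_sum)

lemma smooth_on_scaleR:
  "open W \<Longrightarrow> smooth_on W f \<Longrightarrow> smooth_on W g \<Longrightarrow> smooth_on W (\<lambda>x. f x *\<^sub>R g x)"
  by (simp add: smooth_on_def Ck_on_bilinear[OF bounded_bilinear_scaleR])

lemma smooth_on_compose_linear:
  "bounded_linear L \<Longrightarrow> open W \<Longrightarrow> smooth_on W f \<Longrightarrow> smooth_on W (\<lambda>x. L (f x))"
  by (simp add: smooth_on_def Ck_on_compose_linear)

lemma smooth_on_compose:
  "open W \<Longrightarrow> g ` W \<subseteq> W' \<Longrightarrow> smooth_on W' f \<Longrightarrow> smooth_on W g \<Longrightarrow> smooth_on W (\<lambda>x. f (g x))"
  unfolding smooth_on_def using Ck_on_compose by blast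

lemma smooth_on_Pair:
  "open W \<Longrightarrow> smooth_on W f \<Longrightarrow> smooth_on W g \<Longrightarrow> smooth_on W (\<lambda>x. (f x, g x))"
  by (simp add: smooth_on_def Ck_on_Pair)

text \<open>Here the base point and the vector both move, as in the second component of a tangent
  map; this is what makes the transition maps of the tangent bundle smooth.\<close>

lemma smooth_on_derivative_along:
  assumes "open W" "g ` W \<subseteq> W'" "smooth_on W' f" "smooth_on W g" "smooth_on W v"
  shows "smooth_on W (\<lambda>x. frechet_derivative f (at (g x)) (v x))"
proof -
  have "smooth_on W (\<lambda>x. \<Sum>b\<in>Basis. (v x \<bullet> b) *\<^sub>R frechet_derivative f (at (g x)) b)"
    by (intro smooth_on_sum smooth_on_scaleR smooth_on_compose_linear[OF bounded_linear_inner_left]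
        smooth_on_compose[OF _ assms(2) smooth_on_derivative] assms)
  then show ?thesis
  proof (rule smooth_on_cong[OF assms(1), rotated])
    fix x assume "x \<in> W"
    then have "linear (frechet_derivative f (at (g x)))"
      using assms(2,3) by (intro linear_frechet_derivative smooth_on_differentiable) auto
    from linear_expansion[OF this, of "v x"]
    show "(\<Sum>b\<in>Basis. (v x \<bullet> b) *\<^sub>R frechet_derivative f (at (g x)) b) = frechet_derivative f (at (g x)) (v x)"
      by simp
  qed
qed


section \<open>Symmetry of second derivatives\<close>

lemma second_difference_mvt:
  fixes F :: "'e::euclidean_space \<Rightarrow> real"
  assumes "smooth_on W F" "h > 0"
    and W: "\<And>s r. s \<in> {0..h} \<Longrightarrow> r \<in> {0..h} \<Longrightarrow> x + s *\<^sub>R u + r *\<^sub>R v \<in> W"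
  shows "\<exists>s\<in>{0..h}. \<exists>r\<in>{0..h}. F (x + h *\<^sub>R u + h *\<^sub>R v) - F (x + h *\<^sub>R u) - F (x + h *\<^sub>R v) + F x
    = h * (h * frechet_derivative (\<lambda>y. frechet_derivative F (at y) u) (at (x + s *\<^sub>R u + r *\<^sub>R v)) v)"
proof -
  let ?D = "\<lambda>y. frechet_derivative F (at y)"
  define g where "g s = F (x + s *\<^sub>R u + h *\<^sub>R v) - F (x + s *\<^sub>R u + 0 *\<^sub>R v)" for s
  have dF: "((\<lambda>s. F (x + s *\<^sub>R u + r *\<^sub>R v)) has_real_derivative ?D (x + s *\<^sub>R u + r *\<^sub>R v) u) (at s)"
    if "s \<in> {0..h}" "r \<in> {0..h}" for s r
  proof -
    have lin: "linear (?D (x + s *\<^sub>R u + r *\<^sub>R v))"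
      using assms(1) W that by (intro linear_frechet_derivative smooth_on_differentiable) auto
    have "((\<lambda>s. F (x + s *\<^sub>R u + r *\<^sub>R v)) has_derivative (\<lambda>k. ?D (x + s *\<^sub>R u + r *\<^sub>R v) (k *\<^sub>R u))) (at s)"
      by (rule has_derivative_compose[of "\<lambda>s. x + s *\<^sub>R u + r *\<^sub>R v" _ s UNIV F, OF _ smooth_on_has_derivative[OF assms(1)]])
        (use W that in \<open>auto intro!: derivative_eq_intros\<close>)
    then show ?thesis
      unfolding has_field_derivative_def using lin by (simp add: linear_cmul mult_commute_abs)
  qed
  have dG: "((\<lambda>r. ?D (x + s *\<^sub>R u + r *\<^sub>R v) u) has_real_derivative
      frechet_derivative (\<lambda>y. ?D y u) (at (x + s *\<^sub>R u + r *\<^sub>R v)) v) (at r)"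
    if "s \<in> {0..h}" "r \<in> {0..h}" for s r
  proof -
    have sm: "smooth_on W (\<lambda>y. ?D y u)" using assms(1) by (rule smooth_on_derivative)
    have lin: "linear (frechet_derivative (\<lambda>y. ?D y u) (at (x + s *\<^sub>R u + r *\<^sub>R v)))"
      using sm W that by (intro linear_frechet_derivative smooth_on_differentiable) auto
    have "((\<lambda>r. ?D (x + s *\<^sub>R u + r *\<^sub>R v) u) has_derivative
       (\<lambda>k. frechet_derivative (\<lambda>y. ?D y u) (at (x + s *\<^sub>R u + r *\<^sub>R v)) (k *\<^sub>R v))) (at r)"
      by (rule has_derivative_compose[of "\<lambda>r. x + s *\<^sub>R u + r *\<^sub>R v" _ r UNIV "\<lambda>y. ?D y u", OF _ smooth_on_has_derivative[OF sm]])
        (use W that in \<open>auto intro!: derivative_eq_intros\<close>)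
    then show ?thesis
      unfolding has_field_derivative_def using lin by (simp add: linear_cmul mult_commute_abs)
  qed
  have "\<exists>s. 0 < s \<and> s < h \<and> g h - g 0 = (h - 0) * (?D (x + s *\<^sub>R u + h *\<^sub>R v) u - ?D (x + s *\<^sub>R u + 0 *\<^sub>R v) u)"
    using assms(2) unfolding g_def by (intro MVT2 DERIV_diff dF) auto
  then obtain s where s: "0 < s" "s < h"
    and gs: "g h - g 0 = h * (?D (x + s *\<^sub>R u + h *\<^sub>R v) u - ?D (x + s *\<^sub>R u + 0 *\<^sub>R v) u)" by auto
  have "\<exists>r. 0 < r \<and> r < h \<and> ?D (x + s *\<^sub>R u + h *\<^sub>R v) u - ?D (x + s *\<^sub>R u + 0 *\<^sub>R v) u
      = (h - 0) * frechet_derivative (\<lambda>y. ?D y u) (at (x + s *\<^sub>R u + r *\<^sub>R v)) v"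
    using assms(2) s by (intro MVT2 dG) auto
  then obtain r where "0 < r" "r < h"
    "?D (x + s *\<^sub>R u + h *\<^sub>R v) u - ?D (x + s *\<^sub>R u + 0 *\<^sub>R v) u
      = h * frechet_derivative (\<lambda>y. ?D y u) (at (x + s *\<^sub>R u + r *\<^sub>R v)) v" by auto
  with s gs show ?thesis
    by (intro bexI[of _ s] bexI[of _ r]) (auto simp: g_def)
qed

text \<open>The second difference of \<open>F\<close> over a parallelogram is symmetric in
  \<open>u\<close> and \<open>v\<close>, and by the mean value theorem it equals
  \<open>h * h\<close> times either mixed derivative at some point of the parallelogram. If the two
  mixed derivatives differed at \<open>x\<close>, continuity would keep them apart on a small
  parallelogram.\<close>

lemma symmetric_second_derivative_real:
  fixes F :: "'e::euclidean_space \<Rightarrow> real"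
  assumes F: "smooth_on W F" and "open W" "x \<in> W"
  shows "frechet_derivative (\<lambda>y. frechet_derivative F (at y) u) (at x) v
    = frechet_derivative (\<lambda>y. frechet_derivative F (at y) v) (at x) u"
proof (rule ccontr)
  let ?H = "\<lambda>u v y. frechet_derivative (\<lambda>y. frechet_derivative F (at y) u) (at y) v"
  assume ne: "?H u v x \<noteq> ?H v u x"
  define d where "d = \<bar>?H u v x - ?H v u x\<bar>"
  have cont: "isCont (?H a b) x" for a b
    using smooth_on_continuous_on[OF smooth_on_derivative[OF smooth_on_derivative[OF F]]] assms(2,3)
    by (simp add: continuous_on_eq_continuous_at)
  have d: "d / 2 > 0" using ne by (simp add: d_def)
  obtain e1 where e1: "e1 > 0" "\<And>y. dist y x < e1 \<Longrightarrow> dist (?H u v y) (?H u v x) < d / 2"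
    using cont[of u v] d unfolding continuous_at_eps_delta by (metis dist_commute)
  obtain e2 where e2: "e2 > 0" "\<And>y. dist y x < e2 \<Longrightarrow> dist (?H v u y) (?H v u x) < d / 2"
    using cont[of v u] d unfolding continuous_at_eps_delta by (metis dist_commute)
  obtain e3 where e3: "e3 > 0" "ball x e3 \<subseteq> W" using assms(2,3) open_contains_ball by blast
  define e where "e = min e1 (min e2 e3)"
  \<comment> \<open>With \<open>h = e / (2 * K)\<close> the whole parallelogram stays within
    distance \<open>e\<close> of \<open>x\<close>; the summand \<open>1\<close> keeps
    \<open>K\<close> positive when \<open>u\<close> and \<open>v\<close> vanish.\<close>
  define K where "K = norm u + norm v + 1"
  have K: "K > 0" by (simp add: K_def add_nonneg_pos)
  define h where "h = e / (2 * K)"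
  have e: "e > 0" using e1 e2 e3 by (simp add: e_def)
  then have h: "h > 0" using K by (simp add: h_def)
  have near: "dist (x + s *\<^sub>R a + r *\<^sub>R b) x < e"
    if "s \<in> {0..h}" "r \<in> {0..h}" "norm a + norm b = norm u + norm v" for s r a b
  proof -
    have "dist (x + s *\<^sub>R a + r *\<^sub>R b) x \<le> norm (s *\<^sub>R a) + norm (r *\<^sub>R b)"
      by (simp only: dist_norm add.assoc add_diff_cancel_left' norm_triangle_ineq)
    also have "\<dots> \<le> h * norm a + h * norm b"
      using that by (auto intro!: add_mono mult_right_mono)
    also have "\<dots> = h * (norm u + norm v)" using that by (simp flip: distrib_left)
    also have "\<dots> < h * (2 * K)" using h by (auto simp: K_def add_nonneg_pos)
    also have "\<dots> = e" using K by (simp add: h_def)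
    finally show ?thesis .
  qed
  have inW: "y \<in> W" if "dist y x < e" for y
    using that e3 by (auto simp: e_def dist_commute)
  obtain s r where 1: "s \<in> {0..h}" "r \<in> {0..h}" "F (x + h *\<^sub>R u + h *\<^sub>R v) - F (x + h *\<^sub>R u) - F (x + h *\<^sub>R v) + F x
    = h * (h * ?H u v (x + s *\<^sub>R u + r *\<^sub>R v))"
    using second_difference_mvt[OF F h, of x u v] near inW by blast
  obtain s' r' where 2: "s' \<in> {0..h}" "r' \<in> {0..h}" "F (x + h *\<^sub>R v + h *\<^sub>R u) - F (x + h *\<^sub>R v) - F (x + h *\<^sub>R u) + F x
    = h * (h * ?H v u (x + s' *\<^sub>R v + r' *\<^sub>R u))"
    using second_difference_mvt[OF F h, of x v u] near[where a=v and b=u] inW by (metis add.commute)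
  have "h * (h * ?H u v (x + s *\<^sub>R u + r *\<^sub>R v)) = h * (h * ?H v u (x + s' *\<^sub>R v + r' *\<^sub>R u))"
    unfolding 1(3)[symmetric] 2(3)[symmetric] by (simp add: algebra_simps)
  then have "?H u v (x + s *\<^sub>R u + r *\<^sub>R v) = ?H v u (x + s' *\<^sub>R v + r' *\<^sub>R u)" using h by simp
  moreover have "dist (?H u v (x + s *\<^sub>R u + r *\<^sub>R v)) (?H u v x) < d / 2"
    using near[OF 1(1,2), of u v] by (intro e1) (auto simp: e_def)
  moreover have "dist (?H v u (x + s' *\<^sub>R v + r' *\<^sub>R u)) (?H v u x) < d / 2"
    using near[OF 2(1,2), of v u] by (intro e2) (auto simp: e_def)
  ultimately show False by (simp add: d_def dist_real_def abs_if split: if_splits)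
qed

lemma symmetric_second_derivative:
  fixes f :: "'e::euclidean_space \<Rightarrow> 'h::euclidean_space"
  assumes f: "smooth_on W f" and W: "open W" "x \<in> W"
  shows "frechet_derivative (\<lambda>y. frechet_derivative f (at y) u) (at x) v
    = frechet_derivative (\<lambda>y. frechet_derivative f (at y) v) (at x) u"
proof (rule euclidean_eqI)
  fix b :: 'h
  have comp: "frechet_derivative (\<lambda>y. g y \<bullet> b) (at y) w = frechet_derivative g (at y) w \<bullet> b"
    if "smooth_on W g" "y \<in> W" for g :: "'e \<Rightarrow> 'h" and y w
    using frechet_derivative_eq[OF bounded_linear.has_derivative[OF bounded_linear_inner_left
        smooth_on_has_derivative[OF that]]] by simp
  have comp2: "frechet_derivative (\<lambda>y. frechet_derivative f (at y) u) (at x) v \<bullet> b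
      = frechet_derivative (\<lambda>y. frechet_derivative (\<lambda>y. f y \<bullet> b) (at y) u) (at x) v" for u v
  proof -
    have "((\<lambda>y. frechet_derivative f (at y) u \<bullet> b) has_derivative
        (\<lambda>v. frechet_derivative (\<lambda>y. frechet_derivative f (at y) u) (at x) v \<bullet> b)) (at x)"
      by (intro bounded_linear.has_derivative[OF bounded_linear_inner_left]
          smooth_on_has_derivative[OF smooth_on_derivative[OF f]] W)
    then have "((\<lambda>y. frechet_derivative (\<lambda>y. f y \<bullet> b) (at y) u) has_derivative
        (\<lambda>v. frechet_derivative (\<lambda>y. frechet_derivative f (at y) u) (at x) v \<bullet> b)) (at x)"
      by (rule has_derivative_transform_within_open[OF _ W]) (simp add: comp[OF f])
    from frechet_derivative_eq[OF this] show ?thesis by simp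
  qed
  show "frechet_derivative (\<lambda>y. frechet_derivative f (at y) u) (at x) v \<bullet> b
    = frechet_derivative (\<lambda>y. frechet_derivative f (at y) v) (at x) u \<bullet> b"
    unfolding comp2
    by (rule symmetric_second_derivative_real[OF _ W])
      (intro smooth_on_compose_linear[OF bounded_linear_inner_left] W f)
qed

text \<open>
  Near \<open>y a\<close> the map \<open>f\<close> expands distances by a definite factor, because its derivative there is
  injective; so \<open>y\<close> inherits Lipschitz continuity at \<open>a\<close>, and then differentiability, from \<open>f \<circ> y\<close>.
\<close>

lemma differentiable_through_immersion:
  fixes f :: "'e::euclidean_space \<Rightarrow> 'h::euclidean_space" and y :: "'c::euclidean_space \<Rightarrow> 'e"
  assumes f: "(f has_derivative f') (at (y a))" and inj: "inj f'"
    and y: "isCont y a" and k: "((\<lambda>x. f (y x)) has_derivative k') (at a)"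
  shows "y differentiable (at a)"
proof -
  have lf: "linear f'" using f has_derivative_linear by blast
  \<comment> \<open>Composition with a left inverse of \<open>f'\<close> replaces \<open>f\<close>
    by a map \<open>F\<close> between spaces of equal dimension whose derivative at
    \<open>y a\<close> is the identity.\<close>
  obtain L where L: "linear L" "L \<circ> f' = id"
    using linear_injective_left_inverse[OF lf inj] by blast
  have Lb: "bounded_linear L" using L linear_conv_bounded_linear by blast
  define F where "F x = L (f x)" for x
  have F: "(F has_derivative id) (at (y a))"
    using bounded_linear.has_derivative[OF Lb f] L(2) unfolding F_def by (simp add: o_def id_def fun_eq_iff)
  define r where "r h = (\<lambda>x. L (k' x)) h" for h
  have k: "((\<lambda>x. F (y x)) has_derivative r) (at a)"
    unfolding F_def r_def by (rule bounded_linear.has_derivative[OF Lb k])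
  then have rb: "bounded_linear r" using has_derivative_bounded_linear by blast
  obtain B where B: "B > 0" "\<And>x. norm (r x) \<le> B * norm x"
    using bounded_linear.pos_bounded[OF rb] by (metis mult.commute)
  have "(y has_derivative r) (at a)"
    unfolding has_derivative_at_alt
  proof (intro conjI rb allI impI)
    fix e :: real assume e: "e > 0"
    \<comment> \<open>The bound \<open>1/2\<close> lets \<open>e1 * norm ?Y\<close> be absorbed on
      the left, which yields the Lipschitz constant \<open>2 * (B + 1)\<close> for \<open>y\<close>
      at \<open>a\<close>; the second bound makes the product of \<open>e1\<close> with this
      constant at most \<open>e / 2\<close>.\<close>
    define e1 where "e1 = min (1/2) (e / (4 * (B + 1)))"
    have e1: "e1 > 0" "e1 \<le> 1/2" "e1 * (4 * (B + 1)) \<le> e"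
      using e B pos_le_divide_eq[of "4 * (B + 1)" e1 e] by (auto simp: e1_def simp del: distrib_left_numeral)
    define e2 where "e2 = min 1 (e / 4)"
    have e2: "e2 > 0" "e2 \<le> 1" "4 * e2 \<le> e" using e by (auto simp: e2_def)
    obtain d1 where d1: "d1 > 0" "\<And>z. norm (z - y a) < d1 \<Longrightarrow> norm (F z - F (y a) - (z - y a)) \<le> e1 * norm (z - y a)"
      using F e1 unfolding has_derivative_at_alt by auto
    obtain d2 where d2: "d2 > 0" "\<And>x. norm (x - a) < d2 \<Longrightarrow> norm (y x - y a) < d1"
      using y d1(1) unfolding continuous_at_eps_delta dist_norm by blast
    obtain d3 where d3: "d3 > 0" "\<And>x. norm (x - a) < d3 \<Longrightarrow> norm (F (y x) - F (y a) - r (x - a)) \<le> e2 * norm (x - a)"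
      using k e2 unfolding has_derivative_at_alt by auto
    show "\<exists>d>0. \<forall>x. norm (x - a) < d \<longrightarrow> norm (y x - y a - r (x - a)) \<le> e * norm (x - a)"
    proof (intro exI[of _ "min d2 d3"] conjI allI impI)
      fix x assume x: "norm (x - a) < min d2 d3"
      let ?Y = "y x - y a" and ?N = "norm (x - a)"
      have 1: "norm (F (y x) - F (y a) - ?Y) \<le> e1 * norm ?Y" using d1 d2 x by auto
      have 2: "norm (F (y x) - F (y a) - r (x - a)) \<le> e2 * ?N" using d3 x by auto
      have "?Y - r (x - a) = (F (y x) - F (y a) - r (x - a)) - (F (y x) - F (y a) - ?Y)" by simp
      then have "norm (?Y - r (x - a)) \<le> norm (F (y x) - F (y a) - r (x - a)) + norm (F (y x) - F (y a) - ?Y)"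
        by (metis norm_triangle_ineq4)
      with 1 2 have 3: "norm (?Y - r (x - a)) \<le> e1 * norm ?Y + e2 * ?N" by linarith
      have "norm ?Y \<le> norm (r (x - a)) + norm (?Y - r (x - a))"
        using norm_triangle_ineq[of "r (x - a)" "?Y - r (x - a)"] by simp
      also have "\<dots> \<le> B * ?N + (e1 * norm ?Y + e2 * ?N)" using B(2) 3 by (intro add_mono) auto
      also have "\<dots> \<le> B * ?N + (1/2 * norm ?Y + 1 * ?N)"
        using e1 e2 by (intro add_mono mult_right_mono) auto
      finally have 4: "norm ?Y \<le> 2 * (B + 1) * ?N" by (simp add: algebra_simps)
      have "norm (?Y - r (x - a)) \<le> e1 * (2 * (B + 1) * ?N) + e2 * ?N"
        using 3 mult_left_mono[OF 4, of e1] e1 by linarith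
      also have "\<dots> = (e1 * (4 * (B + 1)) / 2 + 4 * e2 / 4) * ?N" by (simp add: algebra_simps)
      also have "\<dots> \<le> e * ?N" using e1 e2 e by (intro mult_right_mono) auto
      finally show "norm (y x - y a - r (x - a)) \<le> e * norm (x - a)" .
    qed (use d2 d3 in auto)
  qed
  then show ?thesis by (auto simp: differentiable_def)
qed

section \<open>Change of variables for Lebesgue integrals over \<open>real^'n\<close>\<close>

text \<open>
  The library proves the change of variables formula only for well-ordered index types; the
  copy below of a finite type carries an arbitrary well-order and transports it to any
  finite index type.
\<close>

typedef 'a wellordered = "UNIV :: 'a set" ..

instantiation wellordered :: (finite) wellorder
begin

definition wellordered_index :: "'a wellordered \<Rightarrow> nat" where
  "wellordered_index = (SOME f. inj f) \<circ> Rep_wellordered"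

definition less_eq_wellordered :: "'a wellordered \<Rightarrow> 'a wellordered \<Rightarrow> bool" where
  "x \<le> y \<longleftrightarrow> wellordered_index x \<le> wellordered_index y"

definition less_wellordered :: "'a wellordered \<Rightarrow> 'a wellordered \<Rightarrow> bool" where
  "x < y \<longleftrightarrow> wellordered_index x < wellordered_index y"

instance
proof -
  have "\<exists>f :: 'a \<Rightarrow> nat. inj f"
    using finite_imp_inj_to_nat_seg[OF finite_class.finite_UNIV] by blast
  then have "inj (SOME f :: 'a \<Rightarrow> nat. inj f)" by (rule someI_ex)
  moreover have "inj (Rep_wellordered :: 'a wellordered \<Rightarrow> 'a)"
    by (simp add: inj_on_def Rep_wellordered_inject)
  ultimately have inj: "inj (wellordered_index :: 'a wellordered \<Rightarrow> nat)"
    unfolding wellordered_index_def by (rule inj_compose)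
  show "OFCLASS('a wellordered, wellorder_class)"
  proof
    fix P :: "'a wellordered \<Rightarrow> bool" and a :: "'a wellordered"
    assume "\<And>x. (\<And>y. y < x \<Longrightarrow> P y) \<Longrightarrow> P x"
    then show "P a"
      unfolding less_wellordered_def by (rule measure_induct_rule)
  qed (use inj in \<open>auto simp: less_eq_wellordered_def less_wellordered_def inj_def\<close>)
qed

end

instance wellordered :: (finite) finite
proof
  have "range (Abs_wellordered :: 'a \<Rightarrow> _) = UNIV"
    by (metis Rep_wellordered_inverse surjI)
  then show "finite (UNIV :: 'a wellordered set)"
    by (metis finite_class.finite_UNIV finite_imageI)
qed

lemma bij_Rep_wellordered: "bij Rep_wellordered"
  by (simp add: bij_def inj_on_def Rep_wellordered_inject type_definition.Rep_range[OF type_definition_wellordered])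

text \<open>Conjugation with \<open>f\<close> is a bijection between the permutations of the two
  index types that keeps signs and matches the terms of the Leibniz formula.\<close>

lemma det_reindex:
  fixes A :: "'a::comm_ring_1^'n^'n" and f :: "'o::finite \<Rightarrow> 'n::finite"
  assumes f: "bij f"
  shows "det (\<chi> i j. A $ f i $ f j) = det A"
proof -
  let ?m = "map_permutation UNIV f"
  have m: "?m p = f \<circ> p \<circ> inv f" for p
    unfolding map_permutation_def restrict_id_def using f by (auto simp: bij_is_surj)
  have bij: "bij_betw ?m {p. p permutes UNIV} {p. p permutes UNIV}"
  proof (rule bij_betw_byWitness[where f'="\<lambda>q. inv f \<circ> q \<circ> f"])
    show "?m ` {p. p permutes UNIV} \<subseteq> {p. p permutes UNIV}"
      using map_permutation_permutes[OF f] by auto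
    show "(\<lambda>q. inv f \<circ> q \<circ> f) ` {p. p permutes UNIV} \<subseteq> {p. p permutes UNIV}"
      using f by (auto intro!: bij_imp_permutes bij_comp bij_imp_bij_inv dest: permutes_bij)
  qed (use f in \<open>auto simp: m fun_eq_iff bij_is_inj bij_is_surj surj_f_inv_f\<close>)
  have "det A = (\<Sum>p | p permutes UNIV. of_int (sign (?m p)) * (\<Prod>i\<in>UNIV. A $ i $ ?m p i))"
    unfolding det_def by (rule sum.reindex_bij_betw[OF bij, symmetric])
  also have "\<dots> = (\<Sum>p | p permutes UNIV. of_int (sign p) * (\<Prod>i\<in>UNIV. A $ f i $ f (p i)))"
  proof (rule sum.cong[OF refl])
    fix p :: "'o \<Rightarrow> 'o" assume "p \<in> {p. p permutes UNIV}"
    then have "sign (?m p) = sign p"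
      using f by (intro sign_map_permutation) (auto simp: bij_is_inj)
    moreover have "(\<Prod>i\<in>UNIV. A $ i $ ?m p i) = (\<Prod>i\<in>UNIV. A $ f i $ f (p i))"
      using f by (subst prod.reindex_bij_betw[OF f, symmetric]) (simp add: m bij_is_inj)
    ultimately show "of_int (sign (?m p)) * (\<Prod>i\<in>UNIV. A $ i $ ?m p i)
      = of_int (sign p) * (\<Prod>i\<in>UNIV. A $ f i $ f (p i))" by simp
  qed
  also have "\<dots> = det (\<chi> i j. A $ f i $ f j)"
    unfolding det_def by simp
  finally show ?thesis ..
qed

definition reindex_vec :: "('o \<Rightarrow> 'n) \<Rightarrow> 'a^'n \<Rightarrow> 'a^'o" where
  "reindex_vec f x = (\<chi> i. x $ f i)"

lemma linear_reindex_vec: "bounded_linear (reindex_vec f :: real^'n \<Rightarrow> real^'o)"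
  unfolding linear_conv_bounded_linear[symmetric]
  by (rule linearI) (simp_all add: reindex_vec_def vec_eq_iff)

lemma borel_measurable_reindex_vec [measurable]:
  "(reindex_vec f :: real^'n \<Rightarrow> real^'o) \<in> borel_measurable borel"
  by (intro borel_measurable_continuous_onI linear_continuous_on linear_reindex_vec)

lemma reindex_vec_inv:
  assumes "bij f"
  shows "reindex_vec f (reindex_vec (inv f) x) = x" "reindex_vec (inv f) (reindex_vec f y) = y"
  by (simp_all add: reindex_vec_def inv_f_f[OF bij_is_inj[OF assms]] surj_f_inv_f[OF bij_is_surj[OF assms]])

text \<open>Relabelling coordinates sends boxes to boxes with the same side lengths, and Lebesgue
  measure is determined by its values on boxes.\<close>

lemma distr_lborel_reindex_vec:
  fixes f :: "'o::finite \<Rightarrow> 'n::finite"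
  assumes f: "bij f"
  shows "distr lborel borel (reindex_vec f :: real^'n \<Rightarrow> real^'o) = lborel"
proof (rule lborel_eqI[symmetric])
  fix l u :: "real^'o"
  assume le: "\<And>b. b \<in> Basis \<Longrightarrow> l \<bullet> b \<le> u \<bullet> b"
  let ?T = "reindex_vec (inv f) :: real^'o \<Rightarrow> real^'n"
  have le': "l $ i \<le> u $ i" for i
    using le[of "axis i 1"] by (simp add: inner_axis axis_in_Basis_iff)
  have pre: "reindex_vec f -` box l u = box (?T l) (?T u)"
    using f by (auto simp: mem_box_cart reindex_vec_def bij_is_inj) (metis bij_inv_eq_iff)+
  have "emeasure (distr lborel borel (reindex_vec f)) (box l u) = emeasure lborel (box (?T l) (?T u))"
    by (subst emeasure_distr) (auto simp: pre)
  also have "\<dots> = ennreal (\<Prod>b\<in>Basis. (?T u - ?T l) \<bullet> b)"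
    by (rule emeasure_lborel_box) (use le' in \<open>auto simp: Basis_vec_def inner_axis reindex_vec_def\<close>)
  also have "(\<Prod>b\<in>Basis. (?T u - ?T l) \<bullet> b) = (\<Prod>i\<in>UNIV. (u - l) $ inv f i)"
    unfolding Basis_vec_def
    by (subst prod.UNION_disjoint) (auto simp: axis_eq_axis inner_axis reindex_vec_def)
  also have "\<dots> = (\<Prod>i\<in>UNIV. (u - l) $ i)"
    by (rule prod.reindex_bij_betw[OF bij_imp_bij_inv[OF f]])
  also have "\<dots> = (\<Prod>b\<in>Basis. (u - l) \<bullet> b)"
    unfolding Basis_vec_def
    by (subst prod.UNION_disjoint) (auto simp: axis_eq_axis inner_axis)
  finally show "emeasure (distr lborel borel (reindex_vec f)) (box l u) = (\<Prod>b\<in>Basis. (u - l) \<bullet> b)" .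
qed simp

text \<open>Translates between absolute integrability for the gauge integral and the extended
  nonnegative integral. The value \<open>\<infinity>\<close> in the other case allows a change of
  variables formula without integrability assumptions.\<close>

lemma nn_integral_eq_set_integral:
  fixes f :: "'a::euclidean_space \<Rightarrow> real"
  assumes meas: "(\<lambda>x. indicator S x * f x) \<in> borel_measurable borel"
    and nonneg: "\<And>x. x \<in> S \<Longrightarrow> 0 \<le> f x"
  shows "(\<integral>\<^sup>+x\<in>S. ennreal (f x) \<partial>lborel) =
    (if f absolutely_integrable_on S then ennreal (integral S f) else \<infinity>)"
proof -
  let ?F = "\<lambda>x. indicator S x * f x"
  have eq: "(\<integral>\<^sup>+x\<in>S. ennreal (f x) \<partial>lborel) = (\<integral>\<^sup>+x. ennreal (?F x) \<partial>lborel)"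
    by (intro nn_integral_cong) (auto simp: indicator_def)
  \<comment> \<open>\<open>absolutely_integrable_on\<close> refers to the completed measure; Borel
    measurability brings the condition back to \<open>lborel\<close>.\<close>
  have int: "f absolutely_integrable_on S \<longleftrightarrow> integrable lborel ?F"
    using meas by (simp add: set_integrable_def integrable_completion)
  show ?thesis
  proof (cases "integrable lborel ?F")
    case True
    have "(\<integral>\<^sup>+x. ennreal (?F x) \<partial>lborel) = ennreal (integral\<^sup>L lborel ?F)"
      using True nonneg by (intro nn_integral_eq_integral) (auto simp: indicator_def)
    also have "integral\<^sup>L lborel ?F = integral S f"
      using True int set_lebesgue_integral_eq_integral(2)[of S f] meas
      by (simp add: set_lebesgue_integral_def integral_completion)
    finally show ?thesis using True int eq by simp
  next
    case False
    have "(\<integral>\<^sup>+x. ennreal (?F x) \<partial>lborel) = (\<integral>\<^sup>+x. ennreal (norm (?F x)) \<partial>lborel)"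
      using nonneg by (intro nn_integral_cong) (auto simp: indicator_def)
    moreover have "\<not> (\<integral>\<^sup>+x. ennreal (norm (?F x)) \<partial>lborel) < \<infinity>"
      using False meas by (simp add: integrable_iff_bounded)
    ultimately show ?thesis
      using False int eq by (simp add: not_less top_unique)
  qed
qed

lemma nn_integral_change_of_variables_wellorder:
  fixes g :: "real^'n::{finite,wellorder} \<Rightarrow> real^'n::_" and f :: "real^'n::_ \<Rightarrow> real"
  assumes S: "S \<in> sets borel" and der: "\<And>x. x \<in> S \<Longrightarrow> (g has_derivative g' x) (at x)"
    and inj: "inj_on g S" and nonneg: "\<And>x. x \<in> S \<Longrightarrow> 0 \<le> f (g x)"
    and meas: "(\<lambda>y. indicator (g ` S) y * f y) \<in> borel_measurable borel"
      "(\<lambda>x. indicator S x * (\<bar>det (matrix (g' x))\<bar> * f (g x))) \<in> borel_measurable borel"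
  shows "(\<integral>\<^sup>+y\<in>g ` S. ennreal (f y) \<partial>lborel)
    = (\<integral>\<^sup>+x\<in>S. ennreal (\<bar>det (matrix (g' x))\<bar> * f (g x)) \<partial>lborel)"
proof -
  \<comment> \<open>The change of variables theorem is about vector-valued integrands, so
    \<open>f\<close> is regarded as a map into \<open>real^1\<close>. Being stated for every value
    \<open>b\<close>, it transfers integrability and the value of the integral at the same
    time.\<close>
  let ?f = "\<lambda>x. vec (f x) :: real^1"
  let ?h = "\<lambda>x. \<bar>det (matrix (g' x))\<bar> * f (g x)"
  have "(\<lambda>x. \<bar>det (matrix (g' x))\<bar> *\<^sub>R ?f (g x)) absolutely_integrable_on S \<and>
     integral S (\<lambda>x. \<bar>det (matrix (g' x))\<bar> *\<^sub>R ?f (g x)) = b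
     \<longleftrightarrow> ?f absolutely_integrable_on (g ` S) \<and> integral (g ` S) ?f = b" for b
    by (rule has_absolute_integral_change_of_variables[OF _ has_derivative_at_withinI[OF der] inj])
      (use S in auto)
  from this[of "vec b" for b]
  have *: "?h absolutely_integrable_on S \<and> integral S ?h = b
     \<longleftrightarrow> f absolutely_integrable_on (g ` S) \<and> integral (g ` S) f = b" for b
    unfolding absolutely_integrable_on_1_iff integral_on_1_eq by (simp add: vec_eq_iff)
  have iff: "?h absolutely_integrable_on S \<longleftrightarrow> f absolutely_integrable_on (g ` S)"
    using * by blast
  have eq: "integral S ?h = integral (g ` S) f" if "f absolutely_integrable_on (g ` S)"
    using * that by blast
  have 1: "(\<integral>\<^sup>+y\<in>g ` S. ennreal (f y) \<partial>lborel) =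
    (if f absolutely_integrable_on g ` S then ennreal (integral (g ` S) f) else \<infinity>)"
    by (rule nn_integral_eq_set_integral[OF meas(1)]) (use nonneg in auto)
  have 2: "(\<integral>\<^sup>+x\<in>S. ennreal (?h x) \<partial>lborel) =
    (if ?h absolutely_integrable_on S then ennreal (integral S ?h) else \<infinity>)"
    by (rule nn_integral_eq_set_integral[OF meas(2)]) (use nonneg in auto)
  show ?thesis
    unfolding 1 2 iff using eq by (rule if_cong[OF refl arg_cong[of _ _ ennreal] refl, OF sym])
qed

theorem nn_integral_change_of_variables:
  fixes g :: "real^'n \<Rightarrow> real^'n" and f :: "real^'n \<Rightarrow> real"
  assumes S: "S \<in> sets borel" and der: "\<And>x. x \<in> S \<Longrightarrow> (g has_derivative g' x) (at x)"
    and inj: "inj_on g S" and nonneg: "\<And>x. x \<in> S \<Longrightarrow> 0 \<le> f (g x)"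
    and meas: "(\<lambda>y. indicator (g ` S) y * f y) \<in> borel_measurable borel"
      "(\<lambda>x. indicator S x * (\<bar>det (matrix (g' x))\<bar> * f (g x))) \<in> borel_measurable borel"
  shows "(\<integral>\<^sup>+y\<in>g ` S. ennreal (f y) \<partial>lborel)
    = (\<integral>\<^sup>+x\<in>S. ennreal (\<bar>det (matrix (g' x))\<bar> * f (g x)) \<partial>lborel)"
proof -
  let ?r = "Rep_wellordered :: 'n wellordered \<Rightarrow> 'n"
  define P :: "real^'n \<Rightarrow> real^'n wellordered" where "P = reindex_vec ?r"
  define Q :: "real^'n wellordered \<Rightarrow> real^'n" where "Q = reindex_vec (inv ?r)"
  note r = bij_Rep_wellordered
  have PQ: "P (Q x) = x" and QP: "Q (P y) = y" for x y
    unfolding P_def Q_def by (simp_all add: reindex_vec_inv[OF r])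
  have bl: "bounded_linear P" "bounded_linear Q"
    unfolding P_def Q_def by (rule linear_reindex_vec)+
  have Qm: "Q \<in> borel_measurable borel" unfolding Q_def by measurable
  have lb: "lborel = distr lborel borel Q"
    unfolding Q_def by (rule distr_lborel_reindex_vec[OF bij_imp_bij_inv[OF r], symmetric])
  have transport: "(\<integral>\<^sup>+x\<in>E. ennreal (h x) \<partial>lborel) = (\<integral>\<^sup>+x\<in>Q -` E. ennreal (h (Q x)) \<partial>lborel)"
    if "(\<lambda>x. indicator E x * h x) \<in> borel_measurable borel" for E and h :: "real^'n \<Rightarrow> real"
  proof -
    have "(\<integral>\<^sup>+x\<in>E. ennreal (h x) \<partial>lborel) = (\<integral>\<^sup>+x. ennreal (indicator E x * h x) \<partial>lborel)"
      by (intro nn_integral_cong) (auto simp: indicator_def)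
    also have "\<dots> = (\<integral>\<^sup>+x. ennreal (indicator E (Q x) * h (Q x)) \<partial>lborel)"
      using that Qm by (subst lb, subst nn_integral_distr) auto
    also have "\<dots> = (\<integral>\<^sup>+x\<in>Q -` E. ennreal (h (Q x)) \<partial>lborel)"
      by (intro nn_integral_cong) (auto simp: indicator_def)
    finally show ?thesis .
  qed
  define G where "G x = P (g (Q x))" for x
  define G' where "G' x = (\<lambda>h. P (g' (Q x) (Q h)))" for x
  have det: "det (matrix (G' x)) = det (matrix (g' (Q x)))" for x
  proof -
    have "inv ?r i = j \<longleftrightarrow> i = ?r j" for i j
      by (metis bij_inv_eq_iff[OF r])
    then have Q_axis: "Q (axis j 1) = axis (?r j) 1" for j
      unfolding Q_def reindex_vec_def axis_def by (simp add: vec_eq_iff)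
    then have "matrix (G' x) = (\<chi> i j. matrix (g' (Q x)) $ ?r i $ ?r j)"
      unfolding matrix_def G'_def Q_axis by (simp add: P_def reindex_vec_def vec_eq_iff)
    then show ?thesis using det_reindex[OF r] by simp
  qed
  have vim: "Q -` (g ` S) = G ` (Q -` S)"
    unfolding G_def using PQ QP by (auto simp: image_iff) (metis QP vimageI2)+
  have "(\<integral>\<^sup>+y\<in>g ` S. ennreal (f y) \<partial>lborel) = (\<integral>\<^sup>+y\<in>G ` (Q -` S). ennreal (f (Q y)) \<partial>lborel)"
    using transport[OF meas(1)] by (simp add: vim)
  also have "\<dots> = (\<integral>\<^sup>+x\<in>Q -` S. ennreal (\<bar>det (matrix (G' x))\<bar> * f (Q (G x))) \<partial>lborel)"
  proof (rule nn_integral_change_of_variables_wellorder)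
    show "Q -` S \<in> sets borel" using measurable_sets[OF Qm S] by simp
    show "(G has_derivative G' x) (at x)" if "x \<in> Q -` S" for x
      unfolding G_def G'_def using that
      by (intro bounded_linear.has_derivative[OF bl(1)]
          has_derivative_compose[OF bounded_linear_imp_has_derivative[OF bl(2)]] der) auto
    show "inj_on G (Q -` S)"
      using inj unfolding G_def inj_on_def by (metis PQ QP vimageE)
    show "0 \<le> f (Q (G x))" if "x \<in> Q -` S" for x
      using nonneg that by (simp add: G_def QP)
    have "(\<lambda>y. indicator (g ` S) (Q y) * f (Q y)) \<in> borel_measurable borel"
      using measurable_compose[OF Qm meas(1)] .
    then show "(\<lambda>y. indicator (G ` (Q -` S)) y * f (Q y)) \<in> borel_measurable borel"
      unfolding vim[symmetric] by (simp add: indicator_def cong: if_cong)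
    have "(\<lambda>x. indicator S (Q x) * (\<bar>det (matrix (g' (Q x)))\<bar> * f (g (Q x)))) \<in> borel_measurable borel"
      using measurable_compose[OF Qm meas(2)] .
    then show "(\<lambda>x. indicator (Q -` S) x * (\<bar>det (matrix (G' x))\<bar> * f (Q (G x)))) \<in> borel_measurable borel"
      by (simp add: indicator_def det G_def QP cong: if_cong)
  qed
  also have "\<dots> = (\<integral>\<^sup>+x\<in>S. ennreal (\<bar>det (matrix (g' x))\<bar> * f (g x)) \<partial>lborel)"
    using transport[OF meas(2)] by (simp add: det G_def QP)
  finally show ?thesis .
qed

section \<open>Smooth atlases and tangent vectors\<close>

lemma smooth_atlasD:
  assumes "smooth_atlas A" "c \<in> A"
  shows "inj_on (snd c) (fst c)" "open (snd c ` fst c)"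
    "d \<in> A \<Longrightarrow> open (snd c ` (fst c \<inter> fst d))"
    "d \<in> A \<Longrightarrow> smooth_on (snd c ` (fst c \<inter> fst d)) (snd d \<circ> chart_inv c)"
  using assms unfolding smooth_atlas_def by auto

lemma chart_inv_chart [simp]:
  "smooth_atlas A \<Longrightarrow> c \<in> A \<Longrightarrow> p \<in> fst c \<Longrightarrow> chart_inv c (snd c p) = p"
  unfolding chart_inv_def by (simp add: smooth_atlasD(1))

lemma chart_chart_inv: "x \<in> snd c ` fst c \<Longrightarrow> snd c (chart_inv c x) = x"
  unfolding chart_inv_def by (simp add: f_inv_into_f)

lemma chart_inv_in: "x \<in> snd c ` fst c \<Longrightarrow> chart_inv c x \<in> fst c"
  unfolding chart_inv_def by (simp add: inv_into_into)

lemma topspace_atlas_topology [simp]: "topspace (atlas_topology A) = carrier_of A"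
proof -
  have "fst c \<in> {fst c \<inter> snd c -` W | c W. c \<in> A \<and> open W}" if "c \<in> A" for c
    using that by (intro CollectI exI[of _ c] exI[of _ UNIV]) auto
  then show ?thesis
    unfolding atlas_topology_def topology_generated_by_topspace carrier_of_def by blast
qed

text \<open>Replaces generation by a subbasis with a test in each chart. Continuity of the
  transition maps gives open chart images for the subbasic sets; injectivity of the charts passes
  this on to intersections and recovers a set from its chart images.\<close>

lemma openin_atlas_topology_iff:
  assumes A: "smooth_atlas A"
  shows "openin (atlas_topology A) X \<longleftrightarrow>
    X \<subseteq> carrier_of A \<and> (\<forall>c\<in>A. open (snd c ` (X \<inter> fst c)))"
proof
  assume X: "openin (atlas_topology A) X"
  have "open (snd c ` (X \<inter> fst c))" if c: "c \<in> A" for c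
    using X unfolding atlas_topology_def openin_topology_generated_by_iff
  proof (induction rule: generate_topology_on.induct)
    case (Int a b)
    have "snd c ` (a \<inter> b \<inter> fst c) = snd c ` (a \<inter> fst c) \<inter> snd c ` (b \<inter> fst c)"
      using smooth_atlasD(1)[OF A c] by (auto simp: inj_on_def)
    with Int show ?case by (simp add: open_Int)
  next
    case (UN K)
    have "snd c ` (\<Union> K \<inter> fst c) = (\<Union>k\<in>K. snd c ` (k \<inter> fst c))" by auto
    with UN show ?case by (simp add: open_UN)
  next
    case (Basis s)
    then obtain d W where d: "s = fst d \<inter> snd d -` W" "d \<in> A" "open W" by auto
    let ?U = "snd c ` (fst c \<inter> fst d)"
    have "snd c ` (s \<inter> fst c) = ?U \<inter> (snd d \<circ> chart_inv c) -` W"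
      using A c d by (auto simp: image_iff)
    moreover have "open (?U \<inter> (snd d \<circ> chart_inv c) -` W)"
      using smooth_atlasD[OF A c] d by (intro continuous_open_preimage smooth_on_continuous_on) auto
    ultimately show ?case by simp
  qed simp
  moreover have "X \<subseteq> carrier_of A" using openin_subset[OF X] by simp
  ultimately show "X \<subseteq> carrier_of A \<and> (\<forall>c\<in>A. open (snd c ` (X \<inter> fst c)))" by blast
next
  assume X: "X \<subseteq> carrier_of A \<and> (\<forall>c\<in>A. open (snd c ` (X \<inter> fst c)))"
  have "X \<subseteq> (\<Union>c\<in>A. fst c \<inter> snd c -` (snd c ` (X \<inter> fst c)))"
    using X unfolding carrier_of_def by blast
  moreover have "fst c \<inter> snd c -` (snd c ` (X \<inter> fst c)) \<subseteq> X" if "c \<in> A" for c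
    using smooth_atlasD(1)[OF A that] by (auto simp: inj_on_def)
  ultimately have "X = (\<Union>c\<in>A. fst c \<inter> snd c -` (snd c ` (X \<inter> fst c)))" by blast
  moreover have "openin (atlas_topology A) (fst c \<inter> snd c -` (snd c ` (X \<inter> fst c)))" if "c \<in> A" for c
    unfolding atlas_topology_def using that X
    by (intro topology_generated_by_Basis CollectI exI[of _ c] exI[of _ "snd c ` (X \<inter> fst c)"]) auto
  then have "openin (atlas_topology A) (\<Union>c\<in>A. fst c \<inter> snd c -` (snd c ` (X \<inter> fst c)))"
    by (intro openin_Union) blast
  ultimately show "openin (atlas_topology A) X" by argo
qed

lemma openin_chart_domain: "smooth_atlas A \<Longrightarrow> c \<in> A \<Longrightarrow> openin (atlas_topology A) (fst c)"
  using smooth_atlasD(3)[of A] by (auto simp: openin_atlas_topology_iff carrier_of_def Int_commute)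

lemma chart_inv_euclidean [simp]: "chart_inv (UNIV, \<lambda>x. x) = (\<lambda>x. x)"
  unfolding chart_inv_def by (simp add: inv_into_def fun_eq_iff)

lemma smooth_atlas_euclidean: "smooth_atlas (euclidean_atlas :: ('e::euclidean_space, 'e) atlas)"
  by (simp add: smooth_atlas_def o_def)

lemma chart_at_euclidean [simp]: "chart_at euclidean_atlas x = (UNIV, \<lambda>x. x)"
  unfolding chart_at_def by (rule some_equality) auto

lemma atlas_topology_euclidean [simp]:
  "atlas_topology (euclidean_atlas :: ('e::euclidean_space, 'e) atlas) = euclidean"
  by (rule topology_eq[THEN iffD2])
    (simp add: openin_atlas_topology_iff[OF smooth_atlas_euclidean] carrier_of_def)

lemma carrier_of_euclidean [simp]: "carrier_of euclidean_atlas = UNIV"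
  by (simp add: carrier_of_def)

section \<open>Smooth maps from open sets of Euclidean spaces into a manifold\<close>

abbreviation smooth_to :: "('a, 'e::euclidean_space) atlas \<Rightarrow> 'f::euclidean_space set \<Rightarrow> ('f \<Rightarrow> 'a) \<Rightarrow> bool" where
  "smooth_to A W f \<equiv> smooth_map euclidean_atlas A W f"

lemma smooth_to_open: "smooth_to A W f \<Longrightarrow> open W"
  unfolding smooth_map_def by simp

lemma smooth_to_carrier: "smooth_to A W f \<Longrightarrow> x \<in> W \<Longrightarrow> f x \<in> carrier_of A"
  unfolding smooth_map_def continuous_map_def by auto

lemma smooth_to_continuous_map: "smooth_to A W f \<Longrightarrow> continuous_map (top_of_set W) (atlas_topology A) f"
  unfolding smooth_map_def by simp

lemma smooth_to_open_preimage:
  assumes "smooth_to A W f" "openin (atlas_topology A) X"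
  shows "open (W \<inter> f -` X)"
proof -
  have "openin (top_of_set W) {x \<in> W. f x \<in> X}"
    using openin_continuous_map_preimage[OF smooth_to_continuous_map[OF assms(1)] assms(2)] by simp
  moreover have "{x \<in> W. f x \<in> X} = W \<inter> f -` X" by auto
  ultimately show ?thesis using smooth_to_open[OF assms(1)] by (simp add: openin_open_eq)
qed

lemma smooth_to_chart:
  assumes "smooth_to A W f" "d \<in> A"
  shows "smooth_on (W \<inter> f -` fst d) (snd d \<circ> f)"
  using assms unfolding smooth_map_def by (force simp: o_def)

text \<open>Continuity into the atlas topology comes for free: once the preimages of the chart
  domains are open, any open set pulls back through the continuous coordinate expressions.\<close>

lemma smooth_toI:
  assumes A: "smooth_atlas A" and "open W" and fW: "\<And>x. x \<in> W \<Longrightarrow> f x \<in> carrier_of A"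
    and op: "\<And>d. d \<in> A \<Longrightarrow> open (W \<inter> f -` fst d)"
    and sm: "\<And>d. d \<in> A \<Longrightarrow> smooth_on (W \<inter> f -` fst d) (\<lambda>x. snd d (f x))"
  shows "smooth_to A W f"
proof -
  have "open (W \<inter> f -` X)" if X: "openin (atlas_topology A) X" for X
  proof -
    have "W \<inter> f -` X = (\<Union>d\<in>A. (W \<inter> f -` fst d) \<inter> (\<lambda>x. snd d (f x)) -` (snd d ` (X \<inter> fst d)))"
      using fW smooth_atlasD(1)[OF A] by (force simp: carrier_of_def inj_on_def)
    also have "open \<dots>"
      using X by (intro open_UN ballI continuous_open_preimage smooth_on_continuous_on sm op)
        (auto simp: openin_atlas_topology_iff[OF A])
    finally show ?thesis .
  qed
  moreover have "{x \<in> W. f x \<in> X} = W \<inter> f -` X" for X by auto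
  ultimately have "continuous_map (top_of_set W) (atlas_topology A) f"
    using fW \<open>open W\<close> by (simp add: continuous_map_def openin_open_eq)
  then show ?thesis
    using \<open>open W\<close> sm unfolding smooth_map_def by (simp add: o_def)
qed

lemma smooth_to_subset:
  assumes "smooth_atlas A" "smooth_to A W f" "open W'" "W' \<subseteq> W"
  shows "smooth_to A W' f"
proof (rule smooth_toI[OF assms(1,3)])
  fix d assume d: "d \<in> A"
  have "W' \<inter> f -` fst d = W' \<inter> (W \<inter> f -` fst d)" using assms by auto
  then show "open (W' \<inter> f -` fst d)"
    using smooth_to_open_preimage[OF assms(2) openin_chart_domain[OF assms(1) d]] assms(3) by auto
  show "smooth_on (W' \<inter> f -` fst d) (\<lambda>x. snd d (f x))"
    by (rule smooth_on_subset[OF smooth_to_chart[OF assms(2) d, unfolded o_def]]) (use assms in auto)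
qed (use smooth_to_carrier[OF assms(2)] assms(4) in auto)

lemma smooth_to_cong:
  assumes "smooth_atlas A" "smooth_to A W f" "\<And>x. x \<in> W \<Longrightarrow> f x = g x"
  shows "smooth_to A W g"
proof (rule smooth_toI[OF assms(1) smooth_to_open[OF assms(2)]])
  fix d assume d: "d \<in> A"
  have eq: "W \<inter> g -` fst d = W \<inter> f -` fst d" using assms(3) by auto
  show *: "open (W \<inter> g -` fst d)"
    unfolding eq by (rule smooth_to_open_preimage[OF assms(2) openin_chart_domain[OF assms(1) d]])
  show "smooth_on (W \<inter> g -` fst d) (\<lambda>x. snd d (g x))"
    by (rule smooth_on_cong[OF * _ smooth_to_chart[OF assms(2) d, folded eq]]) (use assms(3) in auto)
next
  show "g x \<in> carrier_of A" if "x \<in> W" for x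
    using smooth_to_carrier[OF assms(2) that] assms(3)[OF that] by simp
qed

lemma smooth_to_local:
  assumes A: "smooth_atlas A" and "open W"
    and loc: "\<And>x. x \<in> W \<Longrightarrow> \<exists>T. x \<in> T \<and> smooth_to A T f"
  shows "smooth_to A W f"
proof (rule smooth_toI[OF A \<open>open W\<close>])
  fix d assume d: "d \<in> A"
  have T: "\<exists>T. open T \<and> x \<in> T \<and> T \<subseteq> W \<inter> f -` fst d \<and> smooth_on T (\<lambda>x. snd d (f x))"
    if "x \<in> W \<inter> f -` fst d" for x
  proof -
    from that have "x \<in> W" by simp
    from loc[OF this] obtain T where T: "x \<in> T" "smooth_to A T f" by (elim exE conjE)
    let ?T = "W \<inter> (T \<inter> f -` fst d)"
    have "open ?T"
      using smooth_to_open_preimage[OF T(2) openin_chart_domain[OF A d]] \<open>open W\<close> by auto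
    moreover have "smooth_on ?T (\<lambda>x. snd d (f x))"
      by (rule smooth_on_subset[OF smooth_to_chart[OF T(2) d, unfolded o_def]]) auto
    ultimately show ?thesis using that T by blast
  qed
  show "open (W \<inter> f -` fst d)" using T by (subst open_subopen) blast
  show "smooth_on (W \<inter> f -` fst d) (\<lambda>x. snd d (f x))" by (rule smooth_on_local) (use T in blast)
next
  fix x assume "x \<in> W"
  from loc[OF this] show "f x \<in> carrier_of A" using smooth_to_carrier by (elim exE conjE)
qed

lemma smooth_to_reparam:
  assumes A: "smooth_atlas A" and f: "smooth_to A W' f" and W: "open W" and h: "smooth_on W h" "h ` W \<subseteq> W'"
  shows "smooth_to A W (\<lambda>x. f (h x))"
proof (rule smooth_toI[OF A W])
  fix d assume d: "d \<in> A"
  have "W \<inter> (\<lambda>x. f (h x)) -` fst d = W \<inter> h -` (W' \<inter> f -` fst d)" using h by auto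
  moreover have "open \<dots>"
    by (intro continuous_open_preimage[OF smooth_on_continuous_on[OF h(1)] W]
        smooth_to_open_preimage[OF f openin_chart_domain[OF A d]])
  ultimately show *: "open (W \<inter> (\<lambda>x. f (h x)) -` fst d)" by simp
  show "smooth_on (W \<inter> (\<lambda>x. f (h x)) -` fst d) (\<lambda>x. snd d (f (h x)))"
    by (rule smooth_on_compose[OF * _ smooth_to_chart[OF f d, unfolded o_def] smooth_on_subset[OF h(1)]])
      (use h in auto)
qed (use smooth_to_carrier[OF f] h in auto)

lemma smooth_to_compose_map:
  assumes A: "smooth_atlas A" and B: "smooth_atlas B"
    and F: "smooth_map B A U F" and f: "smooth_to B W f" and fW: "f ` W \<subseteq> U"
  shows "smooth_to A W (\<lambda>x. F (f x))"
proof -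
  have UO: "openin (atlas_topology B) U"
    and Fc: "continuous_map (subtopology (atlas_topology B) U) (atlas_topology A) F"
    using F by (auto simp: smooth_map_def)
  have preF: "openin (atlas_topology B) (U \<inter> F -` X)" if "openin (atlas_topology A) X" for X
  proof -
    have "openin (subtopology (atlas_topology B) U) {x \<in> topspace (subtopology (atlas_topology B) U). F x \<in> X}"
      by (rule openin_continuous_map_preimage[OF Fc that])
    moreover have "{x \<in> topspace (subtopology (atlas_topology B) U). F x \<in> X} = U \<inter> F -` X"
      using openin_subset[OF UO] by auto
    ultimately show ?thesis using UO by (simp add: openin_open_subtopology)
  qed
  have op: "open (W \<inter> (\<lambda>x. F (f x)) -` fst d)" if d: "d \<in> A" for d
  proof -
    have "W \<inter> (\<lambda>x. F (f x)) -` fst d = W \<inter> f -` (U \<inter> F -` fst d)" using fW by auto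
    then show ?thesis
      using smooth_to_open_preimage[OF f preF[OF openin_chart_domain[OF A d]]] by simp
  qed
  show ?thesis
  proof (rule smooth_toI[OF A smooth_to_open[OF f]])
    fix x assume "x \<in> W"
    then have "f x \<in> topspace (subtopology (atlas_topology B) U)"
      using fW openin_subset[OF UO] by auto
    then show "F (f x) \<in> carrier_of A"
      using Fc unfolding continuous_map_def by auto
  next
    fix d assume d: "d \<in> A"
    show "open (W \<inter> (\<lambda>x. F (f x)) -` fst d)" by (rule op[OF d])
    show "smooth_on (W \<inter> (\<lambda>x. F (f x)) -` fst d) (\<lambda>x. snd d (F (f x)))"
    proof (rule smooth_on_local)
      fix x assume x: "x \<in> W \<inter> (\<lambda>x. F (f x)) -` fst d"
      then have "f x \<in> carrier_of B" using smooth_to_carrier[OF f] by auto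
      then obtain c where c: "c \<in> B" "f x \<in> fst c" by (auto simp: carrier_of_def)
      let ?T = "(W \<inter> (\<lambda>x. F (f x)) -` fst d) \<inter> (W \<inter> f -` fst c)"
      have T: "open ?T"
        using op[OF d] smooth_to_open_preimage[OF f openin_chart_domain[OF B c(1)]] by auto
      have "smooth_on ?T (\<lambda>x. (snd d \<circ> F \<circ> chart_inv c) (snd c (f x)))"
      proof (rule smooth_on_compose[OF T, where g = "\<lambda>x. snd c (f x)"])
        show "smooth_on (snd c ` (U \<inter> fst c \<inter> F -` fst d)) (snd d \<circ> F \<circ> chart_inv c)"
          using F c d by (auto simp: smooth_map_def)
        show "(\<lambda>x. snd c (f x)) ` ?T \<subseteq> snd c ` (U \<inter> fst c \<inter> F -` fst d)"
          using fW by (intro image_subsetI imageI) auto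
        show "smooth_on ?T (\<lambda>x. snd c (f x))"
          by (rule smooth_on_subset[OF smooth_to_chart[OF f c(1), unfolded o_def]]) auto
      qed
      then have "smooth_on ?T (\<lambda>x. snd d (F (f x)))"
        by (rule smooth_on_cong[OF T, rotated]) (use B c in auto)
      then show "\<exists>T. open T \<and> x \<in> T \<and> smooth_on T (\<lambda>x. snd d (F (f x)))"
        using T x c by blast
    qed
  qed
qed

text \<open>\<open>F\<close> is smooth on \<open>N\<close> only in the sense of local smooth
  extensions, and a map with values in \<open>N\<close> does not see which extension is taken. In
  this way the exponential map on \<open>V\<close>, \<open>\<xi>\<close> on \<open>S\<close> and
  \<open>\<mu>\<close> on \<open>\<Sigma>\<close> become smooth functions of Euclidean
  parameters.\<close>

lemma smooth_to_compose_map_on: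
  assumes A: "smooth_atlas A" and B: "smooth_atlas B"
    and F: "smooth_map_on B A N F" and f: "smooth_to B W f" and fW: "f ` W \<subseteq> N"
  shows "smooth_to A W (\<lambda>x. F (f x))"
proof (rule smooth_to_local[OF A smooth_to_open[OF f]])
  fix x assume x: "x \<in> W"
  then have "f x \<in> N" using fW by auto
  from F[unfolded smooth_map_on_def, rule_format, OF this]
  obtain U G where U: "f x \<in> U" "smooth_map B A U G" "\<And>q. q \<in> N \<inter> U \<Longrightarrow> G q = F q"
    by (elim exE conjE) auto
  then have UO: "openin (atlas_topology B) U" by (auto simp: smooth_map_def)
  let ?T = "W \<inter> f -` U"
  have T: "open ?T" by (rule smooth_to_open_preimage[OF f UO])
  have "smooth_to A ?T (\<lambda>x. G (f x))"
    by (rule smooth_to_compose_map[OF A B U(2) smooth_to_subset[OF B f T]]) auto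
  then have "smooth_to A ?T (\<lambda>x. F (f x))"
    by (rule smooth_to_cong[OF A]) (use U fW in auto)
  with x U(1) show "\<exists>T. x \<in> T \<and> smooth_to A T (\<lambda>x. F (f x))" by (intro exI[of _ ?T]) simp
qed

lemma smooth_to_euclidean_iff:
  "smooth_to euclidean_atlas W f \<longleftrightarrow> open W \<and> smooth_on W f"
proof
  assume "smooth_to euclidean_atlas W f"
  then show "open W \<and> smooth_on W f"
    using smooth_to_open smooth_to_chart[of euclidean_atlas W f "(UNIV, \<lambda>x. x)"] by (auto simp: o_def)
next
  assume "open W \<and> smooth_on W f"
  then show "smooth_to euclidean_atlas W f"
    by (intro smooth_toI[OF smooth_atlas_euclidean]) auto
qed

section \<open>Differentials in charts and the atlas of the tangent bundle\<close>

abbreviation dchart :: "('a, 'e::euclidean_space) atlas \<Rightarrow> ('a, 'e) chart \<Rightarrow> 'a \<Rightarrow> 'e \<Rightarrow> 'e" where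
  "dchart A c p \<equiv> tangent_map A euclidean_atlas (snd c) p"

lemma dchart_eq:
  "dchart A c p = frechet_derivative (snd c \<circ> chart_inv (chart_at A p)) (at (snd (chart_at A p) p))"
  unfolding tangent_map_def by (simp add: fun_eq_iff o_def)

lemma chart_at:
  assumes "p \<in> carrier_of A" shows "chart_at A p \<in> A" "p \<in> fst (chart_at A p)"
proof -
  have "\<exists>c. c \<in> A \<and> p \<in> fst c" using assms by (auto simp: carrier_of_def)
  then have "chart_at A p \<in> A \<and> p \<in> fst (chart_at A p)" unfolding chart_at_def by (rule someI_ex)
  then show "chart_at A p \<in> A" "p \<in> fst (chart_at A p)" by auto
qed

lemma transition_has_derivative:
  assumes "smooth_atlas A" "c \<in> A" "d \<in> A" "p \<in> fst c" "p \<in> fst d"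
  shows "((\<lambda>x. snd d (chart_inv c x)) has_derivative
    frechet_derivative (\<lambda>x. snd d (chart_inv c x)) (at (snd c p))) (at (snd c p))"
  using smooth_on_has_derivative[OF smooth_atlasD(4)[OF assms(1-3)], of "snd c p"] assms
  by (auto simp: o_def)

lemma transition_self:
  assumes "smooth_atlas A" "c \<in> A" "p \<in> fst c"
  shows "frechet_derivative (\<lambda>x. snd c (chart_inv c x)) (at (snd c p)) v = v"
proof -
  have "((\<lambda>x. snd c (chart_inv c x)) has_derivative (\<lambda>x. x)) (at (snd c p))"
    by (rule has_derivative_transform_within_open[OF has_derivative_ident smooth_atlasD(2)[OF assms(1,2)]])
      (use assms in \<open>auto simp: chart_chart_inv\<close>)
  from frechet_derivative_eq[OF this] show ?thesis by simp
qed

lemma transition_change: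
  assumes A: "smooth_atlas A" "c \<in> A" "d \<in> A" "p \<in> fst c" "p \<in> fst d"
    and f: "((\<lambda>x. snd c (f x)) has_derivative D) (at a)" and fa: "f a = p" and T: "open T" "a \<in> T" "f ` T \<subseteq> fst c"
  shows "((\<lambda>x. snd d (f x)) has_derivative
    (\<lambda>h. frechet_derivative (\<lambda>x. snd d (chart_inv c x)) (at (snd c p)) (D h))) (at a)"
proof -
  have "((\<lambda>x. snd d (chart_inv c (snd c (f x)))) has_derivative
     (\<lambda>h. frechet_derivative (\<lambda>x. snd d (chart_inv c x)) (at (snd c p)) (D h))) (at a)"
    by (rule has_derivative_compose[OF f, of "\<lambda>x. snd d (chart_inv c x)"])
      (use transition_has_derivative[OF A] fa in simp)
  then show ?thesis
    by (rule has_derivative_transform_within_open[OF _ T(1,2)]) (use A T in auto)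
qed

lemma dchart_change:
  assumes A: "smooth_atlas A" "c \<in> A" "d \<in> A" "p \<in> fst c" "p \<in> fst d"
  shows "dchart A d p v = frechet_derivative (\<lambda>x. snd d (chart_inv c x)) (at (snd c p)) (dchart A c p v)"
proof -
  let ?e = "chart_at A p"
  have pc: "p \<in> carrier_of A" using A by (auto simp: carrier_of_def)
  note e = chart_at[OF pc]
  have "((\<lambda>x. snd d (chart_inv ?e x)) has_derivative
    (\<lambda>h. frechet_derivative (\<lambda>x. snd d (chart_inv c x)) (at (snd c p))
      (frechet_derivative (\<lambda>x. snd c (chart_inv ?e x)) (at (snd ?e p)) h))) (at (snd ?e p))"
    by (rule transition_change[OF A transition_has_derivative[OF A(1) e(1) A(2) e(2) A(4)] _ smooth_atlasD(3)[OF A(1) e(1) A(2)]])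
      (use A e in \<open>auto simp: chart_inv_in\<close>)
  from frechet_derivative_eq[OF this] show ?thesis
    unfolding dchart_eq by (simp add: o_def)
qed

lemma dchart_chart_at:
  assumes "smooth_atlas A" "p \<in> carrier_of A"
  shows "dchart A (chart_at A p) p v = v"
  using transition_self[OF assms(1) chart_at[OF assms(2)]] unfolding dchart_eq by (simp add: o_def)

lemma transition_linear:
  assumes "smooth_atlas A" "c \<in> A" "d \<in> A" "p \<in> fst c" "p \<in> fst d"
  shows "linear (frechet_derivative (\<lambda>x. snd d (chart_inv c x)) (at (snd c p)))"
  using has_derivative_linear[OF transition_has_derivative[OF assms]] .

lemma dchart_linear:
  assumes "smooth_atlas A" "c \<in> A" "p \<in> fst c"
  shows "linear (dchart A c p)"
proof -
  have "p \<in> carrier_of A" using assms by (auto simp: carrier_of_def)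
  from transition_linear[OF assms(1) chart_at(1)[OF this] assms(2) chart_at(2)[OF this] assms(3)]
  show ?thesis unfolding dchart_eq by (simp add: o_def)
qed

lemma dchart_bij:
  assumes "smooth_atlas A" "c \<in> A" "p \<in> fst c"
  shows "bij (dchart A c p)"
proof -
  let ?e = "chart_at A p"
  have pc: "p \<in> carrier_of A" using assms by (auto simp: carrier_of_def)
  note e = chart_at[OF pc]
  let ?J = "frechet_derivative (\<lambda>x. snd ?e (chart_inv c x)) (at (snd c p))"
  have J: "?J (dchart A c p v) = v" for v
    using dchart_change[OF assms(1,2) e(1) assms(3) e(2)] dchart_chart_at[OF assms(1) pc] by simp
  then have "inj (dchart A c p)" by (metis injI)
  then show ?thesis
    using linear_injective_imp_surjective[OF dchart_linear[OF assms]] by (simp add: bij_def)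
qed

text \<open>The way out of the preferred charts: \<open>tangent_map\<close> is tied to the one at
  \<open>f x\<close>, while computations take place in whatever chart suits a whole neighborhood.
  The chain rule through the transition map links the two.\<close>

lemma dchart_tangent_map:
  assumes A: "smooth_atlas A" and f: "smooth_to A W f" "x \<in> W" and c: "c \<in> A" "f x \<in> fst c"
  shows "dchart A c (f x) (tangent_map euclidean_atlas A f x u) = frechet_derivative (\<lambda>x. snd c (f x)) (at x) u"
proof -
  let ?e = "chart_at A (f x)"
  have pc: "f x \<in> carrier_of A" using c by (auto simp: carrier_of_def)
  note e = chart_at[OF pc]
  let ?D = "frechet_derivative (\<lambda>x. snd ?e (f x)) (at x)"
  have D: "((\<lambda>x. snd ?e (f x)) has_derivative ?D) (at x)"
    using smooth_on_has_derivative[OF smooth_to_chart[OF f(1) e(1)], of x] f e by (simp add: o_def)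
  have "((\<lambda>x. snd c (f x)) has_derivative
    (\<lambda>h. frechet_derivative (\<lambda>x. snd c (chart_inv ?e x)) (at (snd ?e (f x))) (?D h))) (at x)"
    by (rule transition_change[OF A e(1) c(1) e(2) c(2) D refl smooth_to_open_preimage[OF f(1) openin_chart_domain[OF A e(1)]]])
      (use f e in auto)
  from frechet_derivative_eq[OF this] show ?thesis
    unfolding dchart_eq by (simp add: tangent_map_def o_def)
qed

lemma smooth_to_has_derivative:
  assumes "smooth_to A W f" "x \<in> W" "c \<in> A" "f x \<in> fst c"
  shows "((\<lambda>x. snd c (f x)) has_derivative frechet_derivative (\<lambda>x. snd c (f x)) (at x)) (at x)"
  using smooth_on_has_derivative[OF smooth_to_chart[OF assms(1,3)], of x] assms by (simp add: o_def)

lemma tangent_map_eqI: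
  assumes A: "smooth_atlas A" and f: "smooth_to A W f" "x \<in> W" and c: "c \<in> A" "f x \<in> fst c"
    and D: "((\<lambda>x. snd c (f x)) has_derivative D) (at x)" and v: "dchart A c (f x) v = D u"
  shows "tangent_map euclidean_atlas A f x u = v"
  using dchart_tangent_map[OF A f c, of u] frechet_derivative_eq[OF D] v
  by - (rule injD[OF bij_is_inj[OF dchart_bij[OF A c]]], simp)

lemma smooth_to_chart_inv:
  assumes A: "smooth_atlas A" and c: "c \<in> A"
  shows "smooth_to A (snd c ` fst c) (chart_inv c)"
proof (rule smooth_toI[OF A smooth_atlasD(2)[OF A c]])
  fix d assume d: "d \<in> A"
  have eq: "snd c ` fst c \<inter> chart_inv c -` fst d = snd c ` (fst c \<inter> fst d)"
    using A c by (auto simp: image_iff)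
  show "open (snd c ` fst c \<inter> chart_inv c -` fst d)"
    "smooth_on (snd c ` fst c \<inter> chart_inv c -` fst d) (\<lambda>x. snd d (chart_inv c x))"
    using smooth_atlasD[OF A c] d unfolding eq by (auto simp: o_def)
next
  fix x assume "x \<in> snd c ` fst c"
  from chart_inv_in[OF this] show "chart_inv c x \<in> carrier_of A"
    using c by (auto simp: carrier_of_def)
qed

lemma tangent_map_linear:
  assumes A: "smooth_atlas A" and f: "smooth_to A W f" "x \<in> W"
  shows "linear (tangent_map euclidean_atlas A f x)"
proof -
  note e = chart_at[OF smooth_to_carrier[OF f]]
  have "tangent_map euclidean_atlas A f x = frechet_derivative (\<lambda>y. snd (chart_at A (f x)) (f y)) (at x)"
    by (simp add: tangent_map_def fun_eq_iff o_def)
  then show ?thesis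
    using has_derivative_linear[OF smooth_to_has_derivative[OF f e]] by simp
qed

lemma dchart_tangent_map_chart_inv:
  assumes A: "smooth_atlas A" and c: "c \<in> A" and x: "x \<in> snd c ` fst c"
  shows "dchart A c (chart_inv c x) (tangent_map euclidean_atlas A (chart_inv c) x u) = u"
  using dchart_tangent_map[OF A smooth_to_chart_inv[OF A c] x c chart_inv_in[OF x], of u]
    transition_self[OF A c chart_inv_in[OF x], of u] x by (simp add: chart_chart_inv)

lemma pullback_metric_chart:
  assumes A: "smooth_atlas A" and c: "c \<in> A" "p \<in> fst c"
  shows "pullback_metric A g (chart_inv c) (snd c p) (dchart A c p v) (dchart A c p w) = g p v w"
proof -
  have x: "snd c p \<in> snd c ` fst c" using c by auto
  have "tangent_map euclidean_atlas A (chart_inv c) (snd c p) (dchart A c p v) = v" for v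
    using dchart_tangent_map_chart_inv[OF A c(1) x, of "dchart A c p v"] A c
    by - (rule injD[OF bij_is_inj[OF dchart_bij[OF A c]]], simp)
  then show ?thesis unfolding pullback_metric_def using A c by simp
qed

abbreviation tchart :: "('a, 'e::euclidean_space) atlas \<Rightarrow> ('a, 'e) chart \<Rightarrow> ('a \<times> 'e, 'e \<times> 'e) chart" where
  "tchart A c \<equiv> (fst c \<times> UNIV, \<lambda>(p, v). (snd c p, dchart A c p v))"

lemma tangent_atlas_eq: "tangent_atlas A = tchart A ` A"
  by (simp add: tangent_atlas_def)

lemma tchart_image:
  assumes A: "smooth_atlas A" and c: "c \<in> A" and X: "X \<subseteq> fst c"
  shows "snd (tchart A c) ` (X \<times> UNIV) = snd c ` X \<times> UNIV"
proof -
  have "u \<in> range (dchart A c p)" if "p \<in> X" for u p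
    using bij_is_surj[OF dchart_bij[OF A c]] that X by auto
  then show ?thesis by (force simp: image_iff)
qed

lemma tchart_inj:
  assumes A: "smooth_atlas A" and c: "c \<in> A"
  shows "inj_on (snd (tchart A c)) (fst c \<times> UNIV)"
proof (rule inj_onI, clarsimp)
  fix p v q w assume *: "p \<in> fst c" "q \<in> fst c" "snd c p = snd c q" "dchart A c p v = dchart A c q w"
  then have "p = q" using smooth_atlasD(1)[OF A c] by (auto simp: inj_on_def)
  then show "p = q \<and> v = w" using * bij_is_inj[OF dchart_bij[OF A c]] by (auto simp: inj_eq)
qed

lemma chart_inv_tchart:
  assumes A: "smooth_atlas A" and c: "c \<in> A" and x: "x \<in> snd c ` fst c"
  shows "chart_inv (tchart A c) (x, u) = (chart_inv c x, tangent_map euclidean_atlas A (chart_inv c) x u)"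
  unfolding chart_inv_def[of "tchart A c"] fst_conv snd_conv
  by (rule inv_into_f_eq[OF tchart_inj[OF A c, unfolded snd_conv]])
    (use x dchart_tangent_map_chart_inv[OF A c x] in \<open>auto simp: chart_chart_inv chart_inv_in\<close>)

text \<open>A transition map of the bundle sends \<open>(x, u)\<close> to \<open>\<phi> x\<close>
  together with the derivative of \<open>\<phi>\<close> at \<open>x\<close> applied to
  \<open>u\<close>, where \<open>\<phi>\<close> is the transition map below it; this is jointly
  smooth in \<open>x\<close> and \<open>u\<close>.\<close>

lemma smooth_atlas_tangent:
  assumes A: "smooth_atlas A"
  shows "smooth_atlas (tangent_atlas A)"
  unfolding smooth_atlas_def tangent_atlas_eq
proof (intro conjI ballI; (elim imageE)?)
  fix c' c assume c: "c' = tchart A c" "c \<in> A"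
  show "inj_on (snd c') (fst c')" using tchart_inj[OF A c(2)] c(1) by simp
  show "open (snd c' ` fst c')"
    using tchart_image[OF A c(2) subset_refl] smooth_atlasD(2)[OF A c(2)] c(1) by (simp add: open_Times)
  fix d' d assume d: "d' = tchart A d" "d \<in> A"
  let ?U = "snd c ` (fst c \<inter> fst d)"
  have eq: "snd c' ` (fst c' \<inter> fst d') = ?U \<times> UNIV"
    using tchart_image[OF A c(2), of "fst c \<inter> fst d"] c(1) d(1) by (simp add: Times_Int_Times)
  have U: "open ?U" using smooth_atlasD(3)[OF A c(2) d(2)] .
  then show "open (snd c' ` (fst c' \<inter> fst d'))" unfolding eq by (simp add: open_Times)
  have O: "open (?U \<times> (UNIV :: 'b set))" using U by (simp add: open_Times)
  let ?f = "\<lambda>x. snd d (chart_inv c x)"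
  have sf: "smooth_on ?U ?f" using smooth_atlasD(4)[OF A c(2) d(2)] by (simp add: o_def)
  have "smooth_on (?U \<times> UNIV) (\<lambda>y. (?f (fst y), frechet_derivative ?f (at (fst y)) (snd y)))"
    by (intro smooth_on_Pair O smooth_on_compose[OF O _ sf] smooth_on_derivative_along[OF O _ sf]
        smooth_on_bounded_linear bounded_linear_fst bounded_linear_snd) auto
  then show "smooth_on (snd c' ` (fst c' \<inter> fst d')) (snd d' \<circ> chart_inv c')"
    unfolding eq
  proof (rule smooth_on_cong[OF O, rotated])
    fix y :: "'b \<times> 'b" assume y: "y \<in> ?U \<times> UNIV"
    then obtain p u where p: "p \<in> fst c" "p \<in> fst d" and yp: "y = (snd c p, u)" by auto
    have x: "snd c p \<in> snd c ` fst c" using p by auto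
    have "chart_inv c' y = (p, tangent_map euclidean_atlas A (chart_inv c) (snd c p) u)"
      using chart_inv_tchart[OF A c(2) x, of u] chart_inv_chart[OF A c(2) p(1)] unfolding yp c(1) by simp
    moreover have "dchart A d p (tangent_map euclidean_atlas A (chart_inv c) (snd c p) u)
      = frechet_derivative ?f (at (snd c p)) u"
      using dchart_change[OF A c(2) d(2) p(1,2)] dchart_tangent_map_chart_inv[OF A c(2) x]
        chart_inv_chart[OF A c(2) p(1)] by simp
    ultimately show "(?f (fst y), frechet_derivative ?f (at (fst y)) (snd y)) = (snd d' \<circ> chart_inv c') y"
      using chart_inv_chart[OF A c(2) p(1)] unfolding yp d(1) by simp
  qed
qed

lemma carrier_of_tangent: "carrier_of (tangent_atlas A) = carrier_of A \<times> UNIV"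
  by (auto simp: carrier_of_def tangent_atlas_eq)

lemma smooth_to_tangentI:
  assumes A: "smooth_atlas A" and f: "smooth_to A W f"
    and v: "\<And>c. c \<in> A \<Longrightarrow> smooth_on (W \<inter> f -` fst c) (\<lambda>x. dchart A c (f x) (v x))"
  shows "smooth_to (tangent_atlas A) W (\<lambda>x. (f x, v x))"
proof (rule smooth_toI[OF smooth_atlas_tangent[OF A] smooth_to_open[OF f]])
  show "(f x, v x) \<in> carrier_of (tangent_atlas A)" if "x \<in> W" for x
    using smooth_to_carrier[OF f that] by (simp add: carrier_of_tangent)
  fix c' assume "c' \<in> tangent_atlas A"
  then obtain c where c: "c' = tchart A c" "c \<in> A" by (auto simp: tangent_atlas_eq)
  have eq: "W \<inter> (\<lambda>x. (f x, v x)) -` fst c' = W \<inter> f -` fst c" using c by auto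
  show "open (W \<inter> (\<lambda>x. (f x, v x)) -` fst c')"
    unfolding eq by (rule smooth_to_open_preimage[OF f openin_chart_domain[OF A c(2)]])
  then show "smooth_on (W \<inter> (\<lambda>x. (f x, v x)) -` fst c') (\<lambda>x. snd c' (f x, v x))"
    unfolding eq using v[OF c(2)] smooth_to_chart[OF f c(2)] c(1) by (simp add: smooth_on_Pair o_def)
qed

lemma smooth_to_tangentD:
  assumes A: "smooth_atlas A" and f: "smooth_to (tangent_atlas A) W (\<lambda>x. (f x, v x))"
  shows "smooth_to A W f" "c \<in> A \<Longrightarrow> smooth_on (W \<inter> f -` fst c) (\<lambda>x. dchart A c (f x) (v x))"
proof -
  have *: "open (W \<inter> f -` fst c)" "smooth_on (W \<inter> f -` fst c) (\<lambda>x. snd c (f x))"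
    "smooth_on (W \<inter> f -` fst c) (\<lambda>x. dchart A c (f x) (v x))" if c: "c \<in> A" for c
  proof -
    have t: "tchart A c \<in> tangent_atlas A" using c by (simp add: tangent_atlas_eq)
    have eq: "W \<inter> (\<lambda>x. (f x, v x)) -` fst (tchart A c) = W \<inter> f -` fst c" by auto
    show O: "open (W \<inter> f -` fst c)"
      using smooth_to_open_preimage[OF f openin_chart_domain[OF smooth_atlas_tangent[OF A] t]] eq by simp
    have "smooth_on (W \<inter> f -` fst c) (\<lambda>x. (snd c (f x), dchart A c (f x) (v x)))"
      using smooth_to_chart[OF f t] unfolding eq by (simp add: o_def)
    from smooth_on_compose_linear[OF bounded_linear_fst O this] smooth_on_compose_linear[OF bounded_linear_snd O this]
    show "smooth_on (W \<inter> f -` fst c) (\<lambda>x. snd c (f x))"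
      "smooth_on (W \<inter> f -` fst c) (\<lambda>x. dchart A c (f x) (v x))" by simp_all
  qed
  show "smooth_to A W f"
    using * smooth_to_carrier[OF f] by (intro smooth_toI[OF A smooth_to_open[OF f]]) (auto simp: carrier_of_tangent)
  show "c \<in> A \<Longrightarrow> smooth_on (W \<inter> f -` fst c) (\<lambda>x. dchart A c (f x) (v x))" by (rule *(3))
qed

text \<open>Provides \<open>(p, t \<xi>)\<close>, the argument of the exponential map in the flow,
  as a smooth function of a parameter for \<open>p\<close> and of the time \<open>t\<close>.\<close>

lemma smooth_to_tangent_scale:
  assumes A: "smooth_atlas A" and f: "smooth_to (tangent_atlas A) W (\<lambda>x. (f x, v x))"
  shows "smooth_to (tangent_atlas A) (W \<times> UNIV) (\<lambda>z. (f (fst z), snd z *\<^sub>R v (fst z)))"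
proof (rule smooth_to_tangentI[OF A])
  note fA = smooth_to_tangentD[OF A f]
  show "smooth_to A (W \<times> (UNIV :: real set)) (\<lambda>z. f (fst z))"
    by (rule smooth_to_reparam[OF A fA(1)]) (use smooth_to_open[OF f] in \<open>auto simp: open_Times intro!: smooth_on_bounded_linear bounded_linear_fst\<close>)
  fix c assume c: "c \<in> A"
  have eq: "(W \<times> UNIV) \<inter> (\<lambda>z. f (fst z)) -` fst c = (W \<inter> f -` fst c) \<times> (UNIV :: real set)" by auto
  have O: "open ((W \<inter> f -` fst c) \<times> (UNIV :: real set))"
    using smooth_to_open_preimage[OF fA(1) openin_chart_domain[OF A c]] by (simp add: open_Times)
  have "smooth_on ((W \<inter> f -` fst c) \<times> (UNIV :: real set)) (\<lambda>z. snd z *\<^sub>R dchart A c (f (fst z)) (v (fst z)))"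
    by (intro smooth_on_scaleR[OF O] smooth_on_compose[OF O _ fA(2)[OF c]]
        smooth_on_bounded_linear bounded_linear_fst bounded_linear_snd) auto
  then show "smooth_on ((W \<times> UNIV) \<inter> (\<lambda>z. f (fst z)) -` fst c) (\<lambda>z. dchart A c (f (fst z)) (snd z *\<^sub>R v (fst z)))"
    unfolding eq
    by (rule smooth_on_cong[OF O, rotated]) (use linear_cmul[OF dchart_linear[OF A c]] in auto)
qed

section \<open>Metrics on manifolds and the volume measure\<close>

locale lorentz_manifold =
  fixes A :: "('a, 'e::euclidean_space) atlas" and g :: "('a, 'e) metric"
  assumes atlas: "smooth_atlas A" and lorentz: "lorentzian_metric A g"
begin

lemma metric_bilinear: "p \<in> carrier_of A \<Longrightarrow> bilinear (g p)"
  using lorentz by (simp add: lorentzian_metric_def)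

lemma metric_sym: "p \<in> carrier_of A \<Longrightarrow> g p u v = g p v u"
  using lorentz by (simp add: lorentzian_metric_def)

lemma metric_smooth:
  "c \<in> A \<Longrightarrow> smooth_on (snd c ` fst c) (\<lambda>x. pullback_metric A g (chart_inv c) x u v)"
  using lorentz by (simp add: lorentzian_metric_def)

lemma pullback_bilinear:
  assumes f: "smooth_to A W f" "x \<in> W"
  shows "bilinear (pullback_metric A g f x)"
proof -
  note b = metric_bilinear[OF smooth_to_carrier[OF f]] and l = tangent_map_linear[OF atlas f]
  show ?thesis
    using b l unfolding bilinear_def pullback_metric_def
    by (auto intro!: linear_compose[of "tangent_map euclidean_atlas A f x", unfolded o_def])
qed

lemma chart_metric_bilinear:
  assumes "c \<in> A" "x \<in> snd c ` fst c"
  shows "bilinear (pullback_metric A g (chart_inv c) x)"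
  using pullback_bilinear[OF smooth_to_chart_inv[OF atlas assms(1)] assms(2)] .

lemma pullback_metric_in_chart:
  assumes f: "smooth_to A W f" "x \<in> W" and c: "c \<in> A" "f x \<in> fst c"
  shows "pullback_metric A g f x u v = pullback_metric A g (chart_inv c) (snd c (f x))
    (frechet_derivative (\<lambda>y. snd c (f y)) (at x) u) (frechet_derivative (\<lambda>y. snd c (f y)) (at x) v)"
  using pullback_metric_chart[OF atlas c, symmetric, of g] dchart_tangent_map[OF atlas f c]
  by (simp add: pullback_metric_def[of A g f])

lemma bilinear_expansion:
  fixes B :: "'c::euclidean_space \<Rightarrow> 'c \<Rightarrow> real"
  assumes "bilinear B"
  shows "B u v = (\<Sum>b\<in>Basis. \<Sum>b'\<in>Basis. (u \<bullet> b) *\<^sub>R (v \<bullet> b') *\<^sub>R B b b')"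
proof -
  have "B u v = (\<Sum>b\<in>Basis. (u \<bullet> b) *\<^sub>R B b v)"
    using assms by (intro linear_expansion[of "\<lambda>u. B u v"]) (simp add: bilinear_def)
  also have "\<dots> = (\<Sum>b\<in>Basis. (u \<bullet> b) *\<^sub>R (\<Sum>b'\<in>Basis. (v \<bullet> b') *\<^sub>R B b b'))"
    using assms by (intro sum.cong refl arg_cong2[where f=scaleR] linear_expansion) (simp add: bilinear_def)
  finally show ?thesis by (simp add: sum_distrib_left)
qed

text \<open>Smoothness of the metric is given on constant vectors only; expansion in the basis
  extends it to moving base point and moving arguments.\<close>

lemma smooth_on_chart_metric:
  assumes c: "c \<in> A" and W: "open W" and h: "smooth_on W h" "h ` W \<subseteq> snd c ` fst c"
    and u: "smooth_on W u" and v: "smooth_on W v"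
  shows "smooth_on W (\<lambda>x. pullback_metric A g (chart_inv c) (h x) (u x) (v x))"
proof -
  have "smooth_on W (\<lambda>x. \<Sum>b\<in>Basis. \<Sum>b'\<in>Basis.
      (u x \<bullet> b) *\<^sub>R (v x \<bullet> b') *\<^sub>R pullback_metric A g (chart_inv c) (h x) b b')"
    by (intro smooth_on_sum smooth_on_scaleR W u v smooth_on_compose_linear[OF bounded_linear_inner_left]
        smooth_on_compose[OF W h(2) metric_smooth[OF c] h(1)])
  then show ?thesis
  proof (rule smooth_on_cong[OF W, rotated])
    fix x assume "x \<in> W"
    then have "h x \<in> snd c ` fst c" using h by auto
    from bilinear_expansion[OF chart_metric_bilinear[OF c this], of "u x" "v x"]
    show "(\<Sum>b\<in>Basis. \<Sum>b'\<in>Basis. (u x \<bullet> b) *\<^sub>R (v x \<bullet> b') *\<^sub>R pullback_metric A g (chart_inv c) (h x) b b')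
      = pullback_metric A g (chart_inv c) (h x) (u x) (v x)" by simp
  qed
qed

lemma pullback_smooth:
  assumes f: "smooth_to A W f"
  shows "smooth_on W (\<lambda>x. pullback_metric A g f x u v)"
proof (rule smooth_on_local)
  fix x assume x: "x \<in> W"
  obtain c where c: "c \<in> A" "f x \<in> fst c"
    using smooth_to_carrier[OF f x] by (auto simp: carrier_of_def)
  let ?T = "W \<inter> f -` fst c"
  have T: "open ?T" by (rule smooth_to_open_preimage[OF f openin_chart_domain[OF atlas c(1)]])
  have s: "smooth_on ?T (\<lambda>y. snd c (f y))" using smooth_to_chart[OF f c(1)] by (simp add: o_def)
  have "smooth_on ?T (\<lambda>y. pullback_metric A g (chart_inv c) (snd c (f y))
    (frechet_derivative (\<lambda>y. snd c (f y)) (at y) u) (frechet_derivative (\<lambda>y. snd c (f y)) (at y) v))"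
    by (intro smooth_on_chart_metric[OF c(1) T s] smooth_on_derivative[OF s]) auto
  then have "smooth_on ?T (\<lambda>y. pullback_metric A g f y u v)"
    by (rule smooth_on_cong[OF T, rotated]) (use pullback_metric_in_chart[OF f _ c(1)] in auto)
  then show "\<exists>T. open T \<and> x \<in> T \<and> smooth_on T (\<lambda>x. pullback_metric A g f x u v)"
    using T x c by (intro exI[of _ ?T]) auto
qed

definition gram_matrix :: "(real^'n \<Rightarrow> 'a) \<Rightarrow> real^'n \<Rightarrow> real^'n^'n" where
  "gram_matrix \<psi> x = (\<chi> i j. pullback_metric A g \<psi> x (axis i 1) (axis j 1))"

lemma continuous_on_det:
  fixes M :: "'c::topological_space \<Rightarrow> real^'n^'n"
  assumes "\<And>i j. continuous_on W (\<lambda>x. M x $ i $ j)"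
  shows "continuous_on W (\<lambda>x. det (M x))"
  unfolding det_def by (intro continuous_intros assms)

lemma continuous_on_volume_density:
  assumes "smooth_to A W \<psi>"
  shows "continuous_on W (\<lambda>x. sqrt (det (gram_matrix \<psi> x)))"
  unfolding gram_matrix_def
  by (intro continuous_on_real_sqrt continuous_on_det)
    (simp add: smooth_on_continuous_on[OF pullback_smooth[OF assms]])

end

section \<open>Local parametrizations and Borel sets of a submanifold\<close>

lemma local_parametrizationD:
  assumes "local_parametrization A N W \<psi>"
  shows "smooth_to A W \<psi>" "open W" "inj_on \<psi> W" "x \<in> W \<Longrightarrow> inj (tangent_map euclidean_atlas A \<psi> x)"
    "openin (subtopology (atlas_topology A) N) (\<psi> ` W)" "\<psi> ` W \<subseteq> N"
    "homeomorphic_map (top_of_set W) (subtopology (atlas_topology A) (\<psi> ` W)) \<psi>"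
proof -
  show h: "homeomorphic_map (top_of_set W) (subtopology (atlas_topology A) (\<psi> ` W)) \<psi>"
    and s: "smooth_to A W \<psi>" and o: "openin (subtopology (atlas_topology A) N) (\<psi> ` W)"
    and "x \<in> W \<Longrightarrow> inj (tangent_map euclidean_atlas A \<psi> x)"
    using assms by (auto simp: local_parametrization_def)
  show "open W" by (rule smooth_to_open[OF s])
  show "inj_on \<psi> W" using homeomorphic_imp_injective_map[OF h] by simp
  show "\<psi> ` W \<subseteq> N" using openin_subset[OF o] by auto
qed

lemma local_parametrization_inverse:
  assumes "local_parametrization A N W \<psi>"
  shows "continuous_map (subtopology (atlas_topology A) (\<psi> ` W)) (top_of_set W) (inv_into W \<psi>)"
proof -
  note P = local_parametrizationD[OF assms]
  obtain h where h: "homeomorphic_maps (top_of_set W) (subtopology (atlas_topology A) (\<psi> ` W)) \<psi> h"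
    using P(7) unfolding homeomorphic_map_maps by blast
  then have "continuous_map (subtopology (atlas_topology A) (\<psi> ` W)) (top_of_set W) h"
    by (simp add: homeomorphic_maps_def)
  then show ?thesis
  proof (rule continuous_map_eq)
    fix p assume "p \<in> topspace (subtopology (atlas_topology A) (\<psi> ` W))"
    then obtain x where x: "x \<in> W" "p = \<psi> x" by auto
    then have "h p = x" using h by (simp add: homeomorphic_maps_def)
    then show "h p = inv_into W \<psi> p" using x P(3) by simp
  qed
qed

abbreviation submanifold_borel :: "('a, 'e::euclidean_space) atlas \<Rightarrow> 'a set \<Rightarrow> 'a set set" where
  "submanifold_borel A N \<equiv> sigma_sets N {U. openin (subtopology (atlas_topology A) N) U}"

lemma parametrization_vimage_borel:
  assumes P: "local_parametrization A N W \<psi>" and X: "X \<in> submanifold_borel A N"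
  shows "W \<inter> \<psi> -` X \<in> sets borel"
  using X
proof (induction rule: sigma_sets.induct)
  case (Basic U)
  then obtain T where T: "openin (atlas_topology A) T" "U = T \<inter> N"
    by (auto simp: openin_subtopology)
  have "W \<inter> \<psi> -` U = W \<inter> \<psi> -` T" using T local_parametrizationD(6)[OF P] by auto
  with smooth_to_open_preimage[OF local_parametrizationD(1)[OF P] T(1)] show ?case by simp
next
  case (Compl a)
  have "W \<inter> \<psi> -` (N - a) = W - (W \<inter> \<psi> -` a)" using local_parametrizationD(6)[OF P] by auto
  with Compl local_parametrizationD(2)[OF P] show ?case by simp
next
  case (Union a)
  have "W \<inter> \<psi> -` (\<Union>i. a i) = (\<Union>i. W \<inter> \<psi> -` a i)" by auto
  moreover have "(\<Union>i. W \<inter> \<psi> -` a i) \<in> sets borel" using Union by (intro sets.countable_UN) auto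
  ultimately show ?case by (simp only:)
qed simp

lemma sigma_algebra_submanifold_borel: "sigma_algebra N (submanifold_borel A N)"
  by (intro sigma_algebra_sigma_sets) (auto dest: openin_imp_subset)

text \<open>\<open>\<psi>\<close> is a homeomorphism onto a relatively open set, so images of open
  sets are open in \<open>N\<close>; injectivity takes care of complements, and the claim spreads
  through the generated sigma-algebra.\<close>

lemma parametrization_image_borel:
  fixes W :: "'f::euclidean_space set"
  assumes P: "local_parametrization A N W \<psi>" and E: "E \<in> sets borel"
  shows "\<psi> ` (W \<inter> E) \<in> submanifold_borel A N"
proof -
  note D = local_parametrizationD[OF P]
  interpret sigma_algebra N "submanifold_borel A N" by (rule sigma_algebra_submanifold_borel)
  have WN: "\<psi> ` W \<in> submanifold_borel A N" using D(5) by (intro sigma_sets.Basic) simp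
  have "E \<in> sigma_sets UNIV {S. open S}" using E by (simp add: borel_def)
  then show ?thesis
  proof (induction rule: sigma_sets.induct)
    case (Basic S)
    have "openin (top_of_set W) (W \<inter> S)" using Basic by (auto simp: openin_open)
    then have "openin (subtopology (atlas_topology A) (\<psi> ` W)) (\<psi> ` (W \<inter> S))"
      using homeomorphic_imp_open_map[OF D(7)] by (simp add: open_map_def)
    then have "openin (subtopology (atlas_topology A) N) (\<psi> ` (W \<inter> S))"
      using D(5,6) by (metis openin_trans_full subtopology_subtopology inf.absorb_iff2)
    then show ?case by (intro sigma_sets.Basic) simp
  next
    case (Compl a)
    have "\<psi> ` (W \<inter> (UNIV - a)) = \<psi> ` W - \<psi> ` (W \<inter> a)" using D(3) by (auto simp: inj_on_def)
    with Compl WN show ?case by auto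
  next
    case (Union a)
    have "\<psi> ` (W \<inter> (\<Union>i. a i)) = (\<Union>i. \<psi> ` (W \<inter> a i))" by auto
    with Union show ?case by auto
  qed auto
qed

context lorentz_manifold
begin

text \<open>The homeomorphism property gives only continuity of the transition
  \<open>\<tau>\<close>. Since \<open>\<phi>\<close> is an immersion,
  \<open>differentiable_through_immersion\<close> upgrades this to differentiability, and then the
  Gram matrices are related by \<open>transpose J ** (H ** J)\<close> with \<open>J\<close> the
  Jacobian matrix of \<open>\<tau>\<close>.\<close>

lemma parametrization_transition:
  fixes \<psi> :: "real^'n \<Rightarrow> 'a" and \<phi> :: "real^'n \<Rightarrow> 'a"
  assumes P: "local_parametrization A N W \<psi>" and Q: "local_parametrization A N U \<phi>"
    and x: "x \<in> W" "\<psi> x \<in> \<phi> ` U"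
  defines "\<tau> \<equiv> \<lambda>x. inv_into U \<phi> (\<psi> x)"
  shows "\<exists>D. (\<tau> has_derivative D) (at x) \<and>
    sqrt (det (gram_matrix \<psi> x)) = \<bar>det (matrix D)\<bar> * sqrt (det (gram_matrix \<phi> (\<tau> x)))"
proof -
  note p = local_parametrizationD[OF P] and q = local_parametrizationD[OF Q]
  obtain O' where O': "openin (atlas_topology A) O'" "\<phi> ` U = O' \<inter> N"
    using q(5) by (auto simp: openin_subtopology)
  define T where "T = W \<inter> \<psi> -` O'"
  have T: "open T" unfolding T_def by (rule smooth_to_open_preimage[OF p(1) O'(1)])
  have T\<phi>: "\<psi> y \<in> \<phi> ` U" if "y \<in> T" for y
    using O' p(6) that unfolding T_def by auto
  have Tx: "x \<in> T" using x O' unfolding T_def by auto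
  have \<tau>U: "\<tau> y \<in> U" "\<phi> (\<tau> y) = \<psi> y" if "y \<in> T" for y
    using T\<phi>[OF that] unfolding \<tau>_def by (auto simp: inv_into_into f_inv_into_f)
  have "continuous_map (top_of_set T) (subtopology (atlas_topology A) (\<phi> ` U)) \<psi>"
    using smooth_to_continuous_map[OF smooth_to_subset[OF atlas p(1) T]] T\<phi>
    by (auto simp: continuous_map_in_subtopology T_def)
  from continuous_map_compose[OF this local_parametrization_inverse[OF Q]]
  have "continuous_on T \<tau>" unfolding \<tau>_def o_def
    by (simp add: continuous_map_in_subtopology)
  then have cont: "isCont \<tau> x" using T Tx by (simp add: continuous_on_eq_continuous_at)
  obtain c where c: "c \<in> A" "\<psi> x \<in> fst c"
    using smooth_to_carrier[OF p(1) x(1)] by (auto simp: carrier_of_def)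
  have c': "\<phi> (\<tau> x) \<in> fst c" using c \<tau>U(2)[OF Tx] by simp
  let ?f = "\<lambda>y. snd c (\<phi> y)" and ?k = "\<lambda>y. snd c (\<psi> y)"
  let ?f' = "frechet_derivative ?f (at (\<tau> x))" and ?k' = "frechet_derivative ?k (at x)"
  have f: "(?f has_derivative ?f') (at (\<tau> x))"
    by (rule smooth_to_has_derivative[OF q(1) \<tau>U(1)[OF Tx] c(1) c'])
  have k: "(?k has_derivative ?k') (at x)"
    by (rule smooth_to_has_derivative[OF p(1) x(1) c])
  have k2: "((\<lambda>y. ?f (\<tau> y)) has_derivative ?k') (at x)"
    by (rule has_derivative_transform_within_open[OF k T Tx]) (simp add: \<tau>U)
  have "?f' = (\<lambda>u. dchart A c (\<phi> (\<tau> x)) (tangent_map euclidean_atlas A \<phi> (\<tau> x) u))"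
    using dchart_tangent_map[OF atlas q(1) \<tau>U(1)[OF Tx] c(1) c'] by auto
  then have inj: "inj ?f'"
    using inj_compose[OF bij_is_inj[OF dchart_bij[OF atlas c(1) c']] q(4)[OF \<tau>U(1)[OF Tx]]]
    by (simp add: o_def)
  obtain D where D: "(\<tau> has_derivative D) (at x)"
    using differentiable_through_immersion[OF f inj cont k2] unfolding differentiable_def by blast
  have kD: "?k' u = ?f' (D u)" for u
    using has_derivative_unique[OF k2 has_derivative_compose[OF D f]] by (simp add: fun_eq_iff)
  have pb: "pullback_metric A g \<psi> x u v = pullback_metric A g \<phi> (\<tau> x) (D u) (D v)" for u v
    unfolding pullback_metric_in_chart[OF p(1) x(1) c] pullback_metric_in_chart[OF q(1) \<tau>U(1)[OF Tx] c(1) c']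
    using \<tau>U(2)[OF Tx] by (simp add: kD)
  let ?H = "gram_matrix \<phi> (\<tau> x)" and ?J = "matrix D"
  note bil = pullback_bilinear[OF q(1) \<tau>U(1)[OF Tx]]
  have "gram_matrix \<psi> x = transpose ?J ** (?H ** ?J)"
  proof -
    have "pullback_metric A g \<phi> (\<tau> x) a b = (\<Sum>k\<in>UNIV. a $ k * (\<Sum>l\<in>UNIV. ?H $ k $ l * b $ l))" for a b
    proof -
      have "pullback_metric A g \<phi> (\<tau> x) a b = pullback_metric A g \<phi> (\<tau> x) (\<Sum>k\<in>UNIV. a $ k *\<^sub>R axis k 1) (\<Sum>l\<in>UNIV. b $ l *\<^sub>R axis l 1)"
        using basis_expansion[of a] basis_expansion[of b] by (simp add: scalar_mult_eq_scaleR)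
      also have "\<dots> = (\<Sum>(k, l)\<in>UNIV \<times> UNIV. pullback_metric A g \<phi> (\<tau> x) (a $ k *\<^sub>R axis k 1) (b $ l *\<^sub>R axis l 1))"
        by (rule bilinear_sum[OF bil])
      also have "\<dots> = (\<Sum>k\<in>UNIV. \<Sum>l\<in>UNIV. a $ k * (b $ l * ?H $ k $ l))"
        using bil by (subst sum.cartesian_product[symmetric])
          (simp add: gram_matrix_def bilinear_lmul bilinear_rmul)
      finally show ?thesis by (simp add: sum_distrib_left mult_ac)
    qed
    then show ?thesis
      unfolding vec_eq_iff by (subst gram_matrix_def) (simp add: pb matrix_matrix_mult_def transpose_def matrix_def)
  qed
  then have "det (gram_matrix \<psi> x) = (det ?J)\<^sup>2 * det ?H"
    by (simp add: det_mul det_transpose power2_eq_square)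
  then have "sqrt (det (gram_matrix \<psi> x)) = \<bar>det ?J\<bar> * sqrt (det ?H)"
    by (simp add: real_sqrt_mult)
  with D show ?thesis by blast
qed

lemma parametrization_volume_transition:
  fixes \<psi> :: "real^'n \<Rightarrow> 'a" and \<phi> :: "real^'n \<Rightarrow> 'a"
  assumes P: "local_parametrization A N W \<psi>" and Q: "local_parametrization A N U \<phi>"
    and E: "E \<in> sets borel" "E \<subseteq> W" "\<psi> ` E \<subseteq> \<phi> ` U"
  shows "(\<integral>\<^sup>+y\<in>U \<inter> \<phi> -` (\<psi> ` E). ennreal (sqrt (det (gram_matrix \<phi> y))) \<partial>lborel)
    = (\<integral>\<^sup>+x\<in>E. ennreal (sqrt (det (gram_matrix \<psi> x))) \<partial>lborel)"
proof -
  note p = local_parametrizationD[OF P] and q = local_parametrizationD[OF Q]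
  define \<tau> where "\<tau> x = inv_into U \<phi> (\<psi> x)" for x
  have "\<forall>x\<in>E. \<exists>D. (\<tau> has_derivative D) (at x) \<and>
    sqrt (det (gram_matrix \<psi> x)) = \<bar>det (matrix D)\<bar> * sqrt (det (gram_matrix \<phi> (\<tau> x)))"
    using parametrization_transition[OF P Q] E unfolding \<tau>_def by blast
  then obtain D where D: "\<And>x. x \<in> E \<Longrightarrow> (\<tau> has_derivative D x) (at x)"
    "\<And>x. x \<in> E \<Longrightarrow> sqrt (det (gram_matrix \<psi> x)) = \<bar>det (matrix (D x))\<bar> * sqrt (det (gram_matrix \<phi> (\<tau> x)))"
    by metis
  \<comment> \<open>\<open>N\<close> is not assumed spacelike here, and \<open>sqrt\<close> of a
    negative determinant is negative. The cut-off at \<open>0\<close> supplies the nonnegativity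
    demanded by the change of variables, and \<open>ennreal\<close> does not notice it.\<close>
  let ?r = "\<lambda>\<psi> x. max 0 (sqrt (det (gram_matrix \<psi> x)))"
  have \<tau>: "\<tau> x \<in> U" "\<phi> (\<tau> x) = \<psi> x" if "x \<in> E" for x
    using E that unfolding \<tau>_def by (auto simp: image_subset_iff inv_into_into f_inv_into_f)
  have img: "\<tau> ` E = U \<inter> \<phi> -` (\<psi> ` E)"
  proof
    show "U \<inter> \<phi> -` (\<psi> ` E) \<subseteq> \<tau> ` E"
    proof
      fix y assume y: "y \<in> U \<inter> \<phi> -` (\<psi> ` E)"
      then obtain x where "x \<in> E" "\<phi> y = \<psi> x" by auto
      then have "\<tau> x = y" using y q(3) unfolding \<tau>_def by (metis IntD1 inv_into_f_f)
      then show "y \<in> \<tau> ` E" using \<open>x \<in> E\<close> by blast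
    qed
  qed (use \<tau> in auto)
  have meas: "(\<lambda>x. indicator F x * ?r \<eta> x) \<in> borel_measurable borel"
    if "F \<in> sets borel" "F \<subseteq> V" "smooth_to A V \<eta>" for F V and \<eta> :: "real^'n \<Rightarrow> 'a"
  proof -
    have "continuous_on F (?r \<eta>)"
      by (intro continuous_intros continuous_on_subset[OF continuous_on_volume_density[OF that(3)] that(2)])
    from borel_measurable_continuous_on_indicator[OF that(1) this] show ?thesis by simp
  qed
  have r: "\<bar>det (matrix (D x))\<bar> * ?r \<phi> (\<tau> x) = ?r \<psi> x" if "x \<in> E" for x
    using D(2)[OF that] by (auto simp: max_def mult_nonneg_nonneg zero_le_mult_iff split: if_splits)
  have "\<psi> ` (W \<inter> E) \<in> submanifold_borel A N" by (rule parametrization_image_borel[OF P E(1)])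
  then have "\<psi> ` E \<in> submanifold_borel A N" using E(2) by (simp add: inf.absorb2)
  then have Fb: "U \<inter> \<phi> -` (\<psi> ` E) \<in> sets borel" by (rule parametrization_vimage_borel[OF Q])
  have "(\<integral>\<^sup>+y\<in>\<tau> ` E. ennreal (?r \<phi> y) \<partial>lborel)
    = (\<integral>\<^sup>+x\<in>E. ennreal (\<bar>det (matrix (D x))\<bar> * ?r \<phi> (\<tau> x)) \<partial>lborel)"
  proof (rule nn_integral_change_of_variables[OF E(1) D(1)])
    show "inj_on \<tau> E" using \<tau> p(3) E(2) by (metis inj_on_def subsetD)
    show "(\<lambda>y. indicator (\<tau> ` E) y * ?r \<phi> y) \<in> borel_measurable borel"
      unfolding img by (rule meas[OF Fb _ q(1)]) auto
    have "(\<lambda>x. indicator E x * (\<bar>det (matrix (D x))\<bar> * ?r \<phi> (\<tau> x))) = (\<lambda>x. indicator E x * ?r \<psi> x)"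
      using r by (auto simp: fun_eq_iff indicator_def)
    then show "(\<lambda>x. indicator E x * (\<bar>det (matrix (D x))\<bar> * ?r \<phi> (\<tau> x))) \<in> borel_measurable borel"
      by (simp only: meas[OF E(1,2) p(1)])
  qed auto
  also have "\<dots> = (\<integral>\<^sup>+x\<in>E. ennreal (?r \<psi> x) \<partial>lborel)"
    by (intro nn_integral_cong) (auto simp: indicator_def r)
  finally show ?thesis unfolding img by (simp add: ennreal_max_0)
qed

end

section \<open>Existence and uniqueness of the induced volume\<close>

definition volume_measure ::
  "'n::finite itself \<Rightarrow> ('a, 'e::euclidean_space) atlas \<Rightarrow> ('a, 'e) metric \<Rightarrow> 'a set \<Rightarrow> 'a measure \<Rightarrow> bool" where
  "volume_measure TYPE('n) A g N M \<longleftrightarrow> sets M = submanifold_borel A N \<and>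
     (\<forall>(W :: (real^'n) set) \<psi> E. local_parametrization A N W \<psi> \<and> E \<in> sets borel \<and> E \<subseteq> W \<longrightarrow>
        emeasure M (\<psi> ` E) =
          (\<integral>\<^sup>+ x\<in>E. ennreal (sqrt (det (\<chi> i j. pullback_metric A g \<psi> x (axis i 1) (axis j 1)))) \<partial>lborel))"

text \<open>Compact sets \<open>K i\<close> are recorded beside the domains \<open>W i\<close>
  because the density may fail to be integrable on all of \<open>W i\<close>; closed balls inside
  the domains already cover \<open>N\<close> after passing to a finite subfamily.\<close>

lemma compact_submanifold_cover:
  assumes emb: "embedded_submanifold TYPE(real^'n) A N" and N: "compactin (atlas_topology A) N"
  shows "\<exists>(k :: nat) (W :: nat \<Rightarrow> (real^'n) set) \<psi> K.
    (\<forall>i<k. local_parametrization A N (W i) (\<psi> i) \<and> compact (K i) \<and> K i \<subseteq> W i) \<and>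
    N = (\<Union>i<k. \<psi> i ` K i)"
proof -
  have "\<exists>(W :: (real^'n) set) \<psi> K X. local_parametrization A N W \<psi> \<and> compact K \<and> K \<subseteq> W \<and>
      openin (atlas_topology A) X \<and> p \<in> X \<and> X \<inter> N \<subseteq> \<psi> ` K" if p: "p \<in> N" for p
  proof -
    obtain W :: "(real^'n) set" and \<psi> where P: "local_parametrization A N W \<psi>" and "p \<in> \<psi> ` W"
      using emb p unfolding embedded_submanifold_def by blast
    then obtain x where x: "x \<in> W" "p = \<psi> x" by blast
    note D = local_parametrizationD[OF P]
    obtain e where e: "e > 0" "cball x e \<subseteq> W"
      using D(2) x(1) open_contains_cball by blast
    then have bW: "ball x e \<subseteq> W" using ball_subset_cball by blast
    then have "openin (top_of_set W) (ball x e)" by (simp add: open_subset)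
    then have "openin (subtopology (atlas_topology A) (\<psi> ` W)) (\<psi> ` ball x e)"
      using homeomorphic_imp_open_map[OF D(7)] by (simp add: open_map_def)
    then have "openin (subtopology (atlas_topology A) N) (\<psi> ` ball x e)"
      using D(5,6) by (metis openin_trans_full subtopology_subtopology inf.absorb_iff2)
    then obtain X where "openin (atlas_topology A) X" "\<psi> ` ball x e = X \<inter> N"
      by (auto simp: openin_subtopology)
    moreover have "p \<in> \<psi> ` ball x e" using x e by auto
    moreover have "\<psi> ` ball x e \<subseteq> \<psi> ` cball x e" by (intro image_mono ball_subset_cball)
    ultimately show ?thesis
      using P e by (intro exI[of _ W] exI[of _ \<psi>] exI[of _ "cball x e"] exI[of _ X]) auto
  qed
  then have "\<forall>p\<in>N. \<exists>q. (case q of (W :: (real^'n) set, \<psi>, K, X) \<Rightarrow> local_parametrization A N W \<psi> \<and> compact K \<and>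
      K \<subseteq> W \<and> openin (atlas_topology A) X \<and> p \<in> X \<and> X \<inter> N \<subseteq> \<psi> ` K)"
    by fast
  from bchoice[OF this] obtain q where q: "\<forall>p\<in>N. (case q p of (W :: (real^'n) set, \<psi>, K, X) \<Rightarrow>
      local_parametrization A N W \<psi> \<and> compact K \<and>
      K \<subseteq> W \<and> openin (atlas_topology A) X \<and> p \<in> X \<and> X \<inter> N \<subseteq> \<psi> ` K)" ..
  define W where "W p = fst (q p)" for p
  define \<psi> where "\<psi> p = fst (snd (q p))" for p
  define K where "K p = fst (snd (snd (q p)))" for p
  define X where "X p = snd (snd (snd (q p)))" for p
  have *: "local_parametrization A N (W p) (\<psi> p)" "compact (K p)" "K p \<subseteq> W p"
    "openin (atlas_topology A) (X p)" "p \<in> X p" "X p \<inter> N \<subseteq> \<psi> p ` K p" if "p \<in> N" for p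
    using bspec[OF q that] by (auto simp: W_def \<psi>_def K_def X_def split: prod.splits)
  have "\<exists>\<F>. finite \<F> \<and> \<F> \<subseteq> X ` N \<and> N \<subseteq> \<Union>\<F>"
    using conjunct2[OF N[unfolded compactin_def], rule_format, of "X ` N"] *(4,5) by blast
  then obtain \<F> where \<F>: "finite \<F>" "\<F> \<subseteq> X ` N" "N \<subseteq> \<Union>\<F>" by blast
  then obtain F where F: "F \<subseteq> N" "finite F" "\<F> = X ` F" using finite_subset_image by metis
  obtain h where h: "bij_betw h {0..<card F} F" using ex_bij_betw_nat_finite[OF F(2)] by blast
  have hF: "h ` {..<card F} = F" using h by (simp add: bij_betw_def lessThan_atLeast0)
  then have hN: "h i \<in> N" if "i < card F" for i using F(1) that by blast
  show ?thesis
  proof (rule exI[of _ "card F"], rule exI[of _ "\<lambda>i. W (h i)"], rule exI[of _ "\<lambda>i. \<psi> (h i)"],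
      rule exI[of _ "\<lambda>i. K (h i)"], intro conjI allI impI)
    have "N \<subseteq> (\<Union>i<card F. \<psi> (h i) ` K (h i))"
    proof
      fix p assume p: "p \<in> N"
      then obtain q where q: "q \<in> F" "p \<in> X q" using \<F>(3) F(3) by auto
      then obtain i where "i < card F" "q = h i" using hF by blast
      then show "p \<in> (\<Union>i<card F. \<psi> (h i) ` K (h i))"
        using *(6)[of q] F(1) q p by blast
    qed
    moreover have "\<psi> (h i) ` K (h i) \<subseteq> N" if "i < card F" for i
      using local_parametrizationD(6)[OF *(1)[OF hN[OF that]]] *(3)[OF hN[OF that]] by blast
    ultimately show "N = (\<Union>i<card F. \<psi> (h i) ` K (h i))" by blast
  qed (use *(1-3) hN in auto)
qed

context lorentz_manifold
begin

text \<open>The indicator sits inside \<open>ennreal\<close> so that the density is Borel on the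
  whole space although the square root is known to be continuous only on \<open>W\<close>.\<close>

definition volume_density :: "(real^'n) set \<Rightarrow> (real^'n \<Rightarrow> 'a) \<Rightarrow> real^'n \<Rightarrow> ennreal" where
  "volume_density W \<psi> x = ennreal (indicator W x * sqrt (det (gram_matrix \<psi> x)))"

lemma volume_density_measurable:
  assumes "local_parametrization A N W \<psi>"
  shows "volume_density W \<psi> \<in> borel_measurable lborel"
proof -
  note D = local_parametrizationD[OF assms]
  have "(\<lambda>x. indicator W x *\<^sub>R sqrt (det (gram_matrix \<psi> x))) \<in> borel_measurable borel"
    by (rule borel_measurable_continuous_on_indicator[OF _ continuous_on_volume_density[OF D(1)]])
      (use D(2) in simp)
  then show ?thesis unfolding volume_density_def by simp
qed

lemma emeasure_density_volume:
  assumes "local_parametrization A N W \<psi>" "E \<in> sets borel" "E \<subseteq> W"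
  shows "emeasure (density lborel (volume_density W \<psi>)) E
    = (\<integral>\<^sup>+x\<in>E. ennreal (sqrt (det (gram_matrix \<psi> x))) \<partial>lborel)"
proof -
  have "emeasure (density lborel (volume_density W \<psi>)) E
    = (\<integral>\<^sup>+x. volume_density W \<psi> x * indicator E x \<partial>lborel)"
    using assms by (intro emeasure_density volume_density_measurable) auto
  also have "\<dots> = (\<integral>\<^sup>+x\<in>E. ennreal (sqrt (det (gram_matrix \<psi> x))) \<partial>lborel)"
    using assms(3) by (intro nn_integral_cong) (auto simp: volume_density_def indicator_def)
  finally show ?thesis .
qed

lemma volume_measureD:
  assumes "volume_measure TYPE('n) A g N M"
  shows "sets M = submanifold_borel A N" "space M = N"
    "local_parametrization A N W \<psi> \<Longrightarrow> E \<in> sets borel \<Longrightarrow> E \<subseteq> W \<Longrightarrow>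
      emeasure M (\<psi> ` E) = emeasure (density lborel (volume_density (W :: (real^'n) set) \<psi>)) E"
proof -
  show *: "sets M = submanifold_borel A N" using assms by (simp add: volume_measure_def)
  interpret sigma_algebra N "submanifold_borel A N" by (rule sigma_algebra_submanifold_borel)
  show "space M = N"
    using * sets.top[of M] sets.sets_into_space[of N M] space_closed top by (metis Sup_upper Sup_le_iff order_antisym PowD subsetD)
  assume "local_parametrization A N W \<psi>" "E \<in> sets borel" "E \<subseteq> W"
  then show "emeasure M (\<psi> ` E) = emeasure (density lborel (volume_density W \<psi>)) E"
    using assms emeasure_density_volume[of N W \<psi> E] by (simp add: volume_measure_def gram_matrix_def)
qed

lemma parametrization_density_transition:
  fixes \<psi> :: "real^'n \<Rightarrow> 'a" and \<phi> :: "real^'n \<Rightarrow> 'a"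
  assumes P: "local_parametrization A N W \<psi>" and Q: "local_parametrization A N U \<phi>"
    and E: "E \<in> sets borel" "E \<subseteq> W" "\<psi> ` E \<subseteq> \<phi> ` U"
  shows "emeasure (density lborel (volume_density U \<phi>)) (U \<inter> \<phi> -` (\<psi> ` E))
    = emeasure (density lborel (volume_density W \<psi>)) E"
proof -
  have "\<psi> ` (W \<inter> E) \<in> submanifold_borel A N" by (rule parametrization_image_borel[OF P E(1)])
  then have "\<psi> ` E \<in> submanifold_borel A N" using E(2) by (simp add: inf.absorb2)
  then have "U \<inter> \<phi> -` (\<psi> ` E) \<in> sets borel" by (rule parametrization_vimage_borel[OF Q])
  then show ?thesis
    using parametrization_volume_transition[OF P Q E]
    by (simp add: emeasure_density_volume[OF Q] emeasure_density_volume[OF P E(1,2)])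
qed

end

locale volume_cover = lorentz_manifold A g
  for A :: "('a, 'e::euclidean_space) atlas" and g +
  fixes N :: "'a set" and k :: nat and W :: "nat \<Rightarrow> (real^'n) set" and \<psi> :: "nat \<Rightarrow> real^'n \<Rightarrow> 'a"
  assumes par: "\<And>i. i < k \<Longrightarrow> local_parametrization A N (W i) (\<psi> i)"
    and cover: "N = (\<Union>i<k. \<psi> i ` W i)"
begin

definition piece :: "nat \<Rightarrow> 'a set" where
  "piece i = \<psi> i ` W i - (\<Union>j<i. \<psi> j ` W j)"

text \<open>The candidate for the volume: on each of the disjoint pieces the coordinates of one
  fixed parametrization are used, so nothing is counted twice.\<close>

definition cover_measure :: "'a set \<Rightarrow> ennreal" where
  "cover_measure X = (\<Sum>i<k. emeasure (density lborel (volume_density (W i) (\<psi> i))) (W i \<inter> \<psi> i -` (X \<inter> piece i)))"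

sublocale B: sigma_algebra N "submanifold_borel A N" by (rule sigma_algebra_submanifold_borel)

lemma piece_subset: "i < k \<Longrightarrow> piece i \<subseteq> \<psi> i ` W i"
  by (auto simp: piece_def)

lemma piece_borel: "i < k \<Longrightarrow> piece i \<in> submanifold_borel A N"
proof -
  assume i: "i < k"
  have "\<psi> j ` W j \<in> submanifold_borel A N" if "j < k" for j
    using local_parametrizationD(5)[OF par[OF that]] by (intro sigma_sets.Basic) simp
  then show ?thesis using i unfolding piece_def by (intro B.Diff B.finite_UN) auto
qed

lemma UN_piece: "(\<Union>i<k. piece i) = N"
proof
  show "N \<subseteq> (\<Union>i<k. piece i)"
  proof
    fix p assume "p \<in> N"
    then have ex: "\<exists>i. i < k \<and> p \<in> \<psi> i ` W i" using cover by auto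
    define i where "i = (LEAST i. i < k \<and> p \<in> \<psi> i ` W i)"
    have i: "i < k \<and> p \<in> \<psi> i ` W i" unfolding i_def by (rule LeastI_ex[OF ex])
    have "p \<notin> \<psi> j ` W j" if "j < i" for j
      using not_less_Least[of j "\<lambda>i. i < k \<and> p \<in> \<psi> i ` W i"] that i unfolding i_def by force
    with i show "p \<in> (\<Union>i<k. piece i)" by (auto simp: piece_def)
  qed
qed (use cover piece_subset in blast)

lemma disjoint_piece: "disjoint_family_on piece {..<k}"
  unfolding disjoint_family_on_def
proof (intro ballI impI)
  fix m n :: nat assume "m \<noteq> n"
  then consider "m < n" | "n < m" by linarith
  then show "piece m \<inter> piece n = {}" by cases (auto simp: piece_def)
qed

text \<open>Cutting \<open>E\<close> along the pieces puts each part inside two parametrized patches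
  at once, where the transition formula exchanges the coordinates of \<open>\<psi> i\<close> for
  those of \<open>\<phi>\<close>. Thus the candidate has the required density in every
  parametrization, not only in those of the cover.\<close>

lemma cover_measure_density:
  fixes U :: "(real^'n) set"
  assumes Q: "local_parametrization A N U \<phi>" and E: "E \<in> sets borel" "E \<subseteq> U"
  shows "cover_measure (\<phi> ` E) = emeasure (density lborel (volume_density U \<phi>)) E"
proof -
  let ?\<nu> = "density lborel (volume_density U \<phi>)"
  let ?F = "\<lambda>i. E \<inter> \<phi> -` piece i"
  have F: "?F i \<in> sets borel" if "i < k" for i
  proof -
    have "E \<inter> (U \<inter> \<phi> -` piece i) \<in> sets borel"
      using parametrization_vimage_borel[OF Q piece_borel[OF that]] E(1) by blast
    then show ?thesis using E(2) by (simp add: Int_assoc[symmetric] inf.absorb1)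
  qed
  have "cover_measure (\<phi> ` E) = (\<Sum>i<k. emeasure ?\<nu> (?F i))"
    unfolding cover_measure_def
  proof (rule sum.cong[OF refl])
    fix i assume "i \<in> {..<k}" then have i: "i < k" by simp
    have "\<phi> ` E \<inter> piece i = \<phi> ` ?F i" by auto
    moreover have "\<phi> ` ?F i \<subseteq> \<psi> i ` W i" using piece_subset[OF i] by auto
    ultimately show "emeasure (density lborel (volume_density (W i) (\<psi> i))) (W i \<inter> \<psi> i -` (\<phi> ` E \<inter> piece i))
        = emeasure ?\<nu> (?F i)"
      using parametrization_density_transition[OF Q par[OF i] F[OF i]] E(2) by auto
  qed
  also have "\<dots> = emeasure ?\<nu> (\<Union>i<k. ?F i)"
  proof (rule sum_emeasure)
    show "disjoint_family_on ?F {..<k}"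
      using disjoint_piece unfolding disjoint_family_on_def by blast
  qed (use F in auto)
  also have "(\<Union>i<k. ?F i) = E"
    using UN_piece E(2) local_parametrizationD(6)[OF Q] by blast
  finally show ?thesis .
qed

lemma cover_measure_additive: "countably_additive (submanifold_borel A N) cover_measure"
proof (rule countably_additiveI)
  fix X :: "nat \<Rightarrow> 'a set"
  assume X: "range X \<subseteq> submanifold_borel A N" "disjoint_family X" "(\<Union>i. X i) \<in> submanifold_borel A N"
  let ?F = "\<lambda>i n. W i \<inter> \<psi> i -` (X n \<inter> piece i)"
  let ?\<nu> = "\<lambda>i. density lborel (volume_density (W i) (\<psi> i))"
  have "(\<Sum>n. cover_measure (X n)) = (\<Sum>i<k. \<Sum>n. emeasure (?\<nu> i) (?F i n))"
    unfolding cover_measure_def by (rule suminf_sum) simp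
  also have "\<dots> = (\<Sum>i<k. emeasure (?\<nu> i) (\<Union>n. ?F i n))"
  proof (intro sum.cong refl suminf_emeasure)
    fix i assume "i \<in> {..<k}" then have i: "i < k" by simp
    show "range (?F i) \<subseteq> sets (?\<nu> i)"
    proof (clarsimp)
      fix n
      have "X n \<inter> piece i \<in> submanifold_borel A N" using X(1) piece_borel[OF i] by (intro B.Int) auto
      from parametrization_vimage_borel[OF par[OF i] this]
      show "W i \<inter> (\<psi> i -` X n \<inter> \<psi> i -` piece i) \<in> sets borel" by (simp add: vimage_Int)
    qed
    show "disjoint_family (?F i)" using X(2) unfolding disjoint_family_on_def by blast
  qed
  also have "\<dots> = cover_measure (\<Union>n. X n)"
    unfolding cover_measure_def by (intro sum.cong refl arg_cong2[where f=emeasure]) auto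
  finally show "(\<Sum>n. cover_measure (X n)) = cover_measure (\<Union>n. X n)" .
qed

text \<open>A volume measure is prescribed on Borel subsets of a single patch, hence on each
  \<open>X \<inter> piece i\<close>, and additivity does the rest. Applied to two volume measures
  with the same cover, this is the uniqueness behind \<open>induced_volume\<close>.\<close>

lemma volume_measure_eq_cover_measure:
  assumes M: "volume_measure TYPE('n) A g N M" and X: "X \<in> submanifold_borel A N"
  shows "emeasure M X = cover_measure X"
proof -
  note D = volume_measureD[OF M]
  have pX: "X \<inter> piece i \<in> submanifold_borel A N" if "i < k" for i
    using X piece_borel[OF that] by (rule B.Int)
  have "emeasure M X = emeasure M (\<Union>i<k. X \<inter> piece i)"
    using UN_piece B.sets_into_space[OF X] by (intro arg_cong2[where f=emeasure]) auto
  also have "\<dots> = (\<Sum>i<k. emeasure M (X \<inter> piece i))"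
  proof (rule sum_emeasure[symmetric])
    show "disjoint_family_on (\<lambda>i. X \<inter> piece i) {..<k}"
      using disjoint_piece unfolding disjoint_family_on_def by blast
  qed (use pX D(1) in auto)
  also have "\<dots> = cover_measure X"
    unfolding cover_measure_def
  proof (rule sum.cong[OF refl])
    fix i assume "i \<in> {..<k}" then have i: "i < k" by simp
    have "\<psi> i ` (W i \<inter> \<psi> i -` (X \<inter> piece i)) = X \<inter> piece i" using piece_subset[OF i] by auto
    with D(3)[OF par[OF i] parametrization_vimage_borel[OF par[OF i] pX[OF i]]]
    show "emeasure M (X \<inter> piece i)
      = emeasure (density lborel (volume_density (W i) (\<psi> i))) (W i \<inter> \<psi> i -` (X \<inter> piece i))" by simp
  qed
  finally show ?thesis .
qed

lemma volume_measure_exists: "volume_measure TYPE('n) A g N (measure_of N (submanifold_borel A N) cover_measure)"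
proof -
  let ?M = "measure_of N (submanifold_borel A N) cover_measure"
  have sM: "sets ?M = submanifold_borel A N"
    using B.sets_measure_of_eq by simp
  have em: "emeasure ?M X = cover_measure X" if "X \<in> submanifold_borel A N" for X
    by (rule emeasure_measure_of_sigma[OF B.sigma_algebra_axioms _ cover_measure_additive that])
      (simp add: positive_def cover_measure_def)
  show ?thesis
    unfolding volume_measure_def
  proof (intro conjI allI impI sM)
    fix U :: "(real^'n) set" and \<phi> E
    assume *: "local_parametrization A N U \<phi> \<and> E \<in> sets borel \<and> E \<subseteq> U"
    then have "\<phi> ` (U \<inter> E) \<in> submanifold_borel A N" by (intro parametrization_image_borel) auto
    then have "\<phi> ` E \<in> submanifold_borel A N" using * by (simp add: inf.absorb2)
    from em[OF this] show "emeasure ?M (\<phi> ` E) =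
      (\<integral>\<^sup>+x\<in>E. ennreal (sqrt (det (\<chi> i j. pullback_metric A g \<phi> x (axis i 1) (axis j 1)))) \<partial>lborel)"
      using * cover_measure_density[of U \<phi> E] emeasure_density_volume[of N U \<phi> E]
      by (simp add: gram_matrix_def)
  qed
qed

lemma volume_measure_unique:
  assumes "volume_measure TYPE('n) A g N M" "volume_measure TYPE('n) A g N M'"
  shows "M = M'"
  using assms by (intro measure_eqI) (simp_all add: volume_measureD(1) volume_measure_eq_cover_measure)

end

context lorentz_manifold
begin

lemma volume_measure_induced:
  assumes "embedded_submanifold TYPE(real^'n) A N" "compactin (atlas_topology A) N"
  shows "volume_measure TYPE('n) A g N (induced_volume TYPE('n) A g N)"
proof -
  obtain k :: nat and W \<psi> K where
    "(\<forall>i<k. local_parametrization A N (W i :: (real^'n) set) (\<psi> i) \<and> compact (K i) \<and> K i \<subseteq> W i) \<and>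
    N = (\<Union>i<k. \<psi> i ` K i)"
    using compact_submanifold_cover[OF assms] by (elim exE)
  then have *: "\<And>i. i < k \<Longrightarrow> local_parametrization A N (W i) (\<psi> i)"
    "\<And>i. i < k \<Longrightarrow> compact (K i)" "\<And>i. i < k \<Longrightarrow> K i \<subseteq> W i" "N = (\<Union>i<k. \<psi> i ` K i)"
    by blast+
  have "N = (\<Union>i<k. \<psi> i ` W i)"
  proof
    show "N \<subseteq> (\<Union>i<k. \<psi> i ` W i)" unfolding *(4) using *(3) by (intro UN_mono image_mono) auto
    show "(\<Union>i<k. \<psi> i ` W i) \<subseteq> N" using local_parametrizationD(6)[OF *(1)] by (intro UN_least) auto
  qed
  then interpret volume_cover A g N k W \<psi>
    using *(1) by unfold_locales
  show ?thesis
    unfolding induced_volume_def volume_measure_def[symmetric]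
    by (rule theI[where P = "volume_measure TYPE('n) A g N", OF volume_measure_exists])
      (rule volume_measure_unique[OF _ volume_measure_exists])
qed

text \<open>The continuous density is bounded on each compact parameter set, which has finite
  Lebesgue measure. Finiteness of the leaf volume later yields integrability of the expansion
  factor.\<close>

lemma volume_measure_finite:
  assumes emb: "embedded_submanifold TYPE(real^'n) A N" "compactin (atlas_topology A) N"
    and M: "volume_measure TYPE('n) A g N M"
  shows "emeasure M N < \<infinity>"
proof -
  obtain k :: nat and W \<psi> K where
    "(\<forall>i<k. local_parametrization A N (W i :: (real^'n) set) (\<psi> i) \<and> compact (K i) \<and> K i \<subseteq> W i) \<and>
    N = (\<Union>i<k. \<psi> i ` K i)"
    using compact_submanifold_cover[OF emb] by (elim exE)
  then have *: "\<And>i. i < k \<Longrightarrow> local_parametrization A N (W i) (\<psi> i)"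
    "\<And>i. i < k \<Longrightarrow> compact (K i)" "\<And>i. i < k \<Longrightarrow> K i \<subseteq> W i" "N = (\<Union>i<k. \<psi> i ` K i)"
    by blast+
  note D = volume_measureD[OF M]
  have fin: "emeasure M (\<psi> i ` K i) < \<infinity>" if i: "i < k" for i
  proof -
    have b: "K i \<in> sets borel" using *(2)[OF i] by (simp add: compact_imp_closed)
    have c: "continuous_on (K i) (\<lambda>x. sqrt (det (gram_matrix (\<psi> i) x)))"
      by (rule continuous_on_subset[OF continuous_on_volume_density[OF local_parametrizationD(1)[OF *(1)[OF i]]] *(3)[OF i]])
    have "bounded ((\<lambda>x. sqrt (det (gram_matrix (\<psi> i) x))) ` K i)"
      by (rule compact_imp_bounded[OF compact_continuous_image[OF c *(2)[OF i]]])
    then obtain B where B: "\<And>x. x \<in> K i \<Longrightarrow> sqrt (det (gram_matrix (\<psi> i) x)) \<le> B"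
      unfolding bounded_iff by (metis imageI real_norm_def abs_le_D1)
    have "emeasure M (\<psi> i ` K i) = (\<integral>\<^sup>+x\<in>K i. ennreal (sqrt (det (gram_matrix (\<psi> i) x))) \<partial>lborel)"
      using D(3)[OF *(1)[OF i] b *(3)[OF i]] emeasure_density_volume[OF *(1)[OF i] b *(3)[OF i]] by simp
    also have "\<dots> \<le> (\<integral>\<^sup>+x. ennreal B * indicator (K i) x \<partial>lborel)"
      using B by (intro nn_integral_mono) (auto simp: indicator_def intro!: ennreal_leI)
    also have "\<dots> = ennreal B * emeasure lborel (K i)"
      using b by (simp add: nn_integral_cmult_indicator)
    also have "\<dots> < \<infinity>"
      using emeasure_bounded_finite[OF compact_imp_bounded[OF *(2)[OF i]]]
      by (simp add: ennreal_mult_less_top)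
    finally show ?thesis .
  qed
  have "\<psi> i ` K i \<in> sets M" if i: "i < k" for i
    using parametrization_image_borel[OF *(1)[OF i], of "K i"] *(2,3)[OF i]
    by (simp add: D(1) compact_imp_closed inf.absorb2)
  then have "emeasure M N \<le> (\<Sum>i<k. emeasure M (\<psi> i ` K i))"
    unfolding *(4) by (intro emeasure_subadditive_finite) auto
  also have "\<dots> < \<infinity>" using fin by (simp add: ennreal_sum_less_top less_top)
  finally show ?thesis .
qed

text \<open>On the image of \<open>\<psi>\<close> the measure is the push-forward of the coordinate
  density. The restriction to \<open>W\<close> is essential to the formulation, because nothing is
  known about \<open>\<psi>\<close> outside \<open>W\<close>, not even measurability.\<close>

lemma nn_integral_parametrization:
  fixes W :: "(real^'n) set"
  assumes M: "volume_measure TYPE('n) A g N M" and P: "local_parametrization A N W \<psi>"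
    and f: "f \<in> borel_measurable M"
  shows "(\<integral>\<^sup>+p\<in>\<psi> ` W. f p \<partial>M)
    = (\<integral>\<^sup>+x. f (\<psi> x) \<partial>restrict_space (density lborel (volume_density W \<psi>)) W)"
proof -
  let ?\<nu> = "density lborel (volume_density W \<psi>)"
  note D = volume_measureD[OF M] and L = local_parametrizationD[OF P]
  have W: "W \<in> sets borel" using L(2) by simp
  have WM: "\<psi> ` W \<in> sets M"
    using parametrization_image_borel[OF P W] by (simp add: D(1))
  have vim: "W \<inter> \<psi> -` X \<in> sets borel" if "X \<in> sets M" for X
    using parametrization_vimage_borel[OF P] that by (simp add: D(1))
  have \<psi>: "\<psi> \<in> measurable (restrict_space ?\<nu> W) M"
  proof (rule measurableI)
    show "\<psi> x \<in> space M" if "x \<in> space (restrict_space ?\<nu> W)" for x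
      using that L(6) by (auto simp: space_restrict_space D(2))
    show "\<psi> -` X \<inter> space (restrict_space ?\<nu> W) \<in> sets (restrict_space ?\<nu> W)" if "X \<in> sets M" for X
      using vim[OF that] W by (auto simp: sets_restrict_space_iff space_restrict_space Int_commute)
  qed
  have "distr (restrict_space ?\<nu> W) M \<psi> = density M (indicator (\<psi> ` W))"
  proof (rule measure_eqI)
    fix X assume "X \<in> sets (distr (restrict_space ?\<nu> W) M \<psi>)"
    then have X: "X \<in> sets M" by simp
    have "emeasure (distr (restrict_space ?\<nu> W) M \<psi>) X = emeasure ?\<nu> (W \<inter> \<psi> -` X)"
      using W vim[OF X] by (simp add: emeasure_distr[OF \<psi> X] emeasure_restrict_space space_restrict_space Int_commute)
    also have "\<dots> = emeasure M (\<psi> ` (W \<inter> \<psi> -` X))"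
      by (rule D(3)[OF P vim[OF X], symmetric]) auto
    also have "\<psi> ` (W \<inter> \<psi> -` X) = \<psi> ` W \<inter> X" by auto
    also have "emeasure M (\<psi> ` W \<inter> X) = emeasure (density M (indicator (\<psi> ` W))) X"
      using WM X by (simp add: emeasure_density indicator_inter_arith[symmetric] nn_integral_indicator)
    finally show "emeasure (distr (restrict_space ?\<nu> W) M \<psi>) X = emeasure (density M (indicator (\<psi> ` W))) X" .
  qed simp
  then have "(\<integral>\<^sup>+x. f (\<psi> x) \<partial>restrict_space ?\<nu> W) = (\<integral>\<^sup>+p. f p \<partial>density M (indicator (\<psi> ` W)))"
    using nn_integral_distr[OF \<psi>, of f] f by simp
  also have "\<dots> = (\<integral>\<^sup>+p. indicator (\<psi> ` W) p * f p \<partial>M)"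
    using WM f by (intro nn_integral_density) auto
  finally show ?thesis by (simp add: mult.commute)
qed

text \<open>Both volumes are evaluated with the same finite family: if the \<open>\<psi> i\<close>
  cover \<open>N\<close>, their composites with \<open>F\<close> cover \<open>N'\<close>, and by
  injectivity of \<open>F\<close> the disjoint pieces correspond and have the same preimages in the
  parameter domains. On each piece the two densities differ exactly by the factor
  \<open>f\<close>.\<close>

lemma volume_measure_pushforward:
  fixes f :: "'a \<Rightarrow> real"
  assumes M: "volume_measure TYPE('n) A g N M" and M': "volume_measure TYPE('n) A g N' M'"
    and emb: "embedded_submanifold TYPE(real^'n) A N" "compactin (atlas_topology A) N"
    and F: "bij_betw F N N'"
    and par: "\<And>(W :: (real^'n) set) \<psi>. local_parametrization A N W \<psi> \<Longrightarrow> local_parametrization A N' W (\<lambda>x. F (\<psi> x))"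
    and f: "\<And>(W :: (real^'n) set) \<psi>. local_parametrization A N W \<psi> \<Longrightarrow> continuous_on W (\<lambda>x. f (\<psi> x))"
    and vol: "\<And>(W :: (real^'n) set) \<psi> x. local_parametrization A N W \<psi> \<Longrightarrow> x \<in> W \<Longrightarrow>
      sqrt (det (gram_matrix (\<lambda>x. F (\<psi> x)) x)) = f (\<psi> x) * sqrt (det (gram_matrix \<psi> x))"
    and f0: "\<And>p. p \<in> N \<Longrightarrow> 0 \<le> f p"
  shows "f \<in> borel_measurable M" "emeasure M' N' = (\<integral>\<^sup>+p. ennreal (f p) \<partial>M)"
proof -
  obtain k :: nat and W \<psi> K where
    "(\<forall>i<k. local_parametrization A N (W i :: (real^'n) set) (\<psi> i) \<and> compact (K i) \<and> K i \<subseteq> W i) \<and>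
    N = (\<Union>i<k. \<psi> i ` K i)"
    using compact_submanifold_cover[OF emb] by (elim exE)
  then have *: "\<And>i. i < k \<Longrightarrow> local_parametrization A N (W i) (\<psi> i)"
    "\<And>i. i < k \<Longrightarrow> K i \<subseteq> W i" "N = (\<Union>i<k. \<psi> i ` K i)"
    by blast+
  have cov: "N = (\<Union>i<k. \<psi> i ` W i)"
  proof
    show "N \<subseteq> (\<Union>i<k. \<psi> i ` W i)" unfolding *(3) using *(2) by (intro UN_mono image_mono) auto
    show "(\<Union>i<k. \<psi> i ` W i) \<subseteq> N" using local_parametrizationD(6)[OF *(1)] by (intro UN_least) auto
  qed
  interpret C: volume_cover A g N k W \<psi>
    using *(1) cov by unfold_locales
  have cov': "N' = (\<Union>i<k. (\<lambda>x. F (\<psi> i x)) ` W i)"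
  proof -
    have "N' = F ` N" using F by (simp add: bij_betw_def)
    also have "\<dots> = (\<Union>i<k. F ` \<psi> i ` W i)" by (subst cov) (rule image_UN)
    finally show ?thesis by (simp add: image_image)
  qed
  interpret C': volume_cover A g N' k W "\<lambda>i x. F (\<psi> i x)"
    by unfold_locales (rule par, rule *(1), assumption, rule cov')
  note D = volume_measureD[OF M]
  show fm: "f \<in> borel_measurable M"
  proof (rule borel_measurableI)
    fix S :: "real set" assume S: "open S"
    have "W i \<inter> (\<lambda>x. f (\<psi> i x)) -` S \<in> sets borel" if "i < k" for i
      using continuous_open_preimage[OF f[OF *(1)[OF that]] local_parametrizationD(2)[OF *(1)[OF that]] S] by simp
    then have "(\<Union>i<k. \<psi> i ` (W i \<inter> (W i \<inter> (\<lambda>x. f (\<psi> i x)) -` S))) \<in> sets M"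
      unfolding D(1) by (intro C.B.finite_UN ballI parametrization_image_borel[OF *(1)]) auto
    moreover have "f -` S \<inter> space M = (\<Union>i<k. \<psi> i ` (W i \<inter> (W i \<inter> (\<lambda>x. f (\<psi> i x)) -` S)))"
      unfolding D(2) by (subst cov) auto
    ultimately show "f -` S \<inter> space M \<in> sets M" by simp
  qed
  have inj: "inj_on F N" using F by (simp add: bij_betw_def)
  let ?E = "\<lambda>i. W i \<inter> \<psi> i -` C.piece i"
  have E: "?E i \<in> sets borel" if "i < k" for i
    by (rule parametrization_vimage_borel[OF *(1)[OF that] C.piece_borel[OF that]])
  have piece': "W i \<inter> (\<lambda>x. F (\<psi> i x)) -` (N' \<inter> C'.piece i) = ?E i" if i: "i < k" for i
  proof -
    have sub: "\<psi> j ` W j \<subseteq> N" if "j < k" for j using local_parametrizationD(6)[OF *(1)[OF that]] .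
    have pe: "C'.piece i = F ` C.piece i"
    proof -
      have "C'.piece i = F ` (\<psi> i ` W i) - F ` (\<Union>j<i. \<psi> j ` W j)"
        unfolding C'.piece_def by (simp add: image_image image_UN)
      also have "\<dots> = F ` (\<psi> i ` W i - (\<Union>j<i. \<psi> j ` W j))"
        by (rule inj_on_image_set_diff[OF inj, symmetric]) (use sub[OF i] sub[OF less_trans[OF _ i]] in blast)+
      finally show ?thesis by (simp add: C.piece_def)
    qed
    have mem: "F p \<in> F ` C.piece i \<longleftrightarrow> p \<in> C.piece i" if "p \<in> N" for p
      by (rule inj_on_image_mem_iff[OF inj that order_trans[OF C.piece_subset[OF i] sub[OF i]]])
    have FN: "F p \<in> N'" if "p \<in> N" for p using F that by (auto simp: bij_betw_def)
    show ?thesis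
    proof (rule set_eqI)
      fix x
      show "x \<in> W i \<inter> (\<lambda>x. F (\<psi> i x)) -` (N' \<inter> C'.piece i) \<longleftrightarrow> x \<in> ?E i"
      proof (cases "x \<in> W i")
        case True
        then have "\<psi> i x \<in> N" using sub[OF i] by auto
        from True mem[OF this] FN[OF this] show ?thesis by (simp add: pe)
      qed simp
    qed
  qed
  have "emeasure M' N' = C'.cover_measure N'"
    by (rule C'.volume_measure_eq_cover_measure[OF M' C'.B.top])
  also have "\<dots> = (\<Sum>i<k. emeasure (density lborel (volume_density (W i) (\<lambda>x. F (\<psi> i x)))) (?E i))"
    unfolding C'.cover_measure_def using piece' by (intro sum.cong) auto
  also have "\<dots> = (\<Sum>i<k. \<integral>\<^sup>+p. ennreal (f p) * indicator (C.piece i) p \<partial>M)"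
  proof (rule sum.cong[OF refl])
    fix i assume "i \<in> {..<k}" then have i: "i < k" by simp
    have pm: "C.piece i \<in> sets M" using C.piece_borel[OF i] by (simp add: D(1))
    let ?\<nu> = "density lborel (volume_density (W i) (\<psi> i))"
    have W: "W i \<in> sets borel" using local_parametrizationD(2)[OF *(1)[OF i]] by simp
    have vm: "volume_density (W i) (\<psi> i) \<in> borel_measurable lborel"
      by (rule volume_density_measurable[OF *(1)[OF i]])
    have fm2: "(\<lambda>x. ennreal (indicator (W i) x * f (\<psi> i x)) * indicator (?E i) x) \<in> borel_measurable borel"
    proof -
      have "(\<lambda>x. indicator (W i) x *\<^sub>R f (\<psi> i x)) \<in> borel_measurable borel"
        by (rule borel_measurable_continuous_on_indicator[OF W f[OF *(1)[OF i]]])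
      then show ?thesis using E[OF i] by simp
    qed
    have "(\<integral>\<^sup>+p. ennreal (f p) * indicator (C.piece i) p \<partial>M)
      = (\<integral>\<^sup>+p. ennreal (f p) * indicator (C.piece i) p * indicator (\<psi> i ` W i) p \<partial>M)"
      using C.piece_subset[OF i] by (intro nn_integral_cong) (auto simp: indicator_def)
    also have "\<dots> = (\<integral>\<^sup>+x. ennreal (f (\<psi> i x)) * indicator (C.piece i) (\<psi> i x) \<partial>restrict_space ?\<nu> (W i))"
      using fm pm by (intro nn_integral_parametrization[OF M *(1)[OF i]]) simp
    also have "\<dots> = (\<integral>\<^sup>+x. ennreal (f (\<psi> i x)) * indicator (C.piece i) (\<psi> i x) * indicator (W i) x \<partial>?\<nu>)"
      using W by (intro nn_integral_restrict_space) simp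
    also have "\<dots> = (\<integral>\<^sup>+x. ennreal (indicator (W i) x * f (\<psi> i x)) * indicator (?E i) x \<partial>?\<nu>)"
      by (intro nn_integral_cong) (auto simp: indicator_def)
    also have "\<dots> = (\<integral>\<^sup>+x. volume_density (W i) (\<psi> i) x * (ennreal (indicator (W i) x * f (\<psi> i x)) * indicator (?E i) x) \<partial>lborel)"
      using vm fm2 by (intro nn_integral_density) auto
    also have "\<dots> = (\<integral>\<^sup>+x\<in>?E i. ennreal (sqrt (det (gram_matrix (\<lambda>x. F (\<psi> i x)) x))) \<partial>lborel)"
    proof (rule nn_integral_cong)
      fix x :: "real^'n"
      show "volume_density (W i) (\<psi> i) x * (ennreal (indicator (W i) x * f (\<psi> i x)) * indicator (?E i) x)
        = ennreal (sqrt (det (gram_matrix (\<lambda>x. F (\<psi> i x)) x))) * indicator (?E i) x"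
      proof (cases "x \<in> ?E i")
        case True
        then have "0 \<le> f (\<psi> i x)" using f0 local_parametrizationD(6)[OF *(1)[OF i]] by auto
        with True show ?thesis
          using vol[OF *(1)[OF i], of x] by (simp add: volume_density_def ennreal_mult' mult.commute)
      qed simp
    qed
    also have "\<dots> = emeasure (density lborel (volume_density (W i) (\<lambda>x. F (\<psi> i x)))) (?E i)"
      by (rule emeasure_density_volume[OF par[OF *(1)[OF i]] E[OF i], symmetric]) auto
    finally show "emeasure (density lborel (volume_density (W i) (\<lambda>x. F (\<psi> i x)))) (?E i)
      = (\<integral>\<^sup>+p. ennreal (f p) * indicator (C.piece i) p \<partial>M)" ..
  qed
  also have "\<dots> = (\<integral>\<^sup>+p. (\<Sum>i<k. ennreal (f p) * indicator (C.piece i) p) \<partial>M)"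
    using fm C.piece_borel[folded D(1)]
    by (intro nn_integral_sum[symmetric] borel_measurable_times_ennreal borel_measurable_indicator) auto
  also have "\<dots> = (\<integral>\<^sup>+p. ennreal (f p) \<partial>M)"
  proof (rule nn_integral_cong)
    fix p assume "p \<in> space M"
    then have "p \<in> (\<Union>i<k. C.piece i)" by (simp add: D(2) C.UN_piece)
    then obtain i where i: "i < k" "p \<in> C.piece i" by auto
    have "(\<Sum>j<k. ennreal (f p) * indicator (C.piece j) p) = (\<Sum>j<k. if j = i then ennreal (f p) else 0)"
    proof (rule sum.cong[OF refl])
      fix j assume "j \<in> {..<k}"
      then show "ennreal (f p) * indicator (C.piece j) p = (if j = i then ennreal (f p) else 0)"
        using i C.disjoint_piece unfolding disjoint_family_on_def by (cases "j = i") (auto simp: indicator_def)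
    qed
    then show "(\<Sum>j<k. ennreal (f p) * indicator (C.piece j) p) = ennreal (f p)" using i by simp
  qed
  finally show "emeasure M' N' = (\<integral>\<^sup>+p. ennreal (f p) \<partial>M)" .
qed

end

section \<open>The Levi-Civita connection\<close>

context lorentz_manifold
begin

text \<open>\<open>L\<close> maps the standard basis to an orthonormal frame with one timelike
  vector; pairing with a frame vector isolates, up to sign, one coefficient of
  \<open>v\<close>.\<close>

lemma metric_nondegenerate:
  assumes p: "p \<in> carrier_of A" and z: "\<And>w. g p v w = 0"
  shows "v = 0"
proof -
  obtain L :: "'e \<Rightarrow> 'e" and b0 where L: "linear L" "bij L" "b0 \<in> Basis"
    and Lb: "\<forall>b\<in>Basis. \<forall>b'\<in>Basis. g p (L b) (L b') = (if b \<noteq> b' then 0 else if b = b0 then -1 else 1)"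
    using lorentz p unfolding lorentzian_metric_def by blast
  obtain u where u: "v = L u" using L(2) by (metis bij_pointE)
  have u0: "u \<bullet> b' = 0" if b': "b' \<in> Basis" for b'
  proof -
    have lin: "linear (\<lambda>u. g p (L u) (L b'))"
      using linear_compose[OF L(1), of "\<lambda>v. g p v (L b')"] metric_bilinear[OF p]
      by (simp add: bilinear_def o_def)
    have "0 = g p (L u) (L b')" using z u by simp
    also have "\<dots> = (\<Sum>b\<in>Basis. (u \<bullet> b) *\<^sub>R g p (L b) (L b'))" by (rule linear_expansion[OF lin])
    also have "\<dots> = (\<Sum>b\<in>Basis. if b = b' then (u \<bullet> b') * (if b' = b0 then -1 else 1) else 0)"
      using Lb b' by (intro sum.cong refl) auto
    also have "\<dots> = (u \<bullet> b') * (if b' = b0 then -1 else 1)" using b' by simp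
    finally show ?thesis by (auto split: if_splits)
  qed
  have "u = 0" by (rule euclidean_eqI) (simp add: u0)
  then show ?thesis using u L(1) by (simp add: linear_0)
qed

abbreviation cmetric :: "('a, 'e) chart \<Rightarrow> 'e \<Rightarrow> 'e \<Rightarrow> 'e \<Rightarrow> real" where
  "cmetric c \<equiv> pullback_metric A g (chart_inv c)"

lemma cmetric_sym:
  "c \<in> A \<Longrightarrow> x \<in> snd c ` fst c \<Longrightarrow> cmetric c x u v = cmetric c x v u"
  unfolding pullback_metric_def
  by (rule metric_sym) (use chart_inv_in[of x c] in \<open>auto simp: carrier_of_def\<close>)

lemma cmetric_nondegenerate:
  assumes c: "c \<in> A" and x: "x \<in> snd c ` fst c" and z: "\<And>w. cmetric c x v w = 0"
  shows "v = 0"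
proof -
  let ?p = "chart_inv c x"
  have p: "?p \<in> fst c" "snd c ?p = x" using x by (simp_all add: chart_inv_in chart_chart_inv)
  then have pc: "?p \<in> carrier_of A" using c by (auto simp: carrier_of_def)
  obtain v' where v': "v = dchart A c ?p v'" using dchart_bij[OF atlas c p(1)] by (metis bij_pointE)
  have "g ?p v' w = 0" for w
    using pullback_metric_chart[OF atlas c p(1), of g v' w] z p v' by simp
  from metric_nondegenerate[OF pc this] show ?thesis
    using v' dchart_linear[OF atlas c p(1)] by (simp add: linear_0)
qed

text \<open>Lowering an index is injective by nondegeneracy, hence surjective by dimension. This is
  used to raise the index in the Koszul formula.\<close>

lemma cmetric_represent:
  assumes c: "c \<in> A" and x: "x \<in> snd c ` fst c" and K: "linear K"
  shows "\<exists>!z. \<forall>w. cmetric c x z w = K w"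
proof -
  let ?f = "\<lambda>z. \<Sum>b\<in>Basis. cmetric c x z b *\<^sub>R b"
  note bil = chart_metric_bilinear[OF c x]
  have lin: "linear ?f"
    by (rule linearI)
      (simp_all add: bilinear_ladd[OF bil] bilinear_lmul[OF bil] scaleR_add_left sum.distrib scaleR_sum_right)
  have fb: "?f z \<bullet> b = cmetric c x z b" if "b \<in> Basis" for z b
    by (rule inner_sum_left_Basis[OF that])
  have eqI: "cmetric c x z w = L w" if "\<And>b. b \<in> Basis \<Longrightarrow> cmetric c x z b = L b" "linear L" for z w L
  proof -
    have "cmetric c x z w = (\<Sum>b\<in>Basis. (w \<bullet> b) *\<^sub>R cmetric c x z b)"
      using bil by (intro linear_expansion) (simp add: bilinear_def)
    also have "\<dots> = (\<Sum>b\<in>Basis. (w \<bullet> b) *\<^sub>R L b)" by (intro sum.cong refl) (simp add: that(1))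
    also have "\<dots> = L w" by (rule linear_expansion[OF that(2), symmetric])
    finally show ?thesis .
  qed
  have "z = 0" if "?f z = 0" for z
  proof (rule cmetric_nondegenerate[OF c x])
    fix w
    show "cmetric c x z w = 0"
      by (rule eqI[of z "\<lambda>_. 0"]) (use fb[of _ z] that in \<open>auto simp: linear_iff\<close>)
  qed
  then have inj: "inj ?f" using linear_injective_0[OF lin] by blast
  then have "surj ?f" using linear_injective_imp_surjective[OF lin] by simp
  then obtain z where z: "(\<Sum>b\<in>Basis. K b *\<^sub>R b) = ?f z"
    using surjD[OF \<open>surj ?f\<close>, of "\<Sum>b\<in>Basis. K b *\<^sub>R b"] by (elim exE)
  have Kb: "(\<Sum>b\<in>Basis. K b *\<^sub>R b) \<bullet> b = K b" if "b \<in> Basis" for b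
    by (rule inner_sum_left_Basis[OF that])
  have zK: "cmetric c x z w = K w" for w
  proof (rule eqI[OF _ K])
    show "cmetric c x z b = K b" if "b \<in> Basis" for b
      using fb[OF that, of z] Kb[OF that] z by simp
  qed
  have "z' = z" if "\<forall>w. cmetric c x z' w = K w" for z'
  proof (rule injD[OF inj])
    show "?f z' = ?f z" using that zK by simp
  qed
  with zK show ?thesis by blast
qed

definition dmetric :: "('a, 'e) chart \<Rightarrow> 'e \<Rightarrow> 'e \<Rightarrow> 'e \<Rightarrow> 'e \<Rightarrow> real" where
  "dmetric c x u v w = frechet_derivative (\<lambda>y. cmetric c y v w) (at x) u"

lemma cmetric_has_derivative:
  assumes c: "c \<in> A" and x: "x \<in> snd c ` fst c"
  shows "((\<lambda>y. cmetric c y v w) has_derivative (\<lambda>u. dmetric c x u v w)) (at x)"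
  unfolding dmetric_def by (rule smooth_on_has_derivative[OF metric_smooth[OF c] x])

lemma dmetric_expansion:
  assumes c: "c \<in> A" and x: "x \<in> snd c ` fst c"
  shows "dmetric c x u v w = (\<Sum>b\<in>Basis. \<Sum>b'\<in>Basis. (v \<bullet> b) *\<^sub>R (w \<bullet> b') *\<^sub>R dmetric c x u b b')"
proof -
  have "((\<lambda>y. \<Sum>b\<in>Basis. \<Sum>b'\<in>Basis. (v \<bullet> b) *\<^sub>R (w \<bullet> b') *\<^sub>R cmetric c y b b') has_derivative
    (\<lambda>u. \<Sum>b\<in>Basis. \<Sum>b'\<in>Basis. (v \<bullet> b) *\<^sub>R (w \<bullet> b') *\<^sub>R dmetric c x u b b')) (at x)"
    by (intro has_derivative_sum has_derivative_scaleR_right cmetric_has_derivative c x)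
  then have "((\<lambda>y. cmetric c y v w) has_derivative
    (\<lambda>u. \<Sum>b\<in>Basis. \<Sum>b'\<in>Basis. (v \<bullet> b) *\<^sub>R (w \<bullet> b') *\<^sub>R dmetric c x u b b')) (at x)"
    by (rule has_derivative_transform_within_open[OF _ smooth_atlasD(2)[OF atlas c] x])
      (rule bilinear_expansion[OF chart_metric_bilinear[OF c], symmetric])
  from has_derivative_unique[OF cmetric_has_derivative[OF c x] this] show ?thesis by metis
qed

text \<open>The base point and both arguments move, while only the coefficients on constant vectors
  have a known derivative; basis expansion reduces the claim to products of scalar
  functions.\<close>

lemma cmetric_product_rule:
  fixes h :: "'k::real_normed_vector \<Rightarrow> 'e"
  assumes c: "c \<in> A" and x: "h x \<in> snd c ` fst c"
    and h: "(h has_derivative h') (at x)" and a: "(a has_derivative a') (at x)" and b: "(b has_derivative b') (at x)"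
  shows "((\<lambda>y. cmetric c (h y) (a y) (b y)) has_derivative
    (\<lambda>u. dmetric c (h x) (h' u) (a x) (b x) + cmetric c (h x) (a' u) (b x) + cmetric c (h x) (a x) (b' u))) (at x)"
proof -
  let ?C = "snd c ` fst c"
  have "open ?C" by (rule smooth_atlasD(2)[OF atlas c])
  moreover have "isCont h x" using h has_derivative_continuous by blast
  ultimately have "\<forall>\<^sub>F y in at x. h y \<in> ?C"
    using x unfolding continuous_at by (rule_tac topological_tendstoD)
  then obtain T where T: "open T" "x \<in> T" and T': "\<forall>y\<in>T. y \<noteq> x \<longrightarrow> h y \<in> ?C"
    unfolding eventually_at_topological by blast
  have T3: "h y \<in> ?C" if "y \<in> T" for y using T' that x by (cases "y = x") auto
  have G: "((\<lambda>y. cmetric c (h y) i j) has_derivative (\<lambda>u. dmetric c (h x) (h' u) i j)) (at x)" for i j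
    by (rule has_derivative_compose[OF h cmetric_has_derivative[OF c x]])
  have "((\<lambda>y. \<Sum>i\<in>Basis. \<Sum>j\<in>Basis. (a y \<bullet> i) *\<^sub>R (b y \<bullet> j) *\<^sub>R cmetric c (h y) i j) has_derivative
    (\<lambda>u. \<Sum>i\<in>Basis. \<Sum>j\<in>Basis. (a x \<bullet> i) *\<^sub>R ((b x \<bullet> j) *\<^sub>R dmetric c (h x) (h' u) i j
      + (b' u \<bullet> j) *\<^sub>R cmetric c (h x) i j) + (a' u \<bullet> i) *\<^sub>R (b x \<bullet> j) *\<^sub>R cmetric c (h x) i j)) (at x)"
    by (intro has_derivative_sum has_derivative_scaleR has_derivative_inner_left a b G)
  then have *: "((\<lambda>y. cmetric c (h y) (a y) (b y)) has_derivative
    (\<lambda>u. \<Sum>i\<in>Basis. \<Sum>j\<in>Basis. (a x \<bullet> i) *\<^sub>R ((b x \<bullet> j) *\<^sub>R dmetric c (h x) (h' u) i j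
      + (b' u \<bullet> j) *\<^sub>R cmetric c (h x) i j) + (a' u \<bullet> i) *\<^sub>R (b x \<bullet> j) *\<^sub>R cmetric c (h x) i j)) (at x)"
    by (rule has_derivative_transform_within_open[OF _ T(1,2)])
      (rule bilinear_expansion[OF chart_metric_bilinear[OF c T3], symmetric])
  have "(\<Sum>i\<in>Basis. \<Sum>j\<in>Basis. (a x \<bullet> i) *\<^sub>R ((b x \<bullet> j) *\<^sub>R dmetric c (h x) (h' u) i j
      + (b' u \<bullet> j) *\<^sub>R cmetric c (h x) i j) + (a' u \<bullet> i) *\<^sub>R (b x \<bullet> j) *\<^sub>R cmetric c (h x) i j)
    = dmetric c (h x) (h' u) (a x) (b x) + cmetric c (h x) (a' u) (b x) + cmetric c (h x) (a x) (b' u)" for u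
    unfolding dmetric_expansion[OF c x, of "h' u" "a x" "b x"]
      bilinear_expansion[OF chart_metric_bilinear[OF c x], of "a' u" "b x"]
      bilinear_expansion[OF chart_metric_bilinear[OF c x], of "a x" "b' u"]
    by (simp add: sum.distrib scaleR_add_right algebra_simps del: Finite_Cartesian_Product.sum_cmul)
  with * show ?thesis by simp
qed

text \<open>The body of the definite description in \<open>levi_civita\<close>, named so that
  existence and uniqueness can be stated.\<close>

definition christoffel :: "('a, 'e) chart \<Rightarrow> 'e \<Rightarrow> ('e \<Rightarrow> 'e \<Rightarrow> 'e) \<Rightarrow> bool" where
  "christoffel c x \<Gamma> \<longleftrightarrow> bilinear \<Gamma> \<and> (\<forall>u v. \<Gamma> u v = \<Gamma> v u) \<and>
     (\<forall>u v w. dmetric c x u v w = cmetric c x (\<Gamma> u v) w + cmetric c x v (\<Gamma> u w))"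

lemma dmetric_linear:
  assumes c: "c \<in> A" and x: "x \<in> snd c ` fst c"
  shows "linear (\<lambda>u. dmetric c x u v w)" "linear (\<lambda>v. dmetric c x u v w)" "linear (\<lambda>w. dmetric c x u v w)"
proof -
  show "linear (\<lambda>u. dmetric c x u v w)"
    using has_derivative_linear[OF cmetric_has_derivative[OF c x]] .
  have 1: "(\<lambda>v. dmetric c x u v w) = (\<lambda>v. \<Sum>b\<in>Basis. \<Sum>b'\<in>Basis. (v \<bullet> b) *\<^sub>R (w \<bullet> b') *\<^sub>R dmetric c x u b b')"
    by (rule ext) (rule dmetric_expansion[OF c x])
  show "linear (\<lambda>v. dmetric c x u v w)"
    by (subst 1, rule linearI)
      (simp_all add: inner_add_left algebra_simps sum.distrib sum_distrib_left)
  have 2: "(\<lambda>w. dmetric c x u v w) = (\<lambda>w. \<Sum>b\<in>Basis. \<Sum>b'\<in>Basis. (v \<bullet> b) *\<^sub>R (w \<bullet> b') *\<^sub>R dmetric c x u b b')"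
    by (rule ext) (rule dmetric_expansion[OF c x])
  show "linear (\<lambda>w. dmetric c x u v w)"
    by (subst 2, rule linearI)
      (simp_all add: inner_add_left algebra_simps sum.distrib sum_distrib_left)
qed

lemma dmetric_sym:
  assumes c: "c \<in> A" and x: "x \<in> snd c ` fst c"
  shows "dmetric c x u v w = dmetric c x u w v"
proof -
  have "((\<lambda>y. cmetric c y w v) has_derivative (\<lambda>u. dmetric c x u v w)) (at x)"
    by (rule has_derivative_transform_within_open[OF cmetric_has_derivative[OF c x] smooth_atlasD(2)[OF atlas c] x])
      (rule cmetric_sym[OF c])
  from has_derivative_unique[OF this cmetric_has_derivative[OF c x]] show ?thesis by metis
qed

text \<open>The Koszul formula for coordinate fields, whose brackets vanish: two of the cyclic
  compatibility equations are added, the third is subtracted, and symmetry of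
  \<open>\<Gamma>\<close> cancels the other terms.\<close>

lemma christoffel_koszul:
  assumes c: "c \<in> A" and x: "x \<in> snd c ` fst c" and \<Gamma>: "christoffel c x \<Gamma>"
  shows "2 * cmetric c x (\<Gamma> u v) w = dmetric c x u v w + dmetric c x v u w - dmetric c x w u v"
proof -
  have d: "dmetric c x u v w = cmetric c x (\<Gamma> u v) w + cmetric c x v (\<Gamma> u w)" for u v w
    using \<Gamma> by (simp add: christoffel_def)
  have s: "\<Gamma> u v = \<Gamma> v u" for u v using \<Gamma> by (simp add: christoffel_def)
  show ?thesis
    unfolding d using s[of u v] s[of u w] s[of v w] cmetric_sym[OF c x] by simp
qed

lemma christoffel_unique:
  assumes c: "c \<in> A" and x: "x \<in> snd c ` fst c" and \<Gamma>: "christoffel c x \<Gamma>" "christoffel c x \<Gamma>'"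
  shows "\<Gamma> = \<Gamma>'"
proof (intro ext)
  fix u v
  have "cmetric c x (\<Gamma> u v - \<Gamma>' u v) w = 0" for w
    using christoffel_koszul[OF c x \<Gamma>(1), of u v w] christoffel_koszul[OF c x \<Gamma>(2), of u v w]
    by (simp add: bilinear_lsub[OF chart_metric_bilinear[OF c x]])
  from cmetric_nondegenerate[OF c x this] show "\<Gamma> u v = \<Gamma>' u v" by simp
qed

lemma christoffel_exists:
  assumes c: "c \<in> A" and x: "x \<in> snd c ` fst c"
  shows "\<exists>\<Gamma>. christoffel c x \<Gamma>"
proof -
  let ?G = "cmetric c x" and ?D = "dmetric c x"
  \<comment> \<open>Half the right-hand side of the Koszul formula, hence forced by uniqueness;
    representing it through the metric defines \<open>\<Gamma>\<close>.\<close>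
  define K where "K u v w = (?D u v w + ?D v u w - ?D w u v) / 2" for u v w
  note bil = chart_metric_bilinear[OF c x] and dl = dmetric_linear[OF c x]
  have add: "?D (u + u') v w = ?D u v w + ?D u' v w" "?D u (v + v') w = ?D u v w + ?D u v' w"
    "?D u v (w + w') = ?D u v w + ?D u v w'" for u u' v v' w w'
    using dl[THEN linear_add] by simp_all
  have mul: "?D (r *\<^sub>R u) v w = r * ?D u v w" "?D u (r *\<^sub>R v) w = r * ?D u v w"
    "?D u v (r *\<^sub>R w) = r * ?D u v w" for r u v w
    using dl[THEN linear_cmul] by simp_all
  have "linear (K u v)" for u v
    by (rule linearI) (simp_all add: K_def add mul field_simps)
  from cmetric_represent[OF c x this] obtain \<Gamma> where \<Gamma>: "?G (\<Gamma> u v) w = K u v w" for u v w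
    by metis
  have eqI: "z = z'" if "\<And>w. ?G z w = ?G z' w" for z z'
    using cmetric_nondegenerate[OF c x, of "z - z'"] that by (simp add: bilinear_lsub[OF bil])
  have sym: "\<Gamma> u v = \<Gamma> v u" for u v
    by (rule eqI) (simp add: \<Gamma> K_def dmetric_sym[OF c x, of _ u v])
  have lin: "linear (\<Gamma> u)" for u
    by (rule linearI; rule eqI)
      (simp_all add: \<Gamma> K_def add mul bilinear_ladd[OF bil] bilinear_lmul[OF bil] field_simps)
  have "(\<lambda>u. \<Gamma> u v) = \<Gamma> v" for v using sym by (rule ext)
  with lin have "bilinear \<Gamma>" by (simp add: bilinear_def)
  moreover have "?D u v w = ?G (\<Gamma> u v) w + ?G v (\<Gamma> u w)" for u v w
    unfolding cmetric_sym[OF c x, of v "\<Gamma> u w"] \<Gamma> K_def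
    using dmetric_sym[OF c x, of u v w] by (simp add: field_simps)
  ultimately have "christoffel c x \<Gamma>"
    using sym unfolding christoffel_def by blast
  then show ?thesis by blast
qed

lemma christoffel_levi_civita:
  assumes c: "c \<in> A" and x: "x \<in> snd c ` fst c"
  shows "christoffel c x (levi_civita A g c x)"
proof -
  have "levi_civita A g c x = (THE \<Gamma>. christoffel c x \<Gamma>)"
    unfolding levi_civita_def christoffel_def dmetric_def Let_def ..
  then show ?thesis
    using christoffel_exists[OF c x] christoffel_unique[OF c x] by (metis theI)
qed

text \<open>Metric compatibility for fields along an arbitrary map \<open>h\<close>, in components.
  It serves both the transformation law of the Christoffel symbols and the evolution of the slice
  metric.\<close>

lemma covariant_product_rule:
  fixes h :: "'k::real_normed_vector \<Rightarrow> 'e"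
  assumes c: "c \<in> A" and x: "h x \<in> snd c ` fst c"
    and h: "(h has_derivative h') (at x)" and a: "(a has_derivative a') (at x)" and b: "(b has_derivative b') (at x)"
  defines "\<Gamma> \<equiv> levi_civita A g c (h x)"
  shows "((\<lambda>y. cmetric c (h y) (a y) (b y)) has_derivative
    (\<lambda>u. cmetric c (h x) (a' u + \<Gamma> (h' u) (a x)) (b x) + cmetric c (h x) (a x) (b' u + \<Gamma> (h' u) (b x)))) (at x)"
proof -
  note bil = chart_metric_bilinear[OF c x]
  have "dmetric c (h x) u v w = cmetric c (h x) (\<Gamma> u v) w + cmetric c (h x) v (\<Gamma> u w)" for u v w
    using christoffel_levi_civita[OF c x] by (simp add: christoffel_def \<Gamma>_def)
  then show ?thesis
    using cmetric_product_rule[OF c x h a b]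
    by (simp add: bilinear_ladd[OF bil] bilinear_radd[OF bil] algebra_simps)
qed

end

section \<open>The geodesic equation in a fixed chart and geodesics with vanishing initial
  velocity\<close>

lemma derivative_along_has_derivative:
  fixes f :: "'e::euclidean_space \<Rightarrow> 'h::euclidean_space" and h :: "'k::real_normed_vector \<Rightarrow> 'e"
  assumes f: "smooth_on U f" "open U" and x: "h x \<in> U"
    and h: "(h has_derivative h') (at x)" and v: "(v has_derivative v') (at x)"
  shows "((\<lambda>x. frechet_derivative f (at (h x)) (v x)) has_derivative
    (\<lambda>k. frechet_derivative (\<lambda>y. frechet_derivative f (at y) (v x)) (at (h x)) (h' k)
       + frechet_derivative f (at (h x)) (v' k))) (at x)"
proof -
  let ?D = "\<lambda>y. frechet_derivative f (at y)"
  let ?DD = "\<lambda>b k. frechet_derivative (\<lambda>y. ?D y b) (at (h x)) (h' k)"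
  have lin: "linear (?D y)" if "y \<in> U" for y
    by (rule linear_frechet_derivative[OF smooth_on_differentiable[OF f(1) that]])
  have "isCont h x" using h has_derivative_continuous by blast
  then have "\<forall>\<^sub>F y in at x. h y \<in> U"
    using x f(2) unfolding continuous_at by (rule_tac topological_tendstoD)
  then obtain T where T: "open T" "x \<in> T" and T': "\<forall>y\<in>T. y \<noteq> x \<longrightarrow> h y \<in> U"
    unfolding eventually_at_topological by blast
  have T3: "h y \<in> U" if "y \<in> T" for y using T' that x by (cases "y = x") auto
  have Db: "((\<lambda>z. ?D (h z) b) has_derivative ?DD b) (at x)" for b
    by (rule has_derivative_compose[OF h smooth_on_has_derivative[OF smooth_on_derivative[OF f(1)] x]])
  have "((\<lambda>z. \<Sum>b\<in>Basis. (v z \<bullet> b) *\<^sub>R ?D (h z) b) has_derivative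
    (\<lambda>k. \<Sum>b\<in>Basis. (v x \<bullet> b) *\<^sub>R ?DD b k + (v' k \<bullet> b) *\<^sub>R ?D (h x) b)) (at x)"
    by (intro has_derivative_sum has_derivative_scaleR has_derivative_inner_left v Db)
  then have 1: "((\<lambda>z. ?D (h z) (v z)) has_derivative
    (\<lambda>k. \<Sum>b\<in>Basis. (v x \<bullet> b) *\<^sub>R ?DD b k + (v' k \<bullet> b) *\<^sub>R ?D (h x) b)) (at x)"
    by (rule has_derivative_transform_within_open[OF _ T])
      (rule linear_expansion[OF lin[OF T3], symmetric])
  have "((\<lambda>y. \<Sum>b\<in>Basis. (v x \<bullet> b) *\<^sub>R ?D y b) has_derivative
    (\<lambda>u. \<Sum>b\<in>Basis. (v x \<bullet> b) *\<^sub>R frechet_derivative (\<lambda>y. ?D y b) (at (h x)) u)) (at (h x))"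
    by (intro has_derivative_sum has_derivative_scaleR_right smooth_on_has_derivative[OF smooth_on_derivative[OF f(1)] x])
  then have "((\<lambda>y. ?D y (v x)) has_derivative
    (\<lambda>u. \<Sum>b\<in>Basis. (v x \<bullet> b) *\<^sub>R frechet_derivative (\<lambda>y. ?D y b) (at (h x)) u)) (at (h x))"
    by (rule has_derivative_transform_within_open[OF _ f(2) x]) (rule linear_expansion[OF lin, symmetric])
  from frechet_derivative_eq[OF this]
  have 2: "frechet_derivative (\<lambda>y. ?D y (v x)) (at (h x)) (h' k) = (\<Sum>b\<in>Basis. (v x \<bullet> b) *\<^sub>R ?DD b k)" for k
    by (rule fun_cong)
  show ?thesis
    using 1 unfolding 2 linear_expansion[OF lin[OF x], of "v' k" for k] by (simp only: sum.distrib)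
qed

text \<open>A Gronwall argument: the squared norm is nonincreasing to the right of \<open>a\<close>
  after weighting with \<open>exp (- 2 * C * s)\<close>, and nondecreasing to the left of
  \<open>a\<close> after weighting with \<open>exp (2 * C * s)\<close>. As it vanishes at
  \<open>a\<close>, it cannot become positive on either side.\<close>

lemma linear_growth_vanishes:
  fixes v :: "real \<Rightarrow> 'e::real_inner"
  assumes v: "\<And>s. s \<in> ball a e \<Longrightarrow> (v has_vector_derivative v' s) (at s)"
    and bound: "\<And>s. s \<in> ball a e \<Longrightarrow> norm (v' s) \<le> C * norm (v s)"
    and v0: "v a = 0" and s: "s \<in> ball a e"
  shows "v s = 0"
proof -
  have e: "e > 0" using s by (metis ball_empty empty_iff not_le)
  have u: "((\<lambda>s. v s \<bullet> v s) has_real_derivative 2 * (v s \<bullet> v' s)) (at s)" if "s \<in> ball a e" for s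
    using v[OF that] unfolding has_vector_derivative_def has_field_derivative_def
    by (auto intro!: derivative_eq_intros simp: inner_commute)
  have est: "\<bar>2 * (v s \<bullet> v' s)\<bar> \<le> 2 * C * (v s \<bullet> v s)" if "s \<in> ball a e" for s
  proof -
    have "\<bar>v s \<bullet> v' s\<bar> \<le> norm (v s) * norm (v' s)" by (rule Cauchy_Schwarz_ineq2)
    also have "\<dots> \<le> norm (v s) * (C * norm (v s))" by (intro mult_left_mono bound that) simp
    finally show ?thesis by (simp add: dot_square_norm power2_eq_square abs_mult mult.left_commute)
  qed
  have d: "((\<lambda>s. exp (k * s) * (v s \<bullet> v s)) has_real_derivative
      exp (k * s) * (2 * (v s \<bullet> v' s) + k * (v s \<bullet> v s))) (at s)" if "s \<in> ball a e" for k s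
    by (rule derivative_eq_intros u[OF that] refl)+ (simp add: algebra_simps)
  have "v s \<bullet> v s \<le> 0"
  proof (cases "a \<le> s")
    case True
    have "exp (- (2 * C) * s) * (v s \<bullet> v s) \<le> exp (- (2 * C) * a) * (v a \<bullet> v a)"
    proof (rule DERIV_nonpos_imp_nonincreasing[OF True, where f = "\<lambda>s. exp (- (2 * C) * s) * (v s \<bullet> v s)"])
      fix r assume "a \<le> r" "r \<le> s"
      then have r: "r \<in> ball a e" using s by (auto simp: dist_real_def)
      show "\<exists>y. ((\<lambda>s. exp (- (2 * C) * s) * (v s \<bullet> v s)) has_real_derivative y) (at r) \<and> y \<le> 0"
        using d[OF r, of "- (2 * C)"] est[OF r] by (intro exI conjI) (auto simp: mult_le_0_iff)
    qed
    then show ?thesis using v0 by (simp add: mult_le_0_iff)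
  next
    case False
    have "exp (2 * C * s) * (v s \<bullet> v s) \<le> exp (2 * C * a) * (v a \<bullet> v a)"
    proof (rule DERIV_nonneg_imp_nondecreasing[where f = "\<lambda>s. exp (2 * C * s) * (v s \<bullet> v s)"])
      fix r assume "s \<le> r" "r \<le> a"
      then have r: "r \<in> ball a e" using s by (auto simp: dist_real_def)
      show "\<exists>y. ((\<lambda>s. exp (2 * C * s) * (v s \<bullet> v s)) has_real_derivative y) (at r) \<and> 0 \<le> y"
        using d[OF r, of "2 * C"] est[OF r] by (intro exI conjI) (auto simp: zero_le_mult_iff)
    qed (use False in simp)
    then show ?thesis using v0 by (simp add: mult_le_0_iff)
  qed
  then show ?thesis using inner_ge_zero[of "v s"] inner_eq_zero_iff[of "v s"] by linarith
qed

context lorentz_manifold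
begin

text \<open>The symbols of \<open>d\<close> are pulled back to \<open>c\<close> and corrected by the
  second derivative of the transition map. The result is symmetric, because second derivatives are,
  and compatible with the metric, because \<open>\<phi>\<close> relates the two coordinate metrics;
  uniqueness then identifies it with the symbols of \<open>c\<close>.\<close>

lemma christoffel_transformation:
  assumes c: "c \<in> A" "p \<in> fst c" and d: "d \<in> A" "p \<in> fst d"
  defines "\<phi> \<equiv> \<lambda>x. snd d (chart_inv c x)"
  defines "J \<equiv> frechet_derivative \<phi> (at (snd c p))"
  shows "J (levi_civita A g c (snd c p) u v) =
    levi_civita A g d (snd d p) (J u) (J v) + frechet_derivative (\<lambda>y. frechet_derivative \<phi> (at y) v) (at (snd c p)) u"
proof -
  let ?x = "snd c p" and ?\<Gamma> = "levi_civita A g d (snd d p)"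
  let ?U = "snd c ` (fst c \<inter> fst d)"
  define H where "H u v = frechet_derivative (\<lambda>y. frechet_derivative \<phi> (at y) v) (at ?x) u" for u v
  have U: "open ?U" "?x \<in> ?U" using smooth_atlasD(3)[OF atlas c(1) d(1)] c d by auto
  have sm: "smooth_on ?U \<phi>" using smooth_atlasD(4)[OF atlas c(1) d(1)] by (simp add: \<phi>_def o_def)
  have x: "?x \<in> snd c ` fst c" and y: "snd d p \<in> snd d ` fst d" using c d by auto
  have \<phi>x: "\<phi> ?x = snd d p" by (simp add: \<phi>_def chart_inv_chart[OF atlas c])
  have J: "linear J" "(\<phi> has_derivative J) (at ?x)"
    using transition_linear[OF atlas c(1) d(1) c(2) d(2)] transition_has_derivative[OF atlas c(1) d(1) c(2) d(2)]
    by (simp_all add: J_def \<phi>_def)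
  have "inj J"
  proof (rule injI)
    fix a b assume ab: "J a = J b"
    obtain a' b' where *: "a = dchart A c p a'" "b = dchart A c p b'"
      using dchart_bij[OF atlas c] by (metis bij_pointE)
    then have "dchart A d p a' = dchart A d p b'"
      using ab dchart_change[OF atlas c(1) d(1) c(2) d(2)] by (simp add: J_def \<phi>_def)
    then have "a' = b'" by (rule injD[OF bij_is_inj[OF dchart_bij[OF atlas d]]])
    then show "a = b" using * by simp
  qed
  then obtain J' where J': "linear J'" "J' \<circ> J = id" using linear_injective_left_inverse[OF J(1)] by blast
  then have JJ': "J (J' z) = z" for z using linear_inverse_left[OF J'(1) J(1)] by (metis comp_apply id_apply)
  have H: "linear (\<lambda>u. H u v)" "H u v = H v u" for u v
    unfolding H_def
    by (rule linear_frechet_derivative[OF smooth_on_differentiable[OF smooth_on_derivative[OF sm] U(2)]])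
      (rule symmetric_second_derivative[OF sm U])
  have \<Gamma>: "bilinear ?\<Gamma>" "?\<Gamma> u v = ?\<Gamma> v u" for u v
    using christoffel_levi_civita[OF d(1) y] by (auto simp: christoffel_def)
  \<comment> \<open>The asserted law solved for the symbols of \<open>c\<close>, with
    \<open>J'\<close> the inverse of \<open>J\<close>.\<close>
  define \<Gamma>' where "\<Gamma>' u v = J' (?\<Gamma> (J u) (J v) + H u v)" for u v
  have J\<Gamma>': "J (\<Gamma>' u v) = ?\<Gamma> (J u) (J v) + H u v" for u v by (simp add: \<Gamma>'_def JJ')
  have sym: "\<Gamma>' u v = \<Gamma>' v u" for u v
    unfolding \<Gamma>'_def using H(2)[of u v] \<Gamma>(2)[of "J u" "J v"] by simp
  have lin: "linear (\<lambda>u. \<Gamma>' u v)" for v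
    unfolding \<Gamma>'_def
    by (rule linearI)
      (simp_all add: linear_add[OF J'(1)] linear_add[OF J(1)] linear_add[OF H(1)] linear_cmul[OF J'(1)]
        linear_cmul[OF J(1)] linear_cmul[OF H(1)] bilinear_ladd[OF \<Gamma>(1)] bilinear_lmul[OF \<Gamma>(1)] algebra_simps)
  have lin2: "linear (\<Gamma>' u)" for u
  proof -
    have "\<Gamma>' u = (\<lambda>v. \<Gamma>' v u)" using sym by (rule ext)
    then show ?thesis by (rule ssubst) (rule lin)
  qed
  have bil: "bilinear \<Gamma>'" unfolding bilinear_def using lin lin2 by blast
  have G: "cmetric c z a b = cmetric d (\<phi> z) (frechet_derivative \<phi> (at z) a) (frechet_derivative \<phi> (at z) b)"
    if "z \<in> ?U" for z a b
    unfolding \<phi>_def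
    by (rule pullback_metric_in_chart[OF smooth_to_chart_inv[OF atlas c(1)] _ d(1)])
      (use that c atlas in auto)
  have GJ: "cmetric d (snd d p) (J a) (J b) = cmetric c ?x a b" for a b
    using G[OF U(2), of a b] by (simp add: \<phi>x J_def)
  have compat: "dmetric c ?x u v w = cmetric c ?x (\<Gamma>' u v) w + cmetric c ?x v (\<Gamma>' u w)" for u v w
  proof -
    have Dv: "((\<lambda>z. frechet_derivative \<phi> (at z) v) has_derivative (\<lambda>u. H u v)) (at ?x)" for v
      unfolding H_def by (rule smooth_on_has_derivative[OF smooth_on_derivative[OF sm] U(2)])
    have "((\<lambda>z. cmetric d (\<phi> z) (frechet_derivative \<phi> (at z) v) (frechet_derivative \<phi> (at z) w)) has_derivative
      (\<lambda>u. cmetric d (snd d p) (H u v + ?\<Gamma> (J u) (J v)) (J w) + cmetric d (snd d p) (J v) (H u w + ?\<Gamma> (J u) (J w)))) (at ?x)"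
      using covariant_product_rule[OF d(1) _ J(2) Dv Dv, of v w] y by (simp add: \<phi>x J_def[symmetric])
    then have "((\<lambda>z. cmetric c z v w) has_derivative
      (\<lambda>u. cmetric d (snd d p) (H u v + ?\<Gamma> (J u) (J v)) (J w) + cmetric d (snd d p) (J v) (H u w + ?\<Gamma> (J u) (J w)))) (at ?x)"
      by (rule has_derivative_transform_within_open[OF _ U]) (rule G[symmetric])
    from fun_cong[OF has_derivative_unique[OF cmetric_has_derivative[OF c(1) x] this], of u]
    have "dmetric c ?x u v w = cmetric d (snd d p) (J (\<Gamma>' u v)) (J w) + cmetric d (snd d p) (J v) (J (\<Gamma>' u w))"
      unfolding J\<Gamma>' by (simp only: add.commute)
    then show ?thesis by (simp add: GJ)
  qed
  have "christoffel c ?x \<Gamma>'" using bil sym compat unfolding christoffel_def by blast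
  from christoffel_unique[OF c(1) x christoffel_levi_civita[OF c(1) x] this]
  show ?thesis using J\<Gamma>' by (simp add: H_def)
qed

text \<open>By the Koszul formula the lowered symbols are controlled by first derivatives of the
  metric, and near \<open>x0\<close> the metric is so close to its value at \<open>x0\<close> that
  lowering an index still expands norms by a definite factor. Equal arguments are enough for the
  geodesic equation.\<close>

lemma christoffel_locally_bounded:
  assumes c: "c \<in> A" and x0: "x0 \<in> snd c ` fst c"
  shows "\<exists>e>0. \<exists>C. ball x0 e \<subseteq> snd c ` fst c \<and>
    (\<forall>x\<in>ball x0 e. \<forall>v. norm (levi_civita A g c x v v) \<le> C * (norm v)\<^sup>2)"
proof -
  let ?C = "snd c ` fst c"
  have C: "open ?C" by (rule smooth_atlasD(2)[OF atlas c])
  define F where "F x z = (\<Sum>b\<in>Basis. cmetric c x z b *\<^sub>R b)" for x z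
  have Fb: "F x z \<bullet> b = cmetric c x z b" if "b \<in> Basis" for x z b
    unfolding F_def by (rule inner_sum_left_Basis[OF that])
  note bil = chart_metric_bilinear[OF c]
  have lF: "linear (F x)" if "x \<in> ?C" for x
    unfolding F_def
    by (rule linearI)
      (simp_all add: bilinear_ladd[OF bil[OF that]] bilinear_lmul[OF bil[OF that]] scaleR_add_left sum.distrib scaleR_sum_right)
  have "z = 0" if z: "F x0 z = 0" for z
  proof (rule cmetric_nondegenerate[OF c x0])
    fix w
    have "cmetric c x0 z w = (\<Sum>b\<in>Basis. (w \<bullet> b) *\<^sub>R cmetric c x0 z b)"
      using bil[OF x0] by (intro linear_expansion) (simp add: bilinear_def)
    also have "\<dots> = 0" using Fb[of _ x0 z] z by (intro sum.neutral) auto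
    finally show "cmetric c x0 z w = 0" .
  qed
  then have "inj (F x0)" using linear_injective_0[OF lF[OF x0]] by blast
  then obtain m where m: "m > 0" "\<And>z. m * norm z \<le> norm (F x0 z)"
    using linear_inj_bounded_below_pos[OF lF[OF x0]] by metis
  define M where "M = (\<Sum>i\<in>(Basis :: 'e set). \<Sum>j\<in>(Basis :: 'e set). \<Sum>k\<in>(Basis :: 'e set). \<bar>dmetric c x0 i j k\<bar>)"
  define err where "err x = (\<Sum>i\<in>Basis. \<Sum>b\<in>Basis. \<bar>cmetric c x i b - cmetric c x0 i b\<bar>)" for x
  define S where "S x = (\<Sum>i\<in>(Basis :: 'e set). \<Sum>j\<in>(Basis :: 'e set). \<Sum>k\<in>(Basis :: 'e set). \<bar>dmetric c x i j k\<bar>)" for x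
  have "continuous_on ?C err"
    unfolding err_def by (intro continuous_intros smooth_on_continuous_on metric_smooth c)
  moreover have "continuous_on ?C S"
    unfolding S_def dmetric_def
    by (intro continuous_intros smooth_on_continuous_on[OF smooth_on_derivative[OF metric_smooth[OF c]]])
  ultimately have "isCont err x0" "isCont S x0"
    using continuous_on_eq_continuous_at[OF C] x0 by blast+
  moreover have "err x0 = 0" by (simp add: err_def)
  ultimately obtain e1 e2 where e: "e1 > 0" "\<And>x. dist x x0 < e1 \<Longrightarrow> \<bar>err x\<bar> < m / 2"
    "e2 > 0" "\<And>x. dist x x0 < e2 \<Longrightarrow> \<bar>S x - S x0\<bar> < 1"
    using m(1) unfolding continuous_at_eps_delta dist_real_def
    by (metis diff_zero half_gt_zero zero_less_one)
  obtain e3 where e3: "e3 > 0" "ball x0 e3 \<subseteq> ?C" using C x0 open_contains_ball by blast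
  let ?e = "min e1 (min e2 e3)"
  \<comment> \<open>\<open>2 / m\<close> comes from undoing the lowering, whose constant
    \<open>m\<close> at \<open>x0\<close> is halved nearby; \<open>DIM('e)\<close> from bounding the
    norm by the sum of components; \<open>3 / 2\<close> from three Koszul terms and the factor
    \<open>2\<close> in that formula; \<open>S x0 + 1\<close> bounds the metric derivatives near
    \<open>x0\<close>.\<close>
  let ?K = "2 / m * (real (DIM('e)) * (3 / 2 * (S x0 + 1)))"
  have "norm (levi_civita A g c x v v) \<le> ?K * (norm v)\<^sup>2" if x: "x \<in> ball x0 ?e" for x v
  proof -
    have xC: "x \<in> ?C" using x e3 by auto
    have ex: "\<bar>err x\<bar> < m / 2" "S x \<le> S x0 + 1" using e x by (force simp: dist_commute)+
    let ?z = "levi_civita A g c x v v"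
    have low: "m / 2 * norm z \<le> norm (F x z)" for z
    proof -
      have "F x z - F x0 z = (\<Sum>b\<in>Basis. (cmetric c x z b - cmetric c x0 z b) *\<^sub>R b)"
        by (simp add: F_def sum_subtractf scaleR_diff_left)
      then have "norm (F x z - F x0 z) = norm (\<Sum>b\<in>Basis. (cmetric c x z b - cmetric c x0 z b) *\<^sub>R b)"
        by (rule arg_cong)
      also have "\<dots> \<le> (\<Sum>b\<in>Basis. \<bar>cmetric c x z b - cmetric c x0 z b\<bar>)"
        by (rule order_trans[OF norm_sum]) (simp add: sum_mono)
      also have "\<dots> \<le> (\<Sum>b\<in>Basis. \<Sum>i\<in>Basis. norm z * \<bar>cmetric c x i b - cmetric c x0 i b\<bar>)"
      proof (rule sum_mono)
        fix b :: 'e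
        have "cmetric c y z b = (\<Sum>i\<in>Basis. (z \<bullet> i) *\<^sub>R cmetric c y i b)" if "y \<in> ?C" for y
        proof -
          have "linear (\<lambda>z. cmetric c y z b)"
            using bil[OF that, unfolded bilinear_def, THEN conjunct2, THEN spec, of b] .
          from linear_expansion[OF this, of z] show ?thesis .
        qed
        then have "cmetric c x z b - cmetric c x0 z b
          = (\<Sum>i\<in>Basis. (z \<bullet> i) *\<^sub>R cmetric c x i b) - (\<Sum>i\<in>Basis. (z \<bullet> i) *\<^sub>R cmetric c x0 i b)"
          using xC x0 by (intro arg_cong2[where f="(-)"]) blast+
        also have "\<dots> = (\<Sum>i\<in>Basis. (z \<bullet> i) *\<^sub>R (cmetric c x i b - cmetric c x0 i b))"
          by (simp only: sum_subtractf scaleR_diff_right)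
        finally have "cmetric c x z b - cmetric c x0 z b
          = (\<Sum>i\<in>Basis. (z \<bullet> i) *\<^sub>R (cmetric c x i b - cmetric c x0 i b))" .
        then have "\<bar>cmetric c x z b - cmetric c x0 z b\<bar>
          = \<bar>\<Sum>i\<in>Basis. (z \<bullet> i) *\<^sub>R (cmetric c x i b - cmetric c x0 i b)\<bar>" by (rule arg_cong)
        also have "\<dots> \<le> (\<Sum>i\<in>Basis. \<bar>(z \<bullet> i) *\<^sub>R (cmetric c x i b - cmetric c x0 i b)\<bar>)" by (rule sum_abs)
        also have "\<dots> \<le> (\<Sum>i\<in>Basis. norm z * \<bar>cmetric c x i b - cmetric c x0 i b\<bar>)"
          by (intro sum_mono) (simp add: abs_mult mult_right_mono Basis_le_norm)
        finally show "\<bar>cmetric c x z b - cmetric c x0 z b\<bar> \<le> (\<Sum>i\<in>Basis. norm z * \<bar>cmetric c x i b - cmetric c x0 i b\<bar>)" .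
      qed
      also have "\<dots> = norm z * err x"
        unfolding err_def by (subst sum.swap) (simp add: sum_distrib_left)
      also have "\<dots> \<le> norm z * (m / 2)" using ex(1) by (intro mult_left_mono) auto
      finally have "norm (F x z - F x0 z) \<le> norm z * (m / 2)" .
      moreover have "norm (F x0 z) \<le> norm (F x z) + norm (F x z - F x0 z)"
        by (metis norm_minus_commute norm_triangle_sub add.commute)
      ultimately show ?thesis using m(2)[of z] by (simp add: field_simps)
    qed
    have dm: "\<bar>dmetric c x a v' w'\<bar> \<le> norm a * norm v' * norm w' * S x" for a v' w'
    proof -
      have "dmetric c x a v' w' = (\<Sum>i\<in>Basis. (a \<bullet> i) *\<^sub>R dmetric c x i v' w')"
        by (rule linear_expansion[OF dmetric_linear(1)[OF c xC]])
      also have "\<dots> = (\<Sum>i\<in>Basis. \<Sum>j\<in>Basis. \<Sum>k\<in>Basis. (a \<bullet> i) * ((v' \<bullet> j) * ((w' \<bullet> k) * dmetric c x i j k)))"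
        by (subst dmetric_expansion[OF c xC]) (simp add: sum_distrib_left)
      finally have "\<bar>dmetric c x a v' w'\<bar> =
        \<bar>\<Sum>i\<in>Basis. \<Sum>j\<in>Basis. \<Sum>k\<in>Basis. (a \<bullet> i) * ((v' \<bullet> j) * ((w' \<bullet> k) * dmetric c x i j k))\<bar>"
        by (rule arg_cong)
      also have "\<dots> \<le> (\<Sum>i\<in>Basis. \<Sum>j\<in>Basis. \<Sum>k\<in>Basis. \<bar>(a \<bullet> i) * ((v' \<bullet> j) * ((w' \<bullet> k) * dmetric c x i j k))\<bar>)"
        by (intro order_trans[OF sum_abs] sum_mono order_refl)
      also have "\<dots> \<le> (\<Sum>i\<in>Basis. \<Sum>j\<in>Basis. \<Sum>k\<in>Basis. norm a * (norm v' * (norm w' * \<bar>dmetric c x i j k\<bar>)))"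
        unfolding abs_mult by (intro sum_mono mult_mono Basis_le_norm) auto
      also have "\<dots> = norm a * norm v' * norm w' * S x"
        unfolding S_def by (simp add: sum_distrib_left mult.assoc)
      finally show ?thesis .
    qed
    have comp: "\<bar>F x ?z \<bullet> b\<bar> \<le> 3 / 2 * (S x0 + 1) * (norm v)\<^sup>2" if b: "b \<in> Basis" for b
    proof -
      have "2 * (F x ?z \<bullet> b) = dmetric c x v v b + dmetric c x v v b - dmetric c x b v v"
        using christoffel_koszul[OF c xC christoffel_levi_civita[OF c xC], of v v b] Fb[OF b] by simp
      then have "2 * \<bar>F x ?z \<bullet> b\<bar> \<le> \<bar>dmetric c x v v b\<bar> + \<bar>dmetric c x v v b\<bar> + \<bar>dmetric c x b v v\<bar>" by linarith
      also have "\<dots> \<le> 3 * (norm v * norm v * S x)"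
        using dm[of v v b] dm[of b v v] b by (simp add: mult.commute mult.left_commute)
      also have "\<dots> \<le> 3 * (norm v * norm v * (S x0 + 1))"
        using ex(2) by (intro mult_left_mono) auto
      finally show ?thesis by (simp add: power2_eq_square algebra_simps)
    qed
    have "m / 2 * norm ?z \<le> norm (F x ?z)" by (rule low)
    also have "\<dots> \<le> (\<Sum>b\<in>Basis. \<bar>F x ?z \<bullet> b\<bar>)" by (rule norm_le_l1)
    also have "\<dots> \<le> real (DIM('e)) * (3 / 2 * (S x0 + 1) * (norm v)\<^sup>2)"
      using comp by (intro sum_bounded_above) auto
    finally show ?thesis using m(1) by (simp add: field_simps)
  qed
  moreover have "?e > 0" "ball x0 ?e \<subseteq> ?C" using e e3 by auto
  ultimately show ?thesis by blast
qed

text \<open>\<open>cov_deriv\<close> works in the preferred chart at each \<open>\<gamma> s\<close>,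
  whereas a differential equation on an interval requires one chart \<open>c\<close>. The second
  derivative of the transition map produced by the chain rule cancels against the inhomogeneous term
  in \<open>christoffel_transformation\<close>.\<close>

lemma geodesic_chart_equation:
  assumes \<gamma>: "smooth_to A I \<gamma>" and geo: "\<And>s. s \<in> I \<Longrightarrow> cov_deriv A g \<gamma> (velocity A \<gamma>) s = 0"
    and c: "c \<in> A" and s: "s \<in> I" "\<gamma> s \<in> fst c"
  defines "w \<equiv> \<lambda>s. snd c (\<gamma> s)"
  defines "w1 \<equiv> \<lambda>s. frechet_derivative w (at s) 1"
  shows "(w1 has_vector_derivative - levi_civita A g c (w s) (w1 s) (w1 s)) (at s)"
proof -
  let ?p = "\<gamma> s"
  let ?d = "chart_at A ?p"
  have pc: "?p \<in> carrier_of A" by (rule smooth_to_carrier[OF \<gamma> s(1)])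
  note d = chart_at[OF pc]
  define T where "T = I \<inter> \<gamma> -` fst ?d"
  have T: "open T" unfolding T_def by (rule smooth_to_open_preimage[OF \<gamma> openin_chart_domain[OF atlas d(1)]])
  have sT: "s \<in> T" using s d by (simp add: T_def)
  define z where "z r = snd ?d (\<gamma> r)" for r
  have z: "smooth_on T z" using smooth_to_chart[OF \<gamma> d(1)] by (simp add: T_def z_def[abs_def] o_def)
  define z1 where "z1 r = frechet_derivative z (at r) 1" for r
  have z1: "smooth_on T z1" unfolding z1_def by (rule smooth_on_derivative[OF z])
  have z1v: "dchart A ?d (\<gamma> r) (velocity A \<gamma> r) = z1 r" if "r \<in> T" for r
    unfolding velocity_def z1_def z_def
    by (rule dchart_tangent_map[OF atlas \<gamma> _ d(1)]) (use that in \<open>auto simp: T_def\<close>)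
  have v: "velocity A \<gamma> s = z1 s" using z1v[OF sT] dchart_chart_at[OF atlas pc] by simp
  let ?Dz1 = "frechet_derivative z1 (at s)"
  have Dz1: "(z1 has_derivative ?Dz1) (at s)" by (rule smooth_on_has_derivative[OF z1 sT])
  have "((\<lambda>r. dchart A ?d (\<gamma> r) (velocity A \<gamma> r)) has_derivative ?Dz1) (at s)"
    by (rule has_derivative_transform_within_open[OF Dz1 T sT]) (simp add: z1v)
  then have "vector_derivative (\<lambda>r. dchart A ?d (\<gamma> r) (velocity A \<gamma> r)) (at s) = ?Dz1 1"
    by (intro vector_derivative_at) (simp add: has_vector_derivative_def linear_cmul[OF has_derivative_linear[OF Dz1], symmetric])
  then have z2: "?Dz1 1 = - levi_civita A g ?d (z s) (z1 s) (z1 s)"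
    using geo[OF s(1)] unfolding cov_deriv_def Let_def v z_def by (simp add: eq_neg_iff_add_eq_0)
  define \<phi> where "\<phi> x = snd c (chart_inv ?d x)" for x
  let ?U = "snd ?d ` (fst ?d \<inter> fst c)"
  have U: "open ?U" by (rule smooth_atlasD(3)[OF atlas d(1) c])
  have sm: "smooth_on ?U \<phi>" using smooth_atlasD(4)[OF atlas d(1) c] by (simp add: \<phi>_def[abs_def] o_def)
  have zU: "z s \<in> ?U" using d s by (auto simp: z_def)
  define T' where "T' = T \<inter> (I \<inter> \<gamma> -` fst c)"
  have T': "open T'" "s \<in> T'"
    using T sT s smooth_to_open_preimage[OF \<gamma> openin_chart_domain[OF atlas c]] by (auto simp: T'_def)
  have w1: "w1 r = frechet_derivative \<phi> (at (z r)) (z1 r)" if r: "r \<in> T'" for r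
  proof -
    have rz: "r \<in> T" "\<gamma> r \<in> fst ?d" "\<gamma> r \<in> fst c" using r by (auto simp: T'_def T_def)
    have "(z has_derivative frechet_derivative z (at r)) (at r)"
      by (rule smooth_on_has_derivative[OF z rz(1)])
    from transition_change[OF atlas d(1) c rz(2,3) this[unfolded z_def] refl T rz(1)]
    have "(w has_derivative (\<lambda>h. frechet_derivative \<phi> (at (z r)) (frechet_derivative z (at r) h))) (at r)"
      by (simp add: w_def \<phi>_def[abs_def] z_def[abs_def] T_def image_subset_iff)
    from frechet_derivative_eq[OF this] show ?thesis by (simp add: w1_def z1_def)
  qed
  let ?J = "frechet_derivative \<phi> (at (z s))"
  have "((\<lambda>r. frechet_derivative \<phi> (at (z r)) (z1 r)) has_derivative
    (\<lambda>k. frechet_derivative (\<lambda>y. frechet_derivative \<phi> (at y) (z1 s)) (at (z s)) (frechet_derivative z (at s) k)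
       + ?J (?Dz1 k))) (at s)"
    by (rule derivative_along_has_derivative[OF sm U zU smooth_on_has_derivative[OF z sT] Dz1])
  then have D: "(w1 has_derivative
    (\<lambda>k. frechet_derivative (\<lambda>y. frechet_derivative \<phi> (at y) (z1 s)) (at (z s)) (frechet_derivative z (at s) k)
       + ?J (?Dz1 k))) (at s)"
    by (rule has_derivative_transform_within_open[OF _ T']) (simp add: w1)
  have J: "linear ?J" by (rule linear_frechet_derivative[OF smooth_on_differentiable[OF sm zU]])
  have "?J (levi_civita A g ?d (z s) (z1 s) (z1 s)) = levi_civita A g c (w s) (w1 s) (w1 s)
    + frechet_derivative (\<lambda>y. frechet_derivative \<phi> (at y) (z1 s)) (at (z s)) (z1 s)"
    using christoffel_transformation[OF d c s(2), of "z1 s" "z1 s"]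
    unfolding w1[OF T'(2)] by (simp add: \<phi>_def[abs_def] z_def w_def)
  then have "frechet_derivative (\<lambda>y. frechet_derivative \<phi> (at y) (z1 s)) (at (z s)) (z1 s) + ?J (?Dz1 1)
    = - levi_civita A g c (w s) (w1 s) (w1 s)"
    unfolding z2 linear_neg[OF J] by simp
  with D show ?thesis
    using linear_cmul[OF has_derivative_linear[OF D], of _ 1]
    by (simp add: has_vector_derivative_def z1_def[symmetric] has_derivative_eq_rhs)
qed

text \<open>The geodesic equation is quadratic in the velocity \<open>w1\<close>. As long as
  \<open>norm (w1 r) \<le> 1\<close>, the quadratic bound implies one of linear growth, so a
  velocity that is zero at \<open>s\<close> stays zero nearby; then the coordinates are constant as
  well.\<close>

lemma stationary_geodesic_locally_constant:
  assumes \<gamma>: "smooth_to A I \<gamma>" and geo: "\<And>s. s \<in> I \<Longrightarrow> cov_deriv A g \<gamma> (velocity A \<gamma>) s = 0"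
    and s: "s \<in> I" and v: "velocity A \<gamma> s = 0"
  shows "\<exists>e>0. \<forall>r\<in>ball s e. r \<in> I \<and> velocity A \<gamma> r = 0 \<and> \<gamma> r = \<gamma> s"
proof -
  obtain c where c: "c \<in> A" "\<gamma> s \<in> fst c"
    using smooth_to_carrier[OF \<gamma> s] by (auto simp: carrier_of_def)
  define T where "T = I \<inter> \<gamma> -` fst c"
  have T: "open T" unfolding T_def by (rule smooth_to_open_preimage[OF \<gamma> openin_chart_domain[OF atlas c(1)]])
  have sT: "s \<in> T" using s c by (simp add: T_def)
  define w where "w r = snd c (\<gamma> r)" for r
  define w1 where "w1 r = frechet_derivative w (at r) 1" for r
  have w: "smooth_on T w" using smooth_to_chart[OF \<gamma> c(1)] by (simp add: T_def w_def[abs_def] o_def)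
  have w1: "dchart A c (\<gamma> r) (velocity A \<gamma> r) = w1 r" if "r \<in> T" for r
    unfolding velocity_def w1_def w_def
    by (rule dchart_tangent_map[OF atlas \<gamma> _ c(1)]) (use that in \<open>auto simp: T_def\<close>)
  have w2: "(w1 has_vector_derivative - levi_civita A g c (w r) (w1 r) (w1 r)) (at r)" if "r \<in> T" for r
    using geodesic_chart_equation[OF \<gamma> geo c(1), of r] that
    unfolding w1_def[abs_def] w_def[abs_def] T_def by simp
  have w10: "w1 s = 0" using w1[OF sT] v linear_0[OF dchart_linear[OF atlas c]] by simp
  have ws: "w s \<in> snd c ` fst c" using c by (simp add: w_def)
  obtain e1 C where e1: "e1 > 0" "\<And>x v. x \<in> ball (w s) e1 \<Longrightarrow> norm (levi_civita A g c x v v) \<le> C * (norm v)\<^sup>2"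
    using christoffel_locally_bounded[OF c(1) ws] by blast
  have cont: "isCont w s" "isCont w1 s"
    using smooth_on_continuous_on[OF w] smooth_on_continuous_on[OF smooth_on_derivative[OF w, of 1]] T sT
    by (simp_all add: continuous_on_eq_continuous_at w1_def[abs_def])
  obtain d1 where d1: "d1 > 0" "\<And>r. dist r s < d1 \<Longrightarrow> dist (w r) (w s) < e1"
    using cont(1) e1(1) unfolding continuous_at_eps_delta by metis
  obtain d2 where d2: "d2 > 0" "\<And>r. dist r s < d2 \<Longrightarrow> dist (w1 r) (w1 s) < 1"
    using cont(2) zero_less_one unfolding continuous_at_eps_delta by metis
  obtain d3 where d3: "d3 > 0" "ball s d3 \<subseteq> T" using T sT open_contains_ball by blast
  define e where "e = min d1 (min d2 d3)"
  have e: "e > 0" and eT: "ball s e \<subseteq> T" using d1 d2 d3 by (auto simp: e_def)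
  have w1_0: "w1 r = 0" if r: "r \<in> ball s e" for r
  proof (rule linear_growth_vanishes[where v = w1 and a = s, OF _ _ w10 r])
    fix r assume r: "r \<in> ball s e"
    show "(w1 has_vector_derivative - levi_civita A g c (w r) (w1 r) (w1 r)) (at r)"
      using w2 r eT by blast
    have "norm (w1 r) \<le> 1" using d2(2)[of r] r w10 by (simp add: e_def dist_commute)
    have "w r \<in> ball (w s) e1" using d1(2)[of r] r by (simp add: e_def dist_commute)
    from e1(2)[OF this, of "w1 r"]
    have "norm (levi_civita A g c (w r) (w1 r) (w1 r)) \<le> \<bar>C\<bar> * (norm (w1 r))\<^sup>2"
      using mult_right_mono[OF abs_ge_self[of C], of "(norm (w1 r))\<^sup>2"] by simp
    also have "\<dots> \<le> \<bar>C\<bar> * norm (w1 r)"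
      using \<open>norm (w1 r) \<le> 1\<close> by (intro mult_left_mono) (simp_all add: power2_eq_square mult_left_le)
    finally show "norm (- levi_civita A g c (w r) (w1 r) (w1 r)) \<le> \<bar>C\<bar> * norm (w1 r)" by simp
  qed
  have wc: "w r = w s" if r: "r \<in> ball s e" for r
  proof -
    have "\<exists>k. \<forall>x\<in>ball s e. w x = k"
    proof (rule has_derivative_zero_constant)
      fix x assume x: "x \<in> ball s e"
      then have D: "(w has_derivative frechet_derivative w (at x)) (at x)"
        using eT by (intro smooth_on_has_derivative[OF w]) auto
      have "frechet_derivative w (at x) h = 0" for h
        using linear_cmul[OF has_derivative_linear[OF D], of h 1] w1_0[OF x] by (simp add: w1_def)
      then have "frechet_derivative w (at x) = (\<lambda>h. 0)" by (rule ext)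
      with D show "(w has_derivative (\<lambda>h. 0)) (at x within ball s e)"
        by (simp add: has_derivative_at_withinI)
    qed simp
    then show ?thesis using r e by fastforce
  qed
  have "r \<in> I \<and> velocity A \<gamma> r = 0 \<and> \<gamma> r = \<gamma> s" if r: "r \<in> ball s e" for r
  proof -
    have rT: "r \<in> T" using r eT by blast
    then have rI: "r \<in> I" "\<gamma> r \<in> fst c" by (auto simp: T_def)
    have "dchart A c (\<gamma> r) (velocity A \<gamma> r) = dchart A c (\<gamma> r) 0"
      using w1[OF rT] w1_0[OF r] linear_0[OF dchart_linear[OF atlas c(1) rI(2)]] by simp
    then have "velocity A \<gamma> r = 0" by (rule injD[OF bij_is_inj[OF dchart_bij[OF atlas c(1) rI(2)]]])
    moreover have "\<gamma> r = \<gamma> s"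
      by (rule inj_onD[OF smooth_atlasD(1)[OF atlas c(1)] wc[OF r, unfolded w_def] rI(2) c(2)])
    ultimately show ?thesis using rI by simp
  qed
  then show ?thesis using e by blast
qed

lemma connected_locally_constant_predicate:
  fixes I :: "real set"
  assumes I: "connected I" "open I" "a \<in> I" "P a" "b \<in> I"
    and op: "\<And>s. s \<in> I \<Longrightarrow> \<exists>e>0. \<forall>r\<in>ball s e. P r \<longleftrightarrow> P s"
  shows "P b"
proof -
  have *: "open {s\<in>I. Q s}" if "\<And>s. s \<in> I \<Longrightarrow> Q s \<Longrightarrow> \<exists>e>0. \<forall>r\<in>ball s e. Q r" for Q
  proof (subst open_contains_ball, intro ballI)
    fix s assume s: "s \<in> {s\<in>I. Q s}"
    then have "s \<in> I" "Q s" by auto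
    from that[OF this] obtain e1 where "e1 > 0" "\<forall>r\<in>ball s e1. Q r" by (elim exE conjE)
    moreover obtain e2 where "e2 > 0" "ball s e2 \<subseteq> I" using I(2) s open_contains_ball by blast
    ultimately show "\<exists>e>0. ball s e \<subseteq> {s\<in>I. Q s}" by (intro exI[of _ "min e1 e2"]) auto
  qed
  have "open {s\<in>I. P s}"
  proof (rule *)
    fix s assume "s \<in> I" "P s"
    with op[OF this(1)] show "\<exists>e>0. \<forall>r\<in>ball s e. P r" by simp
  qed
  moreover have "open {s\<in>I. \<not> P s}"
  proof (rule *)
    fix s assume "s \<in> I" "\<not> P s"
    with op[OF this(1)] show "\<exists>e>0. \<forall>r\<in>ball s e. \<not> P r" by simp
  qed
  ultimately show ?thesis
    using connectedD[OF I(1), of "{s\<in>I. P s}" "{s\<in>I. \<not> P s}"] I(3-5) by blast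
qed

text \<open>Connectedness of the interval is used twice: for vanishing of the velocity, an open
  condition by the local result whose failure is open by continuity, and then for the
  position.\<close>

lemma zero_geodesic_constant:
  assumes "geodesic_arc A g p 0 \<gamma>"
  shows "\<gamma> 1 = p"
proof -
  obtain \<epsilon> where e: "\<epsilon> > 0" and \<gamma>0: "\<gamma> 0 = p" "velocity A \<gamma> 0 = 0"
    and \<gamma>: "smooth_to A {-\<epsilon><..<1+\<epsilon>} \<gamma>"
    and geo: "\<And>s. s \<in> {-\<epsilon><..<1+\<epsilon>} \<Longrightarrow> cov_deriv A g \<gamma> (velocity A \<gamma>) s = 0"
    using assms unfolding geodesic_arc_def by blast
  let ?I = "{-\<epsilon><..<1+\<epsilon>}"
  have loc: "\<exists>e>0. \<forall>r\<in>ball s e. r \<in> ?I \<and> velocity A \<gamma> r = 0 \<and> \<gamma> r = \<gamma> s"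
    if "s \<in> ?I" "velocity A \<gamma> s = 0" for s
    by (rule stationary_geodesic_locally_constant[OF \<gamma> geo that])
  have vel: "velocity A \<gamma> b = 0" if "b \<in> ?I" for b
  proof (rule connected_locally_constant_predicate[where I="?I" and a=0 and P="\<lambda>s. velocity A \<gamma> s = 0"])
    fix s assume s: "s \<in> ?I"
    show "\<exists>e>0. \<forall>r\<in>ball s e. (velocity A \<gamma> r = 0) = (velocity A \<gamma> s = 0)"
    proof (cases "velocity A \<gamma> s = 0")
      case True
      then show ?thesis using loc[OF s] by auto
    next
      case False
      obtain c where c: "c \<in> A" "\<gamma> s \<in> fst c"
        using smooth_to_carrier[OF \<gamma> s] by (auto simp: carrier_of_def)
      define T where "T = ?I \<inter> \<gamma> -` fst c"
      have T: "open T" unfolding T_def by (rule smooth_to_open_preimage[OF \<gamma> openin_chart_domain[OF atlas c(1)]])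
      have sT: "s \<in> T" using s c by (simp add: T_def)
      \<comment> \<open>The velocity as a function into the model space may jump together with the
        preferred chart. Its components in the fixed chart are continuous and vanish at the same
        times.\<close>
      define w1 where "w1 r = frechet_derivative (\<lambda>r. snd c (\<gamma> r)) (at r) 1" for r
      have w1: "dchart A c (\<gamma> r) (velocity A \<gamma> r) = w1 r" if "r \<in> T" for r
        unfolding velocity_def w1_def
        by (rule dchart_tangent_map[OF atlas \<gamma> _ c(1)]) (use that in \<open>auto simp: T_def\<close>)
      have "smooth_on T (\<lambda>r. snd c (\<gamma> r))" using smooth_to_chart[OF \<gamma> c(1)] by (simp add: T_def o_def)
      then have "continuous_on T w1"
        unfolding w1_def[abs_def] by (intro smooth_on_continuous_on smooth_on_derivative)
      then have O: "open (T \<inter> w1 -` (- {0}))" by (intro continuous_open_preimage T) auto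
      have lin0: "dchart A c (\<gamma> r) 0 = 0" if "r \<in> T" for r
        using linear_0[OF dchart_linear[OF atlas c(1)]] that by (auto simp: T_def)
      have "w1 s \<noteq> 0"
      proof
        assume "w1 s = 0"
        then have "dchart A c (\<gamma> s) (velocity A \<gamma> s) = dchart A c (\<gamma> s) 0" using w1[OF sT] lin0[OF sT] by simp
        then have "velocity A \<gamma> s = 0" by (rule injD[OF bij_is_inj[OF dchart_bij[OF atlas c]]])
        with False show False by simp
      qed
      then have "s \<in> T \<inter> w1 -` (- {0})" using sT by simp
      then obtain e where e: "e > 0" "ball s e \<subseteq> T \<inter> w1 -` (- {0})" using O open_contains_ball by blast
      have "velocity A \<gamma> r \<noteq> 0" if "r \<in> ball s e" for r
      proof -
        have "r \<in> T" "w1 r \<noteq> 0" using e(2) that by auto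
        then show ?thesis using w1[of r] lin0[of r] by auto
      qed
      then show ?thesis using e(1) False by auto
    qed
  qed (use e \<gamma>0 that in auto)
  show ?thesis
  proof (rule connected_locally_constant_predicate[where I="?I" and a=0 and P="\<lambda>s. \<gamma> s = p"])
    fix s assume s: "s \<in> ?I"
    obtain d where d: "d > 0" "\<And>r. r \<in> ball s d \<Longrightarrow> \<gamma> r = \<gamma> s" using loc[OF s vel[OF s]] by blast
    show "\<exists>e>0. \<forall>r\<in>ball s e. (\<gamma> r = p) = (\<gamma> s = p)"
    proof (intro exI[of _ d] conjI ballI d(1))
      show "(\<gamma> r = p) = (\<gamma> s = p)" if "r \<in> ball s d" for r by (simp only: d(2)[OF that])
    qed
  qed (use e \<gamma>0 in auto)
qed

lemma exp_map_zero:
  assumes "(p, 0) \<in> exp_domain A g"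
  shows "exp_map A g (p, 0) = p"
proof -
  obtain \<gamma> where "geodesic_arc A g p 0 \<gamma>" using assms by (auto simp: exp_domain_def)
  then have "(THE q. \<exists>\<gamma>. geodesic_arc A g p 0 \<gamma> \<and> \<gamma> 1 = q) = p"
    using zero_geodesic_constant by (intro the_equality) blast+
  then show ?thesis by (simp add: exp_map_def)
qed

end

section \<open>The flow along the null normal field\<close>

lemma has_derivative_imp_has_vector_derivative:
  assumes "(f has_derivative D) (at (t :: real))"
  shows "(f has_vector_derivative D 1) (at t)"
proof -
  have "D h = h *\<^sub>R D 1" for h
    using linear_cmul[OF has_derivative_linear[OF assms], of h 1] by simp
  then have "D = (\<lambda>h. h *\<^sub>R D 1)" by (rule ext)
  with assms show ?thesis unfolding has_vector_derivative_def by metis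
qed

lemma smooth_to_const:
  assumes A: "smooth_atlas A" and p: "p \<in> carrier_of A" and W: "open W"
  shows "smooth_to A W (\<lambda>x. p)"
proof (rule smooth_toI[OF A W p])
  fix d assume "d \<in> A"
  show "open (W \<inter> (\<lambda>x. p) -` fst d)" using W by (cases "p \<in> fst d") auto
qed simp

lemma smooth_map_chart_domain_open:
  assumes A: "smooth_atlas A" and B: "smooth_atlas B" and f: "smooth_map A B U f" and c: "c \<in> A" and d: "d \<in> B"
  shows "open (snd c ` (U \<inter> fst c \<inter> f -` fst d))"
proof -
  have U: "openin (atlas_topology A) U"
    and cont: "continuous_map (subtopology (atlas_topology A) U) (atlas_topology B) f"
    using f by (auto simp: smooth_map_def)
  have "openin (subtopology (atlas_topology A) U) {x \<in> topspace (subtopology (atlas_topology A) U). f x \<in> fst d}"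
    by (rule openin_continuous_map_preimage[OF cont openin_chart_domain[OF B d]])
  moreover have "{x \<in> topspace (subtopology (atlas_topology A) U). f x \<in> fst d} = U \<inter> f -` fst d"
    using openin_subset[OF U] by auto
  ultimately have "openin (atlas_topology A) (U \<inter> f -` fst d)" using U by (simp add: openin_open_subtopology)
  then have "open (snd c ` ((U \<inter> f -` fst d) \<inter> fst c))" using c by (simp add: openin_atlas_topology_iff[OF A])
  moreover have "(U \<inter> f -` fst d) \<inter> fst c = U \<inter> fst c \<inter> f -` fst d" by auto
  ultimately show ?thesis by simp
qed

lemma smooth_map_in_charts:
  assumes "smooth_map A B U f" "c \<in> A" "d \<in> B"
  shows "smooth_on (snd c ` (U \<inter> fst c \<inter> f -` fst d)) (\<lambda>x. snd d (f (chart_inv c x)))"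
  using assms by (auto simp: smooth_map_def o_def)

locale null_flow = lorentz_manifold A g
  for A :: "('a, 'e::euclidean_space) atlas" and g +
  fixes S :: "'a set" and \<xi> :: "'a \<Rightarrow> 'e" and V :: "('a \<times> 'e) set"
  assumes S_carrier: "S \<subseteq> carrier_of A"
    and xi: "lightlike_normal_field A g S \<xi>"
    and V: "normal_exp_neighborhood A g S V"
begin

abbreviation \<Phi> :: "'a \<Rightarrow> real \<Rightarrow> 'a" where
  "\<Phi> p t \<equiv> normal_flow A g \<xi> (p, t)"

abbreviation dom :: "('a \<times> real) set" where
  "dom \<equiv> flow_domain S \<xi> V"

abbreviation \<Sigma> :: "'a set" where
  "\<Sigma> \<equiv> emanating_hypersurface A g S \<xi> V"

abbreviation U :: "'a \<Rightarrow> 'e" where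
  "U \<equiv> geodesic_extension A g S \<xi> V"

lemma dom_iff: "(p, t) \<in> dom \<longleftrightarrow> p \<in> S \<and> (p, t *\<^sub>R \<xi> p) \<in> V"
  by (simp add: flow_domain_def)

lemma flow_exp: "\<Phi> p t = exp_map A g (p, t *\<^sub>R \<xi> p)"
  by (simp add: normal_flow_def)

lemma xi_nonzero: "p \<in> S \<Longrightarrow> \<xi> p \<noteq> 0"
  using xi by (simp add: lightlike_normal_field_def)

lemma xi_smooth: "smooth_map_on A (tangent_atlas A) S (\<lambda>p. (p, \<xi> p))"
  using xi by (simp add: lightlike_normal_field_def)

lemma xi_normal: "p \<in> S \<Longrightarrow> (p, t *\<^sub>R \<xi> p) \<in> normal_bundle A g S"
proof -
  assume p: "p \<in> S"
  then have "(p, \<xi> p) \<in> normal_bundle A g S" using xi by (simp add: lightlike_normal_field_def)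
  moreover have "bilinear (g p)" using metric_bilinear S_carrier p by blast
  ultimately show ?thesis by (simp add: normal_bundle_def bilinear_lmul)
qed

lemma V_open:
  obtains Q where "openin (atlas_topology (tangent_atlas A)) Q" "V = Q \<inter> normal_bundle A g S"
  using V by (auto simp: normal_exp_neighborhood_def openin_subtopology)

lemma V_diffeomorphism:
  obtains N where "openin (atlas_topology A) N" "S \<subseteq> N" "bij_betw (exp_map A g) V N"
    "smooth_map_on (tangent_atlas A) A V (exp_map A g)"
    "smooth_map_on A (tangent_atlas A) N (inv_into V (exp_map A g))"
  using V by (auto simp: normal_exp_neighborhood_def diffeomorphism_def)

lemma exp_inj: "inj_on (exp_map A g) V"
  using V_diffeomorphism by (metis bij_betw_def)

lemma exp_smooth: "smooth_map_on (tangent_atlas A) A V (exp_map A g)"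
  using V_diffeomorphism by metis

text \<open>Injectivity of the exponential map on \<open>V\<close> recovers the base point and the
  vector, and \<open>\<xi> p \<noteq> 0\<close> recovers the time from the vector.\<close>

lemma flow_inj: "inj_on (\<lambda>(p, t). \<Phi> p t) dom"
proof (rule inj_onI, clarsimp simp: dom_iff flow_exp)
  fix p s q t assume *: "p \<in> S" "(p, s *\<^sub>R \<xi> p) \<in> V" "q \<in> S" "(q, t *\<^sub>R \<xi> q) \<in> V"
    "exp_map A g (p, s *\<^sub>R \<xi> p) = exp_map A g (q, t *\<^sub>R \<xi> q)"
  then have "(p, s *\<^sub>R \<xi> p) = (q, t *\<^sub>R \<xi> q)" using inj_onD[OF exp_inj] by blast
  then show "p = q \<and> s = t" using xi_nonzero[OF *(1)] by auto
qed

lemma flow_coords_flow: "(p, t) \<in> dom \<Longrightarrow> flow_coords A g S \<xi> V (\<Phi> p t) = (p, t)"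
  unfolding flow_coords_def
  using inv_into_f_f[OF flow_inj[unfolded case_prod_eta], of "(p, t)"] by simp

lemma U_flow: "(p, t) \<in> dom \<Longrightarrow> U (\<Phi> p t) = velocity A (\<Phi> p) t"
  by (simp add: geodesic_extension_def flow_coords_flow)

lemma flow_in_hypersurface: "(p, t) \<in> dom \<Longrightarrow> \<Phi> p t \<in> \<Sigma>"
  by (auto simp: emanating_hypersurface_def)

lemma hypersurface_cases:
  assumes "q \<in> \<Sigma>" obtains p t where "(p, t) \<in> dom" "q = \<Phi> p t"
  using assms by (auto simp: emanating_hypersurface_def)

lemma dom_zero: "p \<in> S \<Longrightarrow> (p, 0) \<in> dom"
  using V by (simp add: dom_iff normal_exp_neighborhood_def)

lemma dom_star:
  assumes "(p, t) \<in> dom" "r \<in> {0..1}" shows "(p, r * t) \<in> dom"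
proof -
  have "(p, r *\<^sub>R (t *\<^sub>R \<xi> p)) \<in> V"
    using assms V unfolding normal_exp_neighborhood_def dom_iff by blast
  then show ?thesis using assms by (simp add: dom_iff)
qed

lemma flow_zero: "p \<in> S \<Longrightarrow> \<Phi> p 0 = p"
  using dom_zero[of p] V exp_map_zero[of p]
  by (auto simp: flow_exp dom_iff normal_exp_neighborhood_def)

lemma flow_lift_smooth:
  assumes f: "smooth_to A W f" and fS: "f ` W \<subseteq> S"
  shows "smooth_to (tangent_atlas A) (W \<times> UNIV) (\<lambda>z. (f (fst z), snd z *\<^sub>R \<xi> (f (fst z))))"
  by (rule smooth_to_tangent_scale[OF atlas])
    (rule smooth_to_compose_map_on[OF smooth_atlas_tangent[OF atlas] atlas xi_smooth f fS])

text \<open>\<open>V\<close> is open only relative to the normal bundle. Since multiples of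
  \<open>\<xi>\<close> are always normal, membership in \<open>V\<close> is decided by an ambient
  open set \<open>Q\<close>.\<close>

lemma flow_domain_open:
  assumes f: "smooth_to A W f" and fS: "f ` W \<subseteq> S"
  shows "open {z \<in> W \<times> UNIV. (f (fst z), snd z) \<in> dom}"
proof -
  obtain Q where Q: "openin (atlas_topology (tangent_atlas A)) Q" "V = Q \<inter> normal_bundle A g S"
    by (rule V_open)
  have VQ: "z \<in> V \<longleftrightarrow> z \<in> Q \<and> z \<in> normal_bundle A g S" for z using Q(2) by blast
  have "{z \<in> W \<times> UNIV. (f (fst z), snd z) \<in> dom}
    = (W \<times> UNIV) \<inter> (\<lambda>z. (f (fst z), snd z *\<^sub>R \<xi> (f (fst z)))) -` Q"
    using fS xi_normal VQ by (auto simp: dom_iff)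
  then show ?thesis using smooth_to_open_preimage[OF flow_lift_smooth[OF f fS] Q(1)] by simp
qed

lemma flow_smooth:
  assumes f: "smooth_to A W f" and fS: "f ` W \<subseteq> S"
  shows "smooth_to A {z \<in> W \<times> UNIV. (f (fst z), snd z) \<in> dom} (\<lambda>z. \<Phi> (f (fst z)) (snd z))"
proof -
  let ?D = "{z \<in> W \<times> UNIV. (f (fst z), snd z) \<in> dom}"
  have "smooth_to A ?D (\<lambda>z. exp_map A g (f (fst z), snd z *\<^sub>R \<xi> (f (fst z))))"
    by (rule smooth_to_compose_map_on[OF atlas smooth_atlas_tangent[OF atlas] exp_smooth
        smooth_to_subset[OF smooth_atlas_tangent[OF atlas] flow_lift_smooth[OF f fS] flow_domain_open[OF f fS]]])
      (auto simp: dom_iff)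
  then show ?thesis by (simp add: flow_exp)
qed

lemma flow_slice_smooth:
  assumes f: "smooth_to A W f" and fS: "f ` W \<subseteq> S" and dom: "\<And>x. x \<in> W \<Longrightarrow> (f x, t) \<in> dom"
  shows "smooth_to A W (\<lambda>x. \<Phi> (f x) t)"
proof -
  have W: "open W" by (rule smooth_to_open[OF f])
  have "smooth_on W (\<lambda>x. (x, t))" by (rule smooth_on_Pair[OF W]) simp_all
  moreover have "(\<lambda>x. (x, t)) ` W \<subseteq> {z \<in> W \<times> UNIV. (f (fst z), snd z) \<in> dom}" using dom by auto
  ultimately show ?thesis using smooth_to_reparam[OF atlas flow_smooth[OF f fS] W, of "\<lambda>x. (x, t)"] by simp
qed

lemma flow_line_smooth:
  assumes p: "p \<in> S"
  shows "smooth_to A {t. (p, t) \<in> dom} (\<Phi> p)" "open {t. (p, t) \<in> dom}"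
proof -
  \<comment> \<open>A single point is treated as a constant family with a dummy real parameter, so
    that the results for families apply to one flow line.\<close>
  have c: "smooth_to A (UNIV :: real set) (\<lambda>x. p)"
    by (rule smooth_to_const[OF atlas]) (use p S_carrier in auto)
  have s: "smooth_on (UNIV :: real set) (\<lambda>t. (0 :: real, t))" by (rule smooth_on_Pair) simp_all
  have "open ((\<lambda>t. (0 :: real, t)) -` {z \<in> UNIV \<times> UNIV. ((\<lambda>x. p) (fst z), snd z) \<in> dom})"
    by (intro continuous_open_vimage flow_domain_open[OF c] continuous_intros) (use p in auto)
  then show O: "open {t. (p, t) \<in> dom}" by (simp add: vimage_def)
  show "smooth_to A {t. (p, t) \<in> dom} (\<Phi> p)"
  proof -
    have "(\<lambda>t. (0 :: real, t)) ` {t. (p, t) \<in> dom} \<subseteq> {z \<in> UNIV \<times> UNIV. (p, snd z) \<in> dom}" by auto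
    from smooth_to_reparam[OF atlas flow_smooth[OF c] O smooth_on_subset[OF s subset_UNIV] this] p
    show ?thesis by simp
  qed
qed

lemma U_chart:
  assumes dom: "(p, t) \<in> dom" and c: "c \<in> A" "\<Phi> p t \<in> fst c"
    and D: "((\<lambda>s. snd c (\<Phi> p s)) has_derivative D) (at t)"
  shows "dchart A c (\<Phi> p t) (U (\<Phi> p t)) = D 1"
proof -
  have p: "p \<in> S" using dom by (simp add: dom_iff)
  show ?thesis
    unfolding U_flow[OF dom] velocity_def
    using dchart_tangent_map[OF atlas flow_line_smooth(1)[OF p] _ c, of 1] dom frechet_derivative_eq[OF D] by simp
qed

text \<open>
  In charts, \<open>U\<close> is \<open>D exp (p, t \<xi>) (0, \<xi>)\<close> evaluated at \<open>(p, t \<xi>) = exp\<^sup>-\<^sup>1 q\<close>; replacing the three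
  maps \<open>exp\<close>, \<open>exp\<^sup>-\<^sup>1\<close> and \<open>\<xi>\<close> by local smooth extensions extends \<open>U\<close> off the hypersurface.
\<close>

lemma U_local_extension:
  assumes dom0: "(p, t) \<in> dom" and c: "c \<in> A" "\<Phi> p t \<in> fst c"
  shows "\<exists>T \<mu>. open T \<and> snd c (\<Phi> p t) \<in> T \<and> \<mu> differentiable (at (snd c (\<Phi> p t))) \<and>
    (\<forall>q\<in>\<Sigma>. q \<in> fst c \<and> snd c q \<in> T \<longrightarrow> dchart A c q (U q) = \<mu> (snd c q))"
proof -
  note TA = smooth_atlas_tangent[OF atlas]
  let ?q = "\<Phi> p t" and ?E = "inv_into V (exp_map A g)"
  obtain Q where Q: "openin (atlas_topology (tangent_atlas A)) Q" "V = Q \<inter> normal_bundle A g S"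
    by (rule V_open)
  obtain N where N: "openin (atlas_topology A) N" "S \<subseteq> N" "bij_betw (exp_map A g) V N"
    "smooth_map_on (tangent_atlas A) A V (exp_map A g)" "smooth_map_on A (tangent_atlas A) N ?E"
    by (rule V_diffeomorphism)
  have p: "p \<in> S" and pV: "(p, t *\<^sub>R \<xi> p) \<in> V" using dom0 by (auto simp: dom_iff)
  have flowN: "\<Phi> p' t' \<in> N" "?E (\<Phi> p' t') = (p', t' *\<^sub>R \<xi> p')" if "(p', t') \<in> dom" for p' t'
    using that N(3) exp_inj by (auto simp: dom_iff flow_exp bij_betw_def)
  obtain UE E where E: "?q \<in> UE" "smooth_map A (tangent_atlas A) UE E" "\<And>q. q \<in> N \<inter> UE \<Longrightarrow> E q = ?E q"
    using N(5)[unfolded smooth_map_on_def, rule_format, OF flowN(1)[OF dom0]] by (elim exE conjE) auto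
  obtain UF F where F: "(p, t *\<^sub>R \<xi> p) \<in> UF" "smooth_map (tangent_atlas A) A UF F" "\<And>z. z \<in> V \<inter> UF \<Longrightarrow> F z = exp_map A g z"
    using N(4)[unfolded smooth_map_on_def, rule_format, OF pV] by (elim exE conjE) auto
  obtain UG G where G: "p \<in> UG" "smooth_map A (tangent_atlas A) UG G" "\<And>q. q \<in> S \<inter> UG \<Longrightarrow> G q = (q, \<xi> q)"
    using xi_smooth[unfolded smooth_map_on_def, rule_format, OF p] by (elim exE conjE) auto
  obtain d where d: "d \<in> A" "p \<in> fst d" using S_carrier p by (auto simp: carrier_of_def)
  let ?d = "tchart A d"
  have dT: "?d \<in> tangent_atlas A" using d by (simp add: tangent_atlas_eq)
  define DK where "DK = snd c ` (UE \<inter> fst c \<inter> E -` fst ?d)"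
  define DH where "DH = snd ?d ` (UF \<inter> fst ?d \<inter> F -` fst c)"
  define DX where "DX = snd d ` (UG \<inter> fst d \<inter> G -` fst ?d)"
  \<comment> \<open>\<open>K\<close>, \<open>H\<close> and \<open>X\<close> are the extensions of
    \<open>exp\<^sup>-\<^sup>1\<close>, \<open>exp\<close> and \<open>\<xi>\<close> written in the
    charts \<open>c\<close> and \<open>d\<close>; the first component of \<open>K\<close> is the
    base point in \<open>d\<close>.\<close>
  define K where "K x = snd ?d (E (chart_inv c x))" for x
  define H where "H y = snd c (F (chart_inv ?d y))" for y
  define X where "X x = snd (snd ?d (G (chart_inv d x)))" for x
  have oK: "open DK" and oH: "open DH" and oX: "open DX"
    unfolding DK_def DH_def DX_def
    by (rule smooth_map_chart_domain_open[OF atlas TA E(2) c(1) dT] smooth_map_chart_domain_open[OF TA atlas F(2) dT c(1)]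
        smooth_map_chart_domain_open[OF atlas TA G(2) d(1) dT])+
  have sK: "smooth_on DK K" and sH: "smooth_on DH H"
    unfolding DK_def DH_def K_def[abs_def] H_def[abs_def]
    by (rule smooth_map_in_charts[OF E(2) c(1) dT] smooth_map_in_charts[OF F(2) dT c(1)])+
  have sX: "smooth_on DX X"
    unfolding X_def[abs_def]
    by (rule smooth_on_compose_linear[OF bounded_linear_snd oX])
      (unfold DX_def, rule smooth_map_in_charts[OF G(2) d(1) dT])
  have dinj: "inj_on (snd d) (fst d)" by (rule smooth_atlasD(1)[OF atlas d(1)])
  have tinj: "inj_on (snd ?d) (fst ?d)" by (rule smooth_atlasD(1)[OF TA dT])
  define T where "T = DK \<inter> K -` (DH \<inter> fst -` DX)"
  have T: "open T"
    unfolding T_def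
    by (rule continuous_open_preimage[OF smooth_on_continuous_on[OF sK] oK])
      (intro open_Int oH continuous_open_vimage[OF oX] continuous_intros)
  have Kq: "K (snd c q) = (snd d p', t' *\<^sub>R dchart A d p' (\<xi> p'))"
    if "q = \<Phi> p' t'" "(p', t') \<in> dom" "q \<in> UE" "q \<in> fst c" "p' \<in> fst d" for q p' t'
    using that flowN[OF that(2)] E(3)[of q] chart_inv_chart[OF atlas c(1) that(4)]
      linear_cmul[OF dchart_linear[OF atlas d(1) that(5)]] by (simp add: K_def)
  have qT: "snd c ?q \<in> T"
  proof -
    have "?q \<in> UE \<inter> fst c \<inter> E -` fst ?d" using E c flowN[OF dom0] d by auto
    then have 1: "snd c ?q \<in> DK" unfolding DK_def by (rule imageI)
    have Kq': "K (snd c ?q) = snd ?d (p, t *\<^sub>R \<xi> p)"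
      using Kq[OF refl dom0 E(1) c(2) d(2)] linear_cmul[OF dchart_linear[OF atlas d]] by simp
    have "(p, t *\<^sub>R \<xi> p) \<in> UF \<inter> fst ?d \<inter> F -` fst c"
      using F d c pV by (auto simp: flow_exp)
    then have 2: "K (snd c ?q) \<in> DH" unfolding DH_def Kq' by (rule imageI)
    have "p \<in> UG \<inter> fst d \<inter> G -` fst ?d" using G d p by auto
    then have "snd d p \<in> DX" unfolding DX_def by (rule imageI)
    then show ?thesis using 1 2 Kq' by (simp add: T_def)
  qed
  define \<mu> where "\<mu> x = frechet_derivative H (at (K x)) (0, X (fst (K x)))" for x
  have diff: "\<mu> differentiable (at (snd c ?q))"
  proof -
    have x: "snd c ?q \<in> DK" "K (snd c ?q) \<in> DH" "fst (K (snd c ?q)) \<in> DX" using qT by (auto simp: T_def)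
    note dK = smooth_on_has_derivative[OF sK x(1)]
    have "((\<lambda>x. X (fst (K x))) has_derivative
       (\<lambda>h. frechet_derivative X (at (fst (K (snd c ?q)))) (fst (frechet_derivative K (at (snd c ?q)) h)))) (at (snd c ?q))"
      by (rule has_derivative_compose[OF has_derivative_fst[OF dK] smooth_on_has_derivative[OF sX x(3)]])
    from has_derivative_Pair[OF has_derivative_const this]
    have "((\<lambda>x. (0 :: 'e, X (fst (K x)))) has_derivative
       (\<lambda>h. (0, frechet_derivative X (at (fst (K (snd c ?q)))) (fst (frechet_derivative K (at (snd c ?q)) h))))) (at (snd c ?q))" .
    from derivative_along_has_derivative[OF sH oH x(2) dK this]
    show ?thesis unfolding \<mu>_def[abs_def] differentiable_def by blast
  qed
  have "dchart A c q (U q) = \<mu> (snd c q)" if q: "q \<in> \<Sigma>" "q \<in> fst c" "snd c q \<in> T" for q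
  proof -
    obtain p' t' where dom': "(p', t') \<in> dom" and q': "q = \<Phi> p' t'" using q(1) by (rule hypersurface_cases)
    have p': "p' \<in> S" "(p', t' *\<^sub>R \<xi> p') \<in> V" using dom' by (auto simp: dom_iff)
    have "snd c q \<in> DK" using q(3) by (simp add: T_def)
    then have qD: "q \<in> UE" "E q \<in> fst ?d"
      unfolding DK_def using inj_onD[OF smooth_atlasD(1)[OF atlas c(1)] _ q(2)] by auto
    have Eq: "E q = (p', t' *\<^sub>R \<xi> p')" using E(3)[of q] qD(1) flowN[OF dom'] q' by simp
    then have p'd: "p' \<in> fst d" using qD(2) by simp
    let ?w = "dchart A d p' (\<xi> p')"
    have K1: "K (snd c q) = (snd d p', t' *\<^sub>R ?w)" by (rule Kq[OF q' dom' qD(1) q(2) p'd])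
    have dl: "snd ?d (p', s *\<^sub>R \<xi> p') = (snd d p', s *\<^sub>R ?w)" for s
      using linear_cmul[OF dchart_linear[OF atlas d(1) p'd]] by simp
    have "snd d p' \<in> DX" using q(3) K1 by (simp add: T_def)
    then have "p' \<in> UG" unfolding DX_def using inj_onD[OF dinj _ p'd] by auto
    then have X1: "X (snd d p') = ?w"
      using G(3)[of p'] p' chart_inv_chart[OF atlas d(1) p'd] by (simp add: X_def)
    have "snd ?d (p', t' *\<^sub>R \<xi> p') \<in> DH" using q(3) K1 unfolding dl by (simp add: T_def)
    then obtain z where z: "z \<in> UF \<inter> fst ?d \<inter> F -` fst c" "snd ?d (p', t' *\<^sub>R \<xi> p') = snd ?d z"
      unfolding DH_def by (rule imageE)
    then have "(p', t' *\<^sub>R \<xi> p') = z" using inj_onD[OF tinj z(2)] p'd by auto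
    then have pUF: "(p', t' *\<^sub>R \<xi> p') \<in> UF" using z by simp
    have KH: "(snd d p', t' *\<^sub>R ?w) \<in> DH" using q(3) K1 by (simp add: T_def)
    have line: "((\<lambda>s. (snd d p', s *\<^sub>R ?w)) has_derivative (\<lambda>h. (0, h *\<^sub>R ?w))) (at t')"
      by (auto intro!: derivative_eq_intros)
    have D1: "((\<lambda>s. H (snd d p', s *\<^sub>R ?w)) has_derivative
       (\<lambda>h. frechet_derivative H (at (snd d p', t' *\<^sub>R ?w)) (0, h *\<^sub>R ?w))) (at t')"
      by (rule has_derivative_compose[OF line smooth_on_has_derivative[OF sH KH]])
    have const: "smooth_to A (UNIV :: real set) (\<lambda>x. p')"
      by (rule smooth_to_const[OF atlas]) (use p' S_carrier in auto)
    have lift: "smooth_to (tangent_atlas A) (UNIV \<times> UNIV) (\<lambda>z :: real \<times> real. (p', snd z *\<^sub>R \<xi> p'))"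
      using flow_lift_smooth[OF const] p' by auto
    have "smooth_on (UNIV :: real set) (\<lambda>s. (0 :: real, s))" by (rule smooth_on_Pair) simp_all
    then have lift1: "smooth_to (tangent_atlas A) (UNIV :: real set) (\<lambda>s. (p', s *\<^sub>R \<xi> p'))"
      using smooth_to_reparam[OF TA lift open_UNIV, of "\<lambda>s. (0, s)"] by simp
    have UFo: "openin (atlas_topology (tangent_atlas A)) (Q \<inter> UF)"
      using Q(1) F(2) by (auto simp: smooth_map_def)
    \<comment> \<open>On the hypersurface the extension \<open>F\<close> must give the true velocity
      of the flow line. Near \<open>t'\<close> the ray remains in \<open>UF\<close> and, being
      normal and in \<open>Q\<close>, also in \<open>V\<close>, where \<open>F\<close> agrees with
      the exponential map.\<close>
    define R where "R = UNIV \<inter> (\<lambda>s. (p', s *\<^sub>R \<xi> p')) -` (Q \<inter> UF)"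
    have R: "open R" unfolding R_def by (rule smooth_to_open_preimage[OF lift1 UFo])
    have tR: "t' \<in> R" using p' pUF Q(2) by (simp add: R_def)
    have D2: "((\<lambda>s. snd c (\<Phi> p' s)) has_derivative
       (\<lambda>h. frechet_derivative H (at (snd d p', t' *\<^sub>R ?w)) (0, h *\<^sub>R ?w))) (at t')"
    proof (rule has_derivative_transform_within_open[OF D1 R tR])
      fix s assume "s \<in> R"
      then have s: "(p', s *\<^sub>R \<xi> p') \<in> V" "(p', s *\<^sub>R \<xi> p') \<in> UF"
        using xi_normal[OF p'(1)] Q(2) by (auto simp: R_def)
      have "chart_inv ?d (snd d p', s *\<^sub>R ?w) = (p', s *\<^sub>R \<xi> p')"
        using chart_inv_chart[OF TA dT, of "(p', s *\<^sub>R \<xi> p')"] p'd unfolding dl by simp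
      then show "H (snd d p', s *\<^sub>R ?w) = snd c (\<Phi> p' s)"
        using F(3)[of "(p', s *\<^sub>R \<xi> p')"] s by (simp add: H_def flow_exp)
    qed
    show ?thesis
      using U_chart[OF dom' c(1) _ D2] q(2) unfolding q'[symmetric] by (simp add: \<mu>_def K1 X1)
  qed
  with T qT diff show ?thesis by blast
qed

text \<open>With a differentiable local extension of \<open>U\<close>, the covariant derivative
  along a curve in \<open>\<Sigma>\<close> depends on the curve only through its initial velocity.
  Hence the definite description may be evaluated along any curve with that velocity.\<close>

lemma cov_deriv_U:
  assumes \<gamma>: "curve_through A \<Sigma> q \<gamma>"
  shows "cov_deriv_on A g \<Sigma> U q (velocity A \<gamma> 0) = cov_deriv A g \<gamma> (\<lambda>s. U (\<gamma> s)) 0"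
proof -
  have "0 \<in> {-\<epsilon><..<\<epsilon>}" if "\<epsilon> > 0" for \<epsilon> :: real using that by simp
  then have q: "q \<in> \<Sigma>" using \<gamma> unfolding curve_through_def by fastforce
  then obtain p t where dom0: "(p, t) \<in> dom" and qpt: "q = \<Phi> p t" by (rule hypersurface_cases)
  have qc: "q \<in> carrier_of A"
    using smooth_to_carrier[OF flow_line_smooth(1)[of p], of t] dom0 qpt by (simp add: dom_iff)
  let ?c = "chart_at A q"
  note c = chart_at[OF qc]
  obtain T \<mu> where T: "open T" "snd ?c q \<in> T" and \<mu>: "\<mu> differentiable (at (snd ?c q))"
    and U\<mu>: "\<And>q'. q' \<in> \<Sigma> \<Longrightarrow> q' \<in> fst ?c \<Longrightarrow> snd ?c q' \<in> T \<Longrightarrow> dchart A ?c q' (U q') = \<mu> (snd ?c q')"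
    using U_local_extension[OF dom0, of ?c] c unfolding qpt by blast
  have val: "cov_deriv A g \<gamma> (\<lambda>s. U (\<gamma> s)) 0 = frechet_derivative \<mu> (at (snd ?c q)) (velocity A \<gamma> 0)
      + levi_civita A g ?c (snd ?c q) (velocity A \<gamma> 0) (U q)" if \<gamma>: "curve_through A \<Sigma> q \<gamma>" for \<gamma>
  proof -
    obtain \<epsilon> where \<epsilon>: "\<epsilon> > 0" "smooth_to A {-\<epsilon><..<\<epsilon>} \<gamma>" "\<gamma> ` {-\<epsilon><..<\<epsilon>} \<subseteq> \<Sigma>" "\<gamma> 0 = q"
      using \<gamma> by (auto simp: curve_through_def)
    have 0: "0 \<in> {-\<epsilon><..<\<epsilon>}" using \<epsilon> by simp
    let ?w = "\<lambda>s. snd ?c (\<gamma> s)"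
    have w: "(?w has_derivative frechet_derivative ?w (at 0)) (at 0)"
      by (rule smooth_to_has_derivative[OF \<epsilon>(2) 0 c(1)]) (use c \<epsilon> in simp)
    have w1: "frechet_derivative ?w (at 0) 1 = velocity A \<gamma> 0"
      using dchart_tangent_map[OF atlas \<epsilon>(2) 0 c(1), of 1] c \<epsilon>(4) dchart_chart_at[OF atlas qc]
      by (simp add: velocity_def)
    have \<mu>': "(\<mu> has_derivative frechet_derivative \<mu> (at (?w 0))) (at (?w 0))"
      using \<mu> \<epsilon>(4) by (simp add: frechet_derivative_works)
    have D: "((\<lambda>s. \<mu> (?w s)) has_derivative
      (\<lambda>h. frechet_derivative \<mu> (at (?w 0)) (frechet_derivative ?w (at 0) h))) (at 0)"
      by (rule has_derivative_compose[OF w \<mu>'])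
    define I where "I = {-\<epsilon><..<\<epsilon>} \<inter> \<gamma> -` fst ?c"
    have I: "open I" unfolding I_def by (rule smooth_to_open_preimage[OF \<epsilon>(2) openin_chart_domain[OF atlas c(1)]])
    have "continuous_on I ?w"
      using smooth_on_continuous_on[OF smooth_to_chart[OF \<epsilon>(2) c(1)]] by (simp add: I_def o_def)
    then have IT: "open (I \<inter> ?w -` T)" using continuous_open_preimage I T(1) by blast
    have 0: "0 \<in> I \<inter> ?w -` T" using 0 c T \<epsilon>(4) by (simp add: I_def)
    have D': "((\<lambda>s. dchart A ?c (\<gamma> s) (U (\<gamma> s))) has_derivative
      (\<lambda>h. frechet_derivative \<mu> (at (?w 0)) (frechet_derivative ?w (at 0) h))) (at 0)"
      by (rule has_derivative_transform_within_open[OF D IT 0])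
        (use U\<mu> \<epsilon>(3) in \<open>auto simp: I_def image_subset_iff\<close>)
    have "vector_derivative (\<lambda>s. dchart A ?c (\<gamma> s) (U (\<gamma> s))) (at 0)
      = frechet_derivative \<mu> (at (?w 0)) (frechet_derivative ?w (at 0) 1)"
      by (rule vector_derivative_at[OF has_derivative_imp_has_vector_derivative[OF D']])
    then show ?thesis
      unfolding cov_deriv_def Let_def using \<epsilon>(4) w1 by simp
  qed
  show ?thesis
    unfolding cov_deriv_on_def
  proof (rule the_equality)
    show "\<exists>\<gamma>'. curve_through A \<Sigma> q \<gamma>' \<and> velocity A \<gamma>' 0 = velocity A \<gamma> 0 \<and>
      cov_deriv A g \<gamma> (\<lambda>s. U (\<gamma> s)) 0 = cov_deriv A g \<gamma>' (\<lambda>s. U (\<gamma>' s)) 0"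
      using \<gamma> by blast
    fix w assume "\<exists>\<gamma>'. curve_through A \<Sigma> q \<gamma>' \<and> velocity A \<gamma>' 0 = velocity A \<gamma> 0 \<and>
      w = cov_deriv A g \<gamma>' (\<lambda>s. U (\<gamma>' s)) 0"
    then show "w = cov_deriv A g \<gamma> (\<lambda>s. U (\<gamma> s)) 0"
      using val[OF \<gamma>] val by metis
  qed
qed

end

section \<open>Evolution of the induced metric\<close>

text \<open>The integrating factor \<open>exp (- a * M s)\<close> turns the equation into a
  vanishing derivative. Closed segments and the oriented integral are used because \<open>t\<close>
  may be negative.\<close>

lemma exponential_evolution:
  fixes k m :: "real \<Rightarrow> real"
  assumes k: "\<And>s. s \<in> closed_segment 0 t \<Longrightarrow> (k has_real_derivative a * m s * k s) (at s)"
    and m: "continuous_on (closed_segment 0 t) m"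
  shows "k t = exp (a * (LBINT s=0..t. m s)) * k 0"
proof -
  let ?I = "{min 0 t..max 0 t}"
  have I: "closed_segment 0 t = ?I" by (auto simp: closed_segment_eq_real_ivl)
  define M where "M u = (LBINT s=0..u. m s)" for u :: real
  \<comment> \<open>The derivative is taken within \<open>?I\<close>: continuity of \<open>m\<close>
    is known only on this interval, so at its ends the fundamental theorem is one-sided.\<close>
  have M: "(M has_real_derivative m s) (at s within ?I)" if "s \<in> ?I" for s
    unfolding M_def[abs_def] has_real_derivative_iff_has_vector_derivative zero_ereal_def[symmetric]
    using interval_integral_FTC2[of "min 0 t" 0 "max 0 t" m s] m that by (simp add: I zero_ereal_def)
  have "((\<lambda>s. exp (- a * M s) * k s) has_real_derivative 0) (at s within ?I)" if s: "s \<in> ?I" for s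
  proof -
    have kd: "(k has_real_derivative a * m s * k s) (at s within ?I)"
      using has_field_derivative_at_within[OF k[of s]] s I by simp
    show ?thesis
      by (rule derivative_eq_intros M[OF s] kd refl)+ (simp add: algebra_simps)
  qed
  then have "\<exists>c. \<forall>s\<in>?I. exp (- a * M s) * k s = c"
    by (intro has_field_derivative_zero_constant) auto
  then have "exp (- a * M t) * k t = exp (- a * M 0) * k 0" by auto
  moreover have "M 0 = 0" by (simp add: M_def zero_ereal_def)
  ultimately have "exp (- a * M t) * k t = k 0" by simp
  then have "exp (a * M t) * k 0 = (exp (a * M t) * exp (- a * M t)) * k t" by simp
  also have "exp (a * M t) * exp (- a * M t) = 1" by (simp flip: exp_add)
  finally show ?thesis by (simp add: M_def zero_ereal_def)
qed

lemma tangent_map_cong: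
  assumes "open W" "x \<in> W" "\<And>y. y \<in> W \<Longrightarrow> f y = h y"
  shows "tangent_map euclidean_atlas A f x = tangent_map euclidean_atlas A h x"
proof -
  let ?c = "chart_at A (f x)"
  have "((\<lambda>y. snd ?c (f y)) has_derivative D) (at x) \<longleftrightarrow> ((\<lambda>y. snd ?c (h y)) has_derivative D) (at x)" for D
    using has_derivative_transform_within_open[OF _ assms(1,2), of "\<lambda>y. snd ?c (f y)" D UNIV "\<lambda>y. snd ?c (h y)"]
      has_derivative_transform_within_open[OF _ assms(1,2), of "\<lambda>y. snd ?c (h y)" D UNIV "\<lambda>y. snd ?c (f y)"] assms(3)
    by auto
  then show ?thesis
    using assms(2,3) by (simp add: tangent_map_def fun_eq_iff o_def frechet_derivative_def)
qed

text \<open>Straight lines in the parameter space realize every vector in the image of the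
  differential as the velocity of a curve, as the definitions of \<open>tangent_space\<close> and
  \<open>screen\<close> demand.\<close>

lemma smooth_line_curve:
  fixes x u :: "'k::euclidean_space"
  assumes A: "smooth_atlas A" and f: "smooth_to A W f" and x: "x \<in> W" and N: "f ` W \<subseteq> N"
  shows "curve_through A N (f x) (\<lambda>\<sigma>. f (x + \<sigma> *\<^sub>R u))"
    "velocity A (\<lambda>\<sigma>. f (x + \<sigma> *\<^sub>R u)) 0 = tangent_map euclidean_atlas A f x u"
proof -
  have W: "open W" by (rule smooth_to_open[OF f])
  have "open ((\<lambda>\<sigma>. x + \<sigma> *\<^sub>R u) -` W)" by (intro continuous_open_vimage W continuous_intros)
  moreover have "0 \<in> (\<lambda>\<sigma>. x + \<sigma> *\<^sub>R u) -` W" using x by simp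
  ultimately obtain e where e: "e > 0" "ball 0 e \<subseteq> (\<lambda>\<sigma>. x + \<sigma> *\<^sub>R u) -` W"
    using open_contains_ball by blast
  have I: "{-e<..<e} = ball (0 :: real) e" by (auto simp: dist_real_def)
  have im: "(\<lambda>\<sigma>. x + \<sigma> *\<^sub>R u) ` {-e<..<e} \<subseteq> W" using e(2) unfolding I by auto
  have "smooth_on {-e<..<e} (\<lambda>\<sigma>. x + \<sigma> *\<^sub>R u)"
    by (intro smooth_on_add smooth_on_scaleR) auto
  then have s: "smooth_to A {-e<..<e} (\<lambda>\<sigma>. f (x + \<sigma> *\<^sub>R u))"
    by (intro smooth_to_reparam[OF A f _ _ im]) auto
  then show "curve_through A N (f x) (\<lambda>\<sigma>. f (x + \<sigma> *\<^sub>R u))"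
    unfolding curve_through_def using e(1) im N by (intro exI[of _ e]) auto
  obtain c where c: "c \<in> A" "f x \<in> fst c" using smooth_to_carrier[OF f x] by (auto simp: carrier_of_def)
  have line: "((\<lambda>\<sigma>. x + \<sigma> *\<^sub>R u) has_derivative (\<lambda>h. h *\<^sub>R u)) (at 0)"
    by (auto intro!: derivative_eq_intros)
  have "((\<lambda>\<sigma>. snd c (f (x + \<sigma> *\<^sub>R u))) has_derivative
      (\<lambda>h. frechet_derivative (\<lambda>y. snd c (f y)) (at x) (h *\<^sub>R u))) (at 0)"
    by (rule has_derivative_compose[OF line]) (use smooth_to_has_derivative[OF f x c] in simp)
  then show "velocity A (\<lambda>\<sigma>. f (x + \<sigma> *\<^sub>R u)) 0 = tangent_map euclidean_atlas A f x u"
    unfolding velocity_def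
    by (rule tangent_map_eqI[OF A s _ c(1), rotated 2])
      (use e(1) c dchart_tangent_map[OF A f x c] in auto)
qed

context null_flow
begin

lemma slice_smooth:
  assumes f: "smooth_to A W \<psi>" and fS: "\<psi> ` W \<subseteq> S"
  shows "smooth_to A {y \<in> W. (\<psi> y, s) \<in> dom} (\<lambda>y. \<Phi> (\<psi> y) s)"
proof -
  have "open ((\<lambda>y. (y, s)) -` {z \<in> W \<times> UNIV. (\<psi> (fst z), snd z) \<in> dom})"
    by (intro continuous_open_vimage flow_domain_open[OF f fS] continuous_intros)
  then have W: "open {y \<in> W. (\<psi> y, s) \<in> dom}" by (simp add: vimage_def)
  show ?thesis
    by (rule flow_slice_smooth[OF smooth_to_subset[OF atlas f W]]) (use fS in auto)
qed

definition slice_tangent :: "('k::euclidean_space \<Rightarrow> 'a) \<Rightarrow> 'k \<Rightarrow> real \<Rightarrow> 'k \<Rightarrow> 'e" where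
  "slice_tangent \<psi> x s = tangent_map euclidean_atlas A (\<lambda>y. \<Phi> (\<psi> y) s) x"

context
  fixes W :: "'k::euclidean_space set" and \<psi> x s c F
  assumes f: "smooth_to A W \<psi>" and fS: "\<psi> ` W \<subseteq> S" and x: "x \<in> W" and dom: "(\<psi> x, s) \<in> dom"
    and c: "c \<in> A" "\<Phi> (\<psi> x) s \<in> fst c"
  defines "F \<equiv> \<lambda>z. snd c (\<Phi> (\<psi> (fst z)) (snd z))"
begin

lemma flow_chart_smooth:
  obtains T where "open T" "(x, s) \<in> T" "smooth_on T F"
    "\<And>z. z \<in> T \<Longrightarrow> fst z \<in> W \<and> (\<psi> (fst z), snd z) \<in> dom \<and> \<Phi> (\<psi> (fst z)) (snd z) \<in> fst c"
proof -
  note sm = flow_smooth[OF f fS]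
  let ?D = "{z \<in> W \<times> UNIV. (\<psi> (fst z), snd z) \<in> dom}"
  let ?T = "?D \<inter> (\<lambda>z. \<Phi> (\<psi> (fst z)) (snd z)) -` fst c"
  have 1: "open ?T" by (rule smooth_to_open_preimage[OF sm openin_chart_domain[OF atlas c(1)]])
  have 2: "(x, s) \<in> ?T" using x dom c by simp
  have 3: "smooth_on ?T F" using smooth_to_chart[OF sm c(1)] by (simp add: F_def o_def)
  show ?thesis by (rule that[OF 1 2 3]) (auto simp: mem_Times_iff)
qed

text \<open>In a chart the whole flow is a single smooth map \<open>F\<close> of
  \<open>(x, s)\<close>. Here and in \<open>U_flow_chart\<close> the slice vectors and
  \<open>U\<close> become its partial derivatives, so that their interaction is a matter of second
  derivatives of \<open>F\<close>.\<close>

lemma slice_tangent_chart: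
  "dchart A c (\<Phi> (\<psi> x) s) (slice_tangent \<psi> x s u) = frechet_derivative F (at (x, s)) (u, 0)"
proof -
  obtain T where T: "open T" "(x, s) \<in> T" "smooth_on T F" by (rule flow_chart_smooth)
  have l: "((\<lambda>y. (y, s)) has_derivative (\<lambda>u. (u, 0))) (at x)" by (auto intro!: derivative_eq_intros)
  have "((\<lambda>y. F (y, s)) has_derivative (\<lambda>u. frechet_derivative F (at (x, s)) (u, 0))) (at x)"
    by (rule has_derivative_compose[OF l smooth_on_has_derivative[OF T(3,2)]])
  from frechet_derivative_eq[OF this] show ?thesis
    unfolding slice_tangent_def
    using dchart_tangent_map[OF atlas slice_smooth[OF f fS] _ c(1), of x s u] x dom c
    by (simp add: F_def)
qed

lemma U_flow_chart:
  "dchart A c (\<Phi> (\<psi> x) s) (U (\<Phi> (\<psi> x) s)) = frechet_derivative F (at (x, s)) (0, 1)"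
proof -
  obtain T where T: "open T" "(x, s) \<in> T" "smooth_on T F" by (rule flow_chart_smooth)
  have l: "((\<lambda>\<sigma>. (x, \<sigma>)) has_derivative (\<lambda>h. (0, h))) (at s)" by (auto intro!: derivative_eq_intros)
  have "((\<lambda>\<sigma>. F (x, \<sigma>)) has_derivative (\<lambda>h. frechet_derivative F (at (x, s)) (0, h))) (at s)"
    by (rule has_derivative_compose[OF l smooth_on_has_derivative[OF T(3,2)]])
  then show ?thesis using U_chart[OF dom c] by (simp add: F_def)
qed

end

lemma slice_curve:
  assumes f: "smooth_to A W \<psi>" and fS: "\<psi> ` W \<subseteq> S" and x: "x \<in> W" and dom: "(\<psi> x, s) \<in> dom"
  shows "curve_through A \<Sigma> (\<Phi> (\<psi> x) s) (\<lambda>\<sigma>. \<Phi> (\<psi> (x + \<sigma> *\<^sub>R u)) s)"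
    "velocity A (\<lambda>\<sigma>. \<Phi> (\<psi> (x + \<sigma> *\<^sub>R u)) s) 0 = slice_tangent \<psi> x s u"
    "slice_tangent \<psi> x s u \<in> tangent_space A \<Sigma> (\<Phi> (\<psi> x) s)"
proof -
  have xs: "x \<in> {y \<in> W. (\<psi> y, s) \<in> dom}" using x dom by simp
  have im: "(\<lambda>y. \<Phi> (\<psi> y) s) ` {y \<in> W. (\<psi> y, s) \<in> dom} \<subseteq> \<Sigma>" using flow_in_hypersurface by auto
  note l = smooth_line_curve[OF atlas slice_smooth[OF f fS] xs im, of u]
  show 1: "curve_through A \<Sigma> (\<Phi> (\<psi> x) s) (\<lambda>\<sigma>. \<Phi> (\<psi> (x + \<sigma> *\<^sub>R u)) s)" by (rule l(1))
  show 2: "velocity A (\<lambda>\<sigma>. \<Phi> (\<psi> (x + \<sigma> *\<^sub>R u)) s) 0 = slice_tangent \<psi> x s u"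
    unfolding slice_tangent_def by (rule l(2))
  show "slice_tangent \<psi> x s u \<in> tangent_space A \<Sigma> (\<Phi> (\<psi> x) s)"
    unfolding tangent_space_def using 1 2[symmetric] by blast
qed

text \<open>The first variation formula, prior to any use of umbilicity. Both orders of the
  arguments occur because symmetry of the null second fundamental form has not been
  established.\<close>

lemma slice_metric_derivative:
  fixes W :: "'k::euclidean_space set"
  assumes f: "smooth_to A W \<psi>" and fS: "\<psi> ` W \<subseteq> S" and x: "x \<in> W" and dom: "(\<psi> x, s) \<in> dom"
  defines "q \<equiv> \<Phi> (\<psi> x) s" and "X \<equiv> slice_tangent \<psi> x s"
  shows "((\<lambda>\<sigma>. pullback_metric A g (\<lambda>y. \<Phi> (\<psi> y) \<sigma>) x u v) has_real_derivative
    - null_sff A g S \<xi> V q (X u) (X v) - null_sff A g S \<xi> V q (X v) (X u)) (at s)"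
proof -
  have qc: "q \<in> carrier_of A"
    using smooth_to_carrier[OF slice_smooth[OF f fS], of x s] x dom by (simp add: q_def)
  \<comment> \<open>The preferred chart at \<open>q\<close> is taken because
    \<open>cov_deriv\<close> computes in it at that point; vectors at \<open>q\<close> then coincide
    with their components.\<close>
  define ch where "ch = chart_at A q"
  have c: "ch \<in> A" "q \<in> fst ch" using chart_at[OF qc] by (simp_all add: ch_def)
  have c2: "\<Phi> (\<psi> x) s \<in> fst ch" using c(2) by (simp add: q_def)
  have chq: "dchart A ch q w = w" for w unfolding ch_def by (rule dchart_chart_at[OF atlas qc])
  define F where "F z = snd ch (\<Phi> (\<psi> (fst z)) (snd z))" for z
  obtain T where T: "open T" "(x, s) \<in> T" "smooth_on T F"
    "\<And>z. z \<in> T \<Longrightarrow> fst z \<in> W \<and> (\<psi> (fst z), snd z) \<in> dom \<and> \<Phi> (\<psi> (fst z)) (snd z) \<in> fst ch"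
    using flow_chart_smooth[OF f fS x dom c(1) c2, folded q_def]
    unfolding F_def[abs_def, symmetric] by blast
  let ?D = "\<lambda>z. frechet_derivative F (at z)"
  let ?DD = "\<lambda>a b. frechet_derivative (\<lambda>z. ?D z a) (at (x, s)) b"
  let ?\<Gamma> = "levi_civita A g ch (snd ch q)"
  have xq: "F (x, s) = snd ch q" by (simp add: F_def q_def)
  have im: "snd ch q \<in> snd ch ` fst ch" using c by simp
  have sym\<Gamma>: "?\<Gamma> a b = ?\<Gamma> b a" for a b
    using christoffel_levi_civita[OF c(1) im] by (simp add: christoffel_def)
  have Xc: "X w = ?D (x, s) (w, 0)" for w
    using slice_tangent_chart[OF f fS x dom c(1) c2, of w, folded q_def X_def]
      chq by (simp add: F_def[abs_def])
  have Uc: "U q = ?D (x, s) (0, 1)"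
    using U_flow_chart[OF f fS x dom c(1) c2, folded q_def]
      chq by (simp add: F_def[abs_def])
  have cov: "cov_deriv_on A g \<Sigma> U q (X w) = ?DD (0, 1) (w, 0) + ?\<Gamma> (X w) (U q)" for w
  proof -
    let ?\<gamma> = "\<lambda>\<sigma>. \<Phi> (\<psi> (x + \<sigma> *\<^sub>R w)) s"
    note cur = slice_curve[OF f fS x dom, of w, folded q_def X_def]
    have line: "((\<lambda>\<sigma>. (x + \<sigma> *\<^sub>R w, s)) has_derivative (\<lambda>h. (h *\<^sub>R w, 0))) (at 0)"
      by (auto intro!: derivative_eq_intros)
    have D1: "((\<lambda>\<sigma>. ?D (x + \<sigma> *\<^sub>R w, s) (0, 1)) has_derivative (\<lambda>h. ?DD (0, 1) (h *\<^sub>R w, 0))) (at 0)"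
      by (rule has_derivative_compose[OF line, of "\<lambda>z. ?D z (0, 1)"])
        (use smooth_on_has_derivative[OF smooth_on_derivative[OF T(3)] T(2)] in simp)
    have O: "open ((\<lambda>\<sigma>. (x + \<sigma> *\<^sub>R w, s)) -` T)" by (intro continuous_open_vimage T(1) continuous_intros)
    have "((\<lambda>\<sigma>. dchart A ch (?\<gamma> \<sigma>) (U (?\<gamma> \<sigma>))) has_derivative (\<lambda>h. ?DD (0, 1) (h *\<^sub>R w, 0))) (at 0)"
    proof (rule has_derivative_transform_within_open[OF D1 O])
      show "0 \<in> (\<lambda>\<sigma>. (x + \<sigma> *\<^sub>R w, s)) -` T" using T(2) by simp
      fix \<sigma> assume "\<sigma> \<in> (\<lambda>\<sigma>. (x + \<sigma> *\<^sub>R w, s)) -` T"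
      then have z: "x + \<sigma> *\<^sub>R w \<in> W" "(\<psi> (x + \<sigma> *\<^sub>R w), s) \<in> dom" "\<Phi> (\<psi> (x + \<sigma> *\<^sub>R w)) s \<in> fst ch"
        using T(4)[of "(x + \<sigma> *\<^sub>R w, s)"] by auto
      from U_flow_chart[OF f fS z(1,2) c(1) z(3)]
      show "?D (x + \<sigma> *\<^sub>R w, s) (0, 1) = dchart A ch (?\<gamma> \<sigma>) (U (?\<gamma> \<sigma>))" by (simp add: F_def[abs_def])
    qed
    from vector_derivative_at[OF has_derivative_imp_has_vector_derivative[OF this]]
    have vd: "vector_derivative (\<lambda>\<sigma>. dchart A ch (?\<gamma> \<sigma>) (U (?\<gamma> \<sigma>))) (at 0) = ?DD (0, 1) (w, 0)" by simp
    have q0: "\<Phi> (\<psi> (x + 0 *\<^sub>R w)) s = q" by (simp add: q_def)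
    have "cov_deriv_on A g \<Sigma> U q (X w) = cov_deriv A g ?\<gamma> (\<lambda>\<sigma>. U (?\<gamma> \<sigma>)) 0"
      using cov_deriv_U[OF cur(1)] cur(2) by simp
    also have "\<dots> = ?DD (0, 1) (w, 0) + ?\<Gamma> (X w) (U q)"
      unfolding cov_deriv_def Let_def q0 ch_def[symmetric] vd cur(2) ..
    finally show ?thesis .
  qed
  have line: "((\<lambda>\<sigma>. (x, \<sigma>)) has_derivative (\<lambda>h. (0, h))) (at s)" by (auto intro!: derivative_eq_intros)
  have dF: "((\<lambda>\<sigma>. F (x, \<sigma>)) has_derivative (\<lambda>h. ?D (x, s) (0, h))) (at s)"
    by (rule has_derivative_compose[OF line smooth_on_has_derivative[OF T(3,2)]])
  have dX: "((\<lambda>\<sigma>. ?D (x, \<sigma>) (w, 0)) has_derivative (\<lambda>h. ?DD (w, 0) (0, h))) (at s)" for w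
    by (rule has_derivative_compose[OF line smooth_on_has_derivative[OF smooth_on_derivative[OF T(3)] T(2)]])
  \<comment> \<open>Vanishing torsion in coordinates: mixed partials of \<open>F\<close> commute
    and, by \<open>sym\<Gamma>\<close>, so do the arguments of the Christoffel term. Together they
    exchange the derivative of a slice vector along the flow for the derivative of \<open>U\<close>
    in its direction.\<close>
  have swap: "?DD (w, 0) (0, 1) = ?DD (0, 1) (w, 0)" for w
    by (rule symmetric_second_derivative[OF T(3,1,2)])
  have imF: "F (x, s) \<in> snd ch ` fst ch" using im xq by simp
  have "((\<lambda>\<sigma>. cmetric ch (F (x, \<sigma>)) (?D (x, \<sigma>) (u, 0)) (?D (x, \<sigma>) (v, 0))) has_derivative
    (\<lambda>h. cmetric ch (F (x, s)) (?DD (u, 0) (0, h) + levi_civita A g ch (F (x, s)) (?D (x, s) (0, h)) (?D (x, s) (u, 0))) (?D (x, s) (v, 0))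
     + cmetric ch (F (x, s)) (?D (x, s) (u, 0)) (?DD (v, 0) (0, h) + levi_civita A g ch (F (x, s)) (?D (x, s) (0, h)) (?D (x, s) (v, 0))))) (at s)"
    by (rule covariant_product_rule[OF c(1) imF dF dX dX])
  from has_derivative_imp_has_vector_derivative[OF this]
  have D: "((\<lambda>\<sigma>. cmetric ch (F (x, \<sigma>)) (?D (x, \<sigma>) (u, 0)) (?D (x, \<sigma>) (v, 0))) has_real_derivative
    cmetric ch (snd ch q) (cov_deriv_on A g \<Sigma> U q (X u)) (X v) + cmetric ch (snd ch q) (X u) (cov_deriv_on A g \<Sigma> U q (X v))) (at s)"
    unfolding has_real_derivative_iff_has_vector_derivative cov swap xq
    by (simp only: Xc[symmetric] Uc[symmetric] sym\<Gamma>[of "U q"])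
  have cm: "cmetric ch (snd ch q) a b = g q a b" for a b
    using pullback_metric_chart[OF atlas c, of g a b] by (simp add: chq)
  have "open ((\<lambda>\<sigma>. (x, \<sigma>)) -` T)" by (intro continuous_open_vimage T(1) continuous_intros)
  then have "((\<lambda>\<sigma>. pullback_metric A g (\<lambda>y. \<Phi> (\<psi> y) \<sigma>) x u v) has_real_derivative
    cmetric ch (snd ch q) (cov_deriv_on A g \<Sigma> U q (X u)) (X v) + cmetric ch (snd ch q) (X u) (cov_deriv_on A g \<Sigma> U q (X v))) (at s)"
  proof (rule has_field_derivative_transform_within_open[OF D])
    show "s \<in> (\<lambda>\<sigma>. (x, \<sigma>)) -` T" using T(2) by simp
    fix \<sigma> assume "\<sigma> \<in> (\<lambda>\<sigma>. (x, \<sigma>)) -` T"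
    then have z: "(\<psi> x, \<sigma>) \<in> dom" "\<Phi> (\<psi> x) \<sigma> \<in> fst ch" using T(4)[of "(x, \<sigma>)"] by auto
    have "dchart A ch (\<Phi> (\<psi> x) \<sigma>) (slice_tangent \<psi> x \<sigma> w) = ?D (x, \<sigma>) (w, 0)" for w
      using slice_tangent_chart[OF f fS x z(1) c(1) z(2)] by (simp add: F_def[abs_def])
    then show "cmetric ch (F (x, \<sigma>)) (?D (x, \<sigma>) (u, 0)) (?D (x, \<sigma>) (v, 0))
      = pullback_metric A g (\<lambda>y. \<Phi> (\<psi> y) \<sigma>) x u v"
      using pullback_metric_chart[OF atlas c(1) z(2), of g "slice_tangent \<psi> x \<sigma> u" "slice_tangent \<psi> x \<sigma> v"]
      by (simp add: F_def slice_tangent_def pullback_metric_def[of A g "\<lambda>y. \<Phi> (\<psi> y) \<sigma>"])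
  qed
  then show ?thesis
    unfolding cm null_sff_def using metric_sym[OF qc] by simp
qed

end

section \<open>Totally umbilical null hypersurfaces\<close>

locale umbilic_flow = null_flow A g S \<xi> V
  for A :: "('a, 'e::euclidean_space) atlas" and g S \<xi> V +
  fixes \<mu> :: "'a \<Rightarrow> real"
  assumes spacelike: "spacelike A g S"
    and mu_smooth: "smooth_map_on A euclidean_atlas \<Sigma> \<mu>"
    and umbilical: "\<And>q X Y. q \<in> \<Sigma> \<Longrightarrow> X \<in> tangent_space A \<Sigma> q \<Longrightarrow> Y \<in> tangent_space A \<Sigma> q \<Longrightarrow>
      null_sff A g S \<xi> V q X Y = \<mu> q * g q X Y"
begin

lemma dom_segment:
  assumes dom: "(p, t) \<in> dom" and s: "s \<in> closed_segment 0 t"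
  shows "(p, s) \<in> dom"
proof -
  obtain r where "0 \<le> r" "r \<le> 1" "s = r * t" using s by (auto simp: in_segment)
  then show ?thesis using dom_star[OF dom, of r] by simp
qed

lemma mu_continuous:
  assumes p: "p \<in> S"
  shows "continuous_on {t. (p, t) \<in> dom} (\<lambda>t. \<mu> (\<Phi> p t))"
proof -
  have "smooth_to euclidean_atlas {t. (p, t) \<in> dom} (\<lambda>t. \<mu> (\<Phi> p t))"
    by (rule smooth_to_compose_map_on[OF smooth_atlas_euclidean atlas mu_smooth flow_line_smooth(1)[OF p]])
      (use flow_in_hypersurface in auto)
  then show ?thesis by (auto simp: smooth_to_euclidean_iff intro: smooth_on_continuous_on)
qed

lemma slice_metric_evolution:
  fixes W :: "'k::euclidean_space set"
  assumes f: "smooth_to A W \<psi>" and fS: "\<psi> ` W \<subseteq> S" and x: "x \<in> W" and dom: "(\<psi> x, t) \<in> dom"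
  shows "pullback_metric A g (\<lambda>y. \<Phi> (\<psi> y) t) x u v
    = exp (- 2 * (LBINT s=0..t. \<mu> (\<Phi> (\<psi> x) s))) * pullback_metric A g \<psi> x u v"
proof -
  let ?h = "\<lambda>s. pullback_metric A g (\<lambda>y. \<Phi> (\<psi> y) s) x u v"
  have p: "\<psi> x \<in> S" using fS x by auto
  have "?h t = exp (- 2 * (LBINT s=0..t. \<mu> (\<Phi> (\<psi> x) s))) * ?h 0"
  proof (rule exponential_evolution)
    fix s assume s: "s \<in> closed_segment 0 t"
    then have ds: "(\<psi> x, s) \<in> dom" by (rule dom_segment[OF dom])
    let ?q = "\<Phi> (\<psi> x) s" and ?X = "slice_tangent \<psi> x s"
    have q: "?q \<in> \<Sigma>" by (rule flow_in_hypersurface[OF ds])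
    have X: "?X w \<in> tangent_space A \<Sigma> ?q" for w by (rule slice_curve(3)[OF f fS x ds])
    have qc: "?q \<in> carrier_of A"
      using smooth_to_carrier[OF flow_line_smooth(1)[OF p], of s] ds by simp
    have "- null_sff A g S \<xi> V ?q (?X u) (?X v) - null_sff A g S \<xi> V ?q (?X v) (?X u) = - 2 * \<mu> ?q * ?h s"
      unfolding umbilical[OF q X X] metric_sym[OF qc, of "?X v" "?X u"]
      by (simp add: pullback_metric_def slice_tangent_def)
    with slice_metric_derivative[OF f fS x ds, of u v]
    show "(?h has_real_derivative - 2 * \<mu> ?q * ?h s) (at s)" by simp
  next
    show "continuous_on (closed_segment 0 t) (\<lambda>s. \<mu> (\<Phi> (\<psi> x) s))"
      by (rule continuous_on_subset[OF mu_continuous[OF p]]) (use dom_segment[OF dom] in auto)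
  qed
  also have "?h 0 = pullback_metric A g \<psi> x u v"
  proof -
    have eq: "\<Phi> (\<psi> y) 0 = \<psi> y" if "y \<in> W" for y using flow_zero fS that by auto
    have "tangent_map euclidean_atlas A (\<lambda>y. \<Phi> (\<psi> y) 0) x = tangent_map euclidean_atlas A \<psi> x"
      by (rule tangent_map_cong[OF smooth_to_open[OF f] x eq])
    then show ?thesis by (simp add: pullback_metric_def eq[OF x])
  qed
  finally show ?thesis .
qed

lemma parametrization_spacelike:
  fixes W :: "'k::euclidean_space set"
  assumes P: "local_parametrization A S W \<psi>" and x: "x \<in> W" and u: "u \<noteq> 0"
  shows "pullback_metric A g \<psi> x u u > 0"
proof -
  note D = local_parametrizationD[OF P]
  have "tangent_map euclidean_atlas A \<psi> x u \<in> tangent_space A S (\<psi> x)"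
    unfolding tangent_space_def
    using smooth_line_curve[OF atlas D(1) x D(6), of u] by (metis (mono_tags, lifting) mem_Collect_eq)
  moreover have "tangent_map euclidean_atlas A \<psi> x u \<noteq> 0"
    using injD[OF D(4)[OF x], of u 0] u linear_0[OF tangent_map_linear[OF atlas D(1) x]] by auto
  moreover have "\<psi> x \<in> S" using D(6) x by auto
  ultimately show ?thesis using spacelike unfolding spacelike_def pullback_metric_def by blast
qed

lemma slice_spacelike:
  fixes W :: "'k::euclidean_space set"
  assumes P: "local_parametrization A S W \<psi>" and x: "x \<in> W" and dom: "(\<psi> x, t) \<in> dom" and u: "u \<noteq> 0"
  shows "g (\<Phi> (\<psi> x) t) (slice_tangent \<psi> x t u) (slice_tangent \<psi> x t u) > 0"
proof -
  note D = local_parametrizationD[OF P]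
  have "g (\<Phi> (\<psi> x) t) (slice_tangent \<psi> x t u) (slice_tangent \<psi> x t u)
    = pullback_metric A g (\<lambda>y. \<Phi> (\<psi> y) t) x u u"
    by (simp add: pullback_metric_def slice_tangent_def)
  then show ?thesis
    using slice_metric_evolution[OF D(1,6) x dom, of u u] parametrization_spacelike[OF P x u] by simp
qed

lemma slice_tangent_linear:
  assumes f: "smooth_to A W \<psi>" and fS: "\<psi> ` W \<subseteq> S" and x: "x \<in> W" and dom: "(\<psi> x, t) \<in> dom"
  shows "linear (slice_tangent \<psi> x t)"
  unfolding slice_tangent_def
  by (rule tangent_map_linear[OF atlas slice_smooth[OF f fS]]) (use x dom in simp)

text \<open>A kernel vector would have length zero in the evolved metric, which is still positive
  definite. The slices are thus seen to be immersed without inspecting the differential of the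
  exponential map.\<close>

lemma slice_tangent_inj:
  fixes W :: "'k::euclidean_space set"
  assumes P: "local_parametrization A S W \<psi>" and x: "x \<in> W" and dom: "(\<psi> x, t) \<in> dom"
  shows "inj (slice_tangent \<psi> x t)"
proof -
  note D = local_parametrizationD[OF P]
  have p: "\<psi> x \<in> S" using D(6) x by auto
  have qc: "\<Phi> (\<psi> x) t \<in> carrier_of A"
    using smooth_to_carrier[OF flow_line_smooth(1)[OF p], of t] dom by simp
  have "u = 0" if "slice_tangent \<psi> x t u = 0" for u
    using slice_spacelike[OF P x dom, of u] that bilinear_lzero[OF metric_bilinear[OF qc]] by force
  then show ?thesis using linear_injective_0[OF slice_tangent_linear[OF D(1,6) x dom]] by blast
qed

lemma flow_timesD: "t \<in> flow_times S \<xi> V \<Longrightarrow> p \<in> S \<Longrightarrow> (p, t) \<in> dom"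
  by (auto simp: flow_times_def)

lemma flow_times_segment:
  assumes "t \<in> flow_times S \<xi> V" "s \<in> closed_segment 0 t"
  shows "s \<in> flow_times S \<xi> V"
  using dom_segment[OF flow_timesD[OF assms(1)] assms(2)] by (auto simp: flow_times_def)

text \<open>The screen is defined by arbitrary curves in \<open>S\<close>, which must be brought
  back to the parameter domain. The lift of a curve through \<open>\<psi>\<close> is continuous by
  the homeomorphism property and differentiable at \<open>0\<close> because \<open>\<psi>\<close> is
  an immersion.\<close>

lemma screen_eq:
  fixes W :: "'k::euclidean_space set"
  assumes P: "local_parametrization A S W \<psi>" and x: "x \<in> W" and t: "t \<in> flow_times S \<xi> V"
  shows "screen A g S \<xi> V (\<Phi> (\<psi> x) t) = range (slice_tangent \<psi> x t)"
proof -
  note D = local_parametrizationD[OF P]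
  let ?q = "\<Phi> (\<psi> x) t"
  have dom: "(\<psi> y, t) \<in> dom" if "y \<in> W" for y using flow_timesD[OF t] D(6) that by auto
  have slice: "{p'. (p', t) \<in> dom} = S" using flow_timesD[OF t] by (auto simp: dom_iff)
  have scr: "screen A g S \<xi> V ?q = {velocity A (\<lambda>\<sigma>. \<Phi> (\<gamma> \<sigma>) t) 0 |\<gamma>. curve_through A S (\<psi> x) \<gamma>}"
    unfolding screen_def flow_coords_flow[OF dom[OF x]] prod.case slice ..
  have sm: "smooth_to A W (\<lambda>y. \<Phi> (\<psi> y) t)" by (rule flow_slice_smooth[OF D(1,6) dom])
  obtain c where c: "c \<in> A" "?q \<in> fst c"
    using smooth_to_carrier[OF sm x] by (auto simp: carrier_of_def)
  show ?thesis
  proof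
    show "range (slice_tangent \<psi> x t) \<subseteq> screen A g S \<xi> V ?q"
    proof
      fix X assume "X \<in> range (slice_tangent \<psi> x t)"
      then obtain u where u: "X = slice_tangent \<psi> x t u" by blast
      have "curve_through A S (\<psi> x) (\<lambda>\<sigma>. \<psi> (x + \<sigma> *\<^sub>R u))"
        by (rule smooth_line_curve(1)[OF atlas D(1) x D(6)])
      moreover have "X = velocity A (\<lambda>\<sigma>. \<Phi> (\<psi> (x + \<sigma> *\<^sub>R u)) t) 0"
        using slice_curve(2)[OF D(1,6) x dom[OF x], of u] u by simp
      ultimately show "X \<in> screen A g S \<xi> V ?q"
        unfolding scr by (intro CollectI exI[of _ "\<lambda>\<sigma>. \<psi> (x + \<sigma> *\<^sub>R u)"] conjI)
    qed
    show "screen A g S \<xi> V ?q \<subseteq> range (slice_tangent \<psi> x t)"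
    proof
      fix X assume "X \<in> screen A g S \<xi> V ?q"
      then obtain \<gamma> where \<gamma>: "curve_through A S (\<psi> x) \<gamma>" and X: "X = velocity A (\<lambda>\<sigma>. \<Phi> (\<gamma> \<sigma>) t) 0"
        unfolding scr by blast
      obtain \<epsilon> where e: "\<epsilon> > 0" "smooth_to A {-\<epsilon><..<\<epsilon>} \<gamma>" "\<gamma> ` {-\<epsilon><..<\<epsilon>} \<subseteq> S" "\<gamma> 0 = \<psi> x"
        using \<gamma> by (auto simp: curve_through_def)
      obtain Q where Q: "openin (atlas_topology A) Q" "\<psi> ` W = Q \<inter> S"
        using D(5) by (auto simp: openin_subtopology)
      define I where "I = {-\<epsilon><..<\<epsilon>} \<inter> \<gamma> -` Q"
      have I: "open I" unfolding I_def by (rule smooth_to_open_preimage[OF e(2) Q(1)])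
      have I0: "0 \<in> I" using e Q(2) x by (auto simp: I_def)
      have I\<gamma>: "\<gamma> r \<in> \<psi> ` W" if "r \<in> I" for r using that e(3) Q(2) by (auto simp: I_def)
      define y where "y r = inv_into W \<psi> (\<gamma> r)" for r
      have y: "y r \<in> W" "\<psi> (y r) = \<gamma> r" if "r \<in> I" for r
        using I\<gamma>[OF that] by (auto simp: y_def inv_into_into f_inv_into_f)
      have y0: "y 0 = x" using e(4) x D(3) by (simp add: y_def)
      have "continuous_map (top_of_set I) (subtopology (atlas_topology A) (\<psi> ` W)) \<gamma>"
        using smooth_to_continuous_map[OF smooth_to_subset[OF atlas e(2) I]] I\<gamma>
        by (auto simp: continuous_map_in_subtopology I_def)
      from continuous_map_compose[OF this local_parametrization_inverse[OF P]]
      have "continuous_on I y" unfolding y_def o_def by (simp add: continuous_map_in_subtopology)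
      then have cont: "isCont y 0" using I I0 by (simp add: continuous_on_eq_continuous_at)
      obtain d where d: "d \<in> A" "\<psi> x \<in> fst d"
        using smooth_to_carrier[OF D(1) x] by (auto simp: carrier_of_def)
      let ?f = "\<lambda>z. snd d (\<psi> z)"
      have f: "(?f has_derivative frechet_derivative ?f (at x)) (at x)"
        by (rule smooth_to_has_derivative[OF D(1) x d])
      have "frechet_derivative ?f (at x) = (\<lambda>u. dchart A d (\<psi> x) (tangent_map euclidean_atlas A \<psi> x u))"
        using dchart_tangent_map[OF atlas D(1) x d] by auto
      then have inj: "inj (frechet_derivative ?f (at x))"
        using inj_compose[OF bij_is_inj[OF dchart_bij[OF atlas d]] D(4)[OF x]] by (simp add: o_def)
      have k: "((\<lambda>r. snd d (\<gamma> r)) has_derivative frechet_derivative (\<lambda>r. snd d (\<gamma> r)) (at 0)) (at 0)"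
        by (rule smooth_to_has_derivative[OF e(2) _ d(1)]) (use e d in auto)
      have k2: "((\<lambda>r. ?f (y r)) has_derivative frechet_derivative (\<lambda>r. snd d (\<gamma> r)) (at 0)) (at 0)"
        by (rule has_derivative_transform_within_open[OF k I I0]) (simp add: y)
      obtain Y where Y: "(y has_derivative Y) (at 0)"
        using differentiable_through_immersion[OF f[folded y0] inj[folded y0] cont k2]
        unfolding differentiable_def by blast
      let ?F = "\<lambda>z. snd c (\<Phi> (\<psi> z) t)"
      have F: "(?F has_derivative frechet_derivative ?F (at x)) (at x)"
        by (rule smooth_to_has_derivative[OF sm x c])
      have "((\<lambda>r. ?F (y r)) has_derivative (\<lambda>h. frechet_derivative ?F (at x) (Y h))) (at 0)"
        using has_derivative_compose[OF Y, of ?F] F y0 by simp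
      then have D\<gamma>: "((\<lambda>r. snd c (\<Phi> (\<gamma> r) t)) has_derivative (\<lambda>h. frechet_derivative ?F (at x) (Y h))) (at 0)"
        by (rule has_derivative_transform_within_open[OF _ I I0]) (simp add: y)
      have sm\<gamma>: "smooth_to A {-\<epsilon><..<\<epsilon>} (\<lambda>r. \<Phi> (\<gamma> r) t)"
        by (rule flow_slice_smooth[OF e(2,3)]) (rule flow_timesD[OF t], use e(3) in auto)
      have "X = slice_tangent \<psi> x t (Y 1)"
        unfolding X velocity_def
        by (rule tangent_map_eqI[OF atlas sm\<gamma> _ c(1) _ D\<gamma>])
          (use e c dchart_tangent_map[OF atlas sm x c] in \<open>auto simp: slice_tangent_def\<close>)
      then show "X \<in> range (slice_tangent \<psi> x t)" by blast
    qed
  qed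
qed

text \<open>The shape operator is identified through uniqueness: the difference of two candidates
  lies in the screen, hence may be tested against itself, and the metric is definite there. Its
  trace is \<open>\<mu>\<close> times the dimension of the screen, which equals that of
  \<open>S\<close> because \<open>slice_tangent\<close> is injective.\<close>

lemma expansion_scalar_eq:
  fixes W :: "(real^'n) set"
  assumes P: "local_parametrization A S W \<psi>" and x: "x \<in> W" and t: "t \<in> flow_times S \<xi> V"
  shows "expansion_scalar A g S \<xi> V (\<Phi> (\<psi> x) t) = - real CARD('n) * \<mu> (\<Phi> (\<psi> x) t)"
proof -
  note D = local_parametrizationD[OF P]
  let ?q = "\<Phi> (\<psi> x) t" and ?L = "range (slice_tangent \<psi> x t)"
  have dom: "(\<psi> x, t) \<in> dom" using flow_timesD[OF t] D(6) x by auto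
  have p: "\<psi> x \<in> S" using D(6) x by auto
  have qc: "?q \<in> carrier_of A" using smooth_to_carrier[OF flow_line_smooth(1)[OF p], of t] dom by simp
  have q: "?q \<in> \<Sigma>" by (rule flow_in_hypersurface[OF dom])
  note lin = slice_tangent_linear[OF D(1,6) x dom] and inj = slice_tangent_inj[OF P x dom]
  note bil = metric_bilinear[OF qc]
  have sub: "subspace ?L" using linear_subspace_image[OF lin subspace_UNIV] .
  have LT: "X \<in> tangent_space A \<Sigma> ?q" if "X \<in> ?L" for X
    using slice_curve(3)[OF D(1,6) x dom] that by auto
  have pos: "X = 0" if "X \<in> ?L" "g ?q X X = 0" for X
  proof -
    obtain u where u: "X = slice_tangent \<psi> x t u" using \<open>X \<in> ?L\<close> by blast
    have "u = 0" using slice_spacelike[OF P x dom, of u] \<open>g ?q X X = 0\<close> u by fastforce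
    then show ?thesis using u linear_0[OF lin] by simp
  qed
  have shape: "screen_shape_operator A g S \<xi> V ?q X = \<mu> ?q *\<^sub>R X" if X: "X \<in> ?L" for X
    unfolding screen_shape_operator_def screen_eq[OF P x t]
  proof (rule the_equality, intro conjI ballI)
    show muX: "\<mu> ?q *\<^sub>R X \<in> ?L" using sub X by (rule subspace_scale)
    show "null_sff A g S \<xi> V ?q X Y = g ?q (\<mu> ?q *\<^sub>R X) Y" if "Y \<in> tangent_space A \<Sigma> ?q" for Y
      using umbilical[OF q LT[OF X] that] by (simp add: bilinear_lmul[OF bil])
    fix Z assume Z: "Z \<in> ?L \<and> (\<forall>Y\<in>tangent_space A \<Sigma> ?q. null_sff A g S \<xi> V ?q X Y = g ?q Z Y)"
    let ?d = "Z - \<mu> ?q *\<^sub>R X"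
    have d: "?d \<in> ?L" using sub Z muX by (intro subspace_diff) auto
    have "g ?q Z ?d = g ?q (\<mu> ?q *\<^sub>R X) ?d"
      using Z LT[OF d] umbilical[OF q LT[OF X] LT[OF d]] by (simp add: bilinear_lmul[OF bil])
    then have "g ?q ?d ?d = 0" by (simp add: bilinear_lsub[OF bil])
    from pos[OF d this] show "Z = \<mu> ?q *\<^sub>R X" by simp
  qed
  \<comment> \<open>The very basis chosen inside \<open>trace_on\<close>. For a multiple of the
    identity every diagonal coefficient is the same, so only its cardinality matters.\<close>
  define B where "B = (SOME B. independent B \<and> span B = ?L)"
  have "\<exists>B. independent B \<and> span B = ?L"
    using basis_exists[of ?L] sub by (metis span_eq_iff span_mono span_subspace)
  then have B: "independent B" "span B = ?L" unfolding B_def by (metis (mono_tags, lifting) someI_ex)+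
  have "trace_on (screen A g S \<xi> V ?q) (screen_shape_operator A g S \<xi> V ?q)
    = (\<Sum>b\<in>B. representation B (screen_shape_operator A g S \<xi> V ?q b) b)"
    unfolding trace_on_def screen_eq[OF P x t] B_def Let_def ..
  also have "\<dots> = (\<Sum>b\<in>B. \<mu> ?q)"
  proof (rule sum.cong[OF refl])
    fix b assume b: "b \<in> B"
    then have bL: "b \<in> ?L" using B(2) span_base by blast
    have "representation B (\<mu> ?q *\<^sub>R b) b = \<mu> ?q * representation B b b"
      using representation_scale[OF B(1), of b "\<mu> ?q"] bL B(2) by simp
    then show "representation B (screen_shape_operator A g S \<xi> V ?q b) b = \<mu> ?q"
      using shape[OF bL] representation_basis[OF B(1) b] by simp
  qed
  also have "\<dots> = real (card B) * \<mu> ?q" by simp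
  also have "card B = CARD('n)"
  proof -
    have "card B = dim ?L" using dim_span_eq_card_independent[OF B(1)] B(2) by simp
    also have "\<dots> = dim (UNIV :: (real^'n) set)"
      using dim_image_eq[OF lin, of UNIV] inj by simp
    finally show ?thesis by simp
  qed
  finally show ?thesis by (simp add: expansion_scalar_def)
qed

end

section \<open>The leaves of the screen distribution as compact embedded submanifolds\<close>

lemma openin_tangent_vimage:
  assumes A: "smooth_atlas A" and X: "openin (atlas_topology A) X"
  shows "openin (atlas_topology (tangent_atlas A)) (X \<times> UNIV)"
  unfolding openin_atlas_topology_iff[OF smooth_atlas_tangent[OF A]]
proof (intro conjI ballI)
  show "X \<times> UNIV \<subseteq> carrier_of (tangent_atlas A)"
    using openin_subset[OF X] by (auto simp: carrier_of_tangent)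
  fix c' assume "c' \<in> tangent_atlas A"
  then obtain c where c: "c' = tchart A c" "c \<in> A" by (auto simp: tangent_atlas_eq)
  have "X \<times> UNIV \<inter> fst c' = (X \<inter> fst c) \<times> UNIV" using c(1) by auto
  then have "snd c' ` (X \<times> UNIV \<inter> fst c') = snd c ` (X \<inter> fst c) \<times> UNIV"
    using tchart_image[OF A c(2), of "X \<inter> fst c"] c(1) by simp
  moreover have "open (snd c ` (X \<inter> fst c))" using X c(2) by (simp add: openin_atlas_topology_iff[OF A])
  ultimately show "open (snd c' ` (X \<times> UNIV \<inter> fst c'))" by (simp add: open_Times)
qed

context umbilic_flow
begin

abbreviation leaf :: "real \<Rightarrow> 'a set" where
  "leaf t \<equiv> screen_leaf A g S \<xi> t"

lemma leaf_eq: "leaf t = (\<lambda>p. \<Phi> p t) ` S"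
  by (auto simp: screen_leaf_def)

lemma leaf_bij: "t \<in> flow_times S \<xi> V \<Longrightarrow> bij_betw (\<lambda>p. \<Phi> p t) S (leaf t)"
  unfolding bij_betw_def leaf_eq using inj_onD[OF flow_inj] flow_timesD
  by (auto intro!: inj_onI)

lemma leaf_carrier:
  assumes t: "t \<in> flow_times S \<xi> V"
  shows "leaf t \<subseteq> carrier_of A"
  unfolding leaf_eq using smooth_to_carrier[OF flow_line_smooth(1)] flow_timesD[OF t] by fastforce

text \<open>The inverse of \<open>p \<mapsto> \<Phi> p t\<close> is the base point of \<open>exp\<^sup>-\<^sup>1\<close>, hence continuous on the leaf.\<close>

lemma leaf_image_open:
  assumes t: "t \<in> flow_times S \<xi> V" and X: "openin (atlas_topology A) X"
  shows "openin (subtopology (atlas_topology A) (leaf t)) ((\<lambda>p. \<Phi> p t) ` (S \<inter> X))"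
proof (subst openin_subopen, intro ballI)
  let ?E = "inv_into V (exp_map A g)"
  obtain N where N: "openin (atlas_topology A) N" "S \<subseteq> N" "bij_betw (exp_map A g) V N"
    "smooth_map_on (tangent_atlas A) A V (exp_map A g)" "smooth_map_on A (tangent_atlas A) N ?E"
    by (rule V_diffeomorphism)
  have flowN: "\<Phi> p t \<in> N" "?E (\<Phi> p t) = (p, t *\<^sub>R \<xi> p)" if "p \<in> S" for p
    using flow_timesD[OF t that] N(3) exp_inj by (auto simp: dom_iff flow_exp bij_betw_def)
  fix q assume "q \<in> (\<lambda>p. \<Phi> p t) ` (S \<inter> X)"
  then obtain p where p: "p \<in> S" "p \<in> X" "q = \<Phi> p t" by blast
  obtain UE E where E: "q \<in> UE" "smooth_map A (tangent_atlas A) UE E" "\<And>q. q \<in> N \<inter> UE \<Longrightarrow> E q = ?E q"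
    using N(5)[unfolded smooth_map_on_def, rule_format, OF flowN(1)[OF p(1)]] p(3) by (elim exE conjE) auto
  have UE: "openin (atlas_topology A) UE"
    and cont: "continuous_map (subtopology (atlas_topology A) UE) (atlas_topology (tangent_atlas A)) E"
    using E(2) by (auto simp: smooth_map_def)
  let ?P = "{q \<in> topspace (subtopology (atlas_topology A) UE). E q \<in> X \<times> UNIV}"
  have "openin (subtopology (atlas_topology A) UE) ?P"
    by (rule openin_continuous_map_preimage[OF cont openin_tangent_vimage[OF atlas X]])
  moreover have "?P = UE \<inter> E -` (X \<times> UNIV)" using openin_subset[OF UE] by auto
  ultimately have P: "openin (atlas_topology A) (UE \<inter> E -` (X \<times> UNIV))"
    using UE by (simp add: openin_open_subtopology)
  show "\<exists>T. openin (subtopology (atlas_topology A) (leaf t)) T \<and> q \<in> T \<and> T \<subseteq> (\<lambda>p. \<Phi> p t) ` (S \<inter> X)"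
  proof (intro exI conjI)
    show "openin (subtopology (atlas_topology A) (leaf t)) ((UE \<inter> E -` (X \<times> UNIV)) \<inter> leaf t)"
      using P by (auto simp: openin_subtopology)
    show "q \<in> (UE \<inter> E -` (X \<times> UNIV)) \<inter> leaf t"
      using E(1,3) flowN[OF p(1)] p by (auto simp: leaf_eq)
    show "(UE \<inter> E -` (X \<times> UNIV)) \<inter> leaf t \<subseteq> (\<lambda>p. \<Phi> p t) ` (S \<inter> X)"
    proof
      fix r assume r: "r \<in> (UE \<inter> E -` (X \<times> UNIV)) \<inter> leaf t"
      then obtain p' where p': "p' \<in> S" "r = \<Phi> p' t" by (auto simp: leaf_eq)
      have "E r = (p', t *\<^sub>R \<xi> p')" using E(3)[of r] r flowN[OF p'(1)] p'(2) by auto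
      then have "p' \<in> X" using r by auto
      then show "r \<in> (\<lambda>p. \<Phi> p t) ` (S \<inter> X)" using p' by blast
    qed
  qed
qed

text \<open>Each parametrization of \<open>S\<close> is carried by the flow to one of the leaf with
  the same parameter domain, which makes the two volumes comparable. The homeomorphism property is
  obtained from openness, as \<open>leaf_image_open\<close> controls the inverse of the
  flow.\<close>

lemma leaf_parametrization:
  fixes W :: "'k::euclidean_space set"
  assumes P: "local_parametrization A S W \<psi>" and t: "t \<in> flow_times S \<xi> V"
  shows "local_parametrization A (leaf t) W (\<lambda>x. \<Phi> (\<psi> x) t)"
proof -
  note D = local_parametrizationD[OF P]
  let ?F = "\<lambda>x. \<Phi> (\<psi> x) t"
  have dom: "(\<psi> x, t) \<in> dom" if "x \<in> W" for x using flow_timesD[OF t] D(6) that by auto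
  have sm: "smooth_to A W ?F" by (rule flow_slice_smooth[OF D(1,6) dom])
  have sub: "?F ` W \<subseteq> leaf t" using D(6) by (auto simp: leaf_eq)
  have car: "?F ` W \<subseteq> carrier_of A" using sub leaf_carrier[OF t] by blast
  have image_open: "openin (subtopology (atlas_topology A) (leaf t)) (?F ` E)"
    if E: "openin (top_of_set W) E" for E
  proof -
    have "openin (subtopology (atlas_topology A) (\<psi> ` W)) (\<psi> ` E)"
      using homeomorphic_imp_open_map[OF D(7)] E by (simp add: open_map_def)
    then have "openin (subtopology (atlas_topology A) S) (\<psi> ` E)"
      using D(5,6) by (metis openin_trans_full subtopology_subtopology inf.absorb_iff2)
    then obtain X where X: "openin (atlas_topology A) X" "\<psi> ` E = X \<inter> S" by (auto simp: openin_subtopology)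
    have SX: "S \<inter> X = \<psi> ` E" using X(2) by auto
    have "?F ` E = (\<lambda>p. \<Phi> p t) ` (S \<inter> X)" unfolding SX by (rule image_image[symmetric])
    then show ?thesis using leaf_image_open[OF t X(1)] by simp
  qed
  have inj: "inj_on ?F W"
  proof (rule inj_onI)
    fix x y assume xy: "x \<in> W" "y \<in> W" "?F x = ?F y"
    then have "\<psi> x = \<psi> y" using inj_onD[OF bij_betw_imp_inj_on[OF leaf_bij[OF t]]] D(6) by blast
    then show "x = y" using inj_onD[OF D(3)] xy by blast
  qed
  have "homeomorphic_map (top_of_set W) (subtopology (atlas_topology A) (?F ` W)) ?F"
  proof (rule bijective_open_imp_homeomorphic_map)
    show "continuous_map (top_of_set W) (subtopology (atlas_topology A) (?F ` W)) ?F"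
      using smooth_to_continuous_map[OF sm] by (auto simp: continuous_map_in_subtopology)
    show "open_map (top_of_set W) (subtopology (atlas_topology A) (?F ` W)) ?F"
      unfolding open_map_def
    proof (intro allI impI)
      fix E assume E: "openin (top_of_set W) E"
      then have EW: "E \<subseteq> W" by (rule openin_imp_subset)
      obtain X where X: "openin (atlas_topology A) X" "?F ` E = X \<inter> leaf t"
        using image_open[OF E] by (auto simp: openin_subtopology)
      have "?F ` E = X \<inter> ?F ` W" using X(2) EW sub by blast
      then show "openin (subtopology (atlas_topology A) (?F ` W)) (?F ` E)"
        using X(1) by (auto simp: openin_subtopology)
    qed
    show "?F ` topspace (top_of_set W) = topspace (subtopology (atlas_topology A) (?F ` W))" using car by auto
    show "inj_on ?F (topspace (top_of_set W))" using inj by simp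
  qed
  moreover have "inj (tangent_map euclidean_atlas A ?F x)" if "x \<in> W" for x
    using slice_tangent_inj[OF P that dom[OF that]] by (simp add: slice_tangent_def)
  ultimately show ?thesis
    unfolding local_parametrization_def using sm image_open[of W] by simp
qed

lemma leaf_embedded:
  assumes emb: "embedded_submanifold TYPE('k::euclidean_space) A S" and t: "t \<in> flow_times S \<xi> V"
  shows "embedded_submanifold TYPE('k) A (leaf t)"
  unfolding embedded_submanifold_def
proof (intro conjI ballI leaf_carrier[OF t])
  fix q assume "q \<in> leaf t"
  then obtain p where p: "p \<in> S" "q = \<Phi> p t" by (auto simp: leaf_eq)
  obtain W :: "'k set" and \<psi> where P: "local_parametrization A S W \<psi>" "p \<in> \<psi> ` W"
    using emb p(1) unfolding embedded_submanifold_def by blast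
  show "\<exists>(W :: 'k set) \<psi>. local_parametrization A (leaf t) W \<psi> \<and> q \<in> \<psi> ` W"
    using leaf_parametrization[OF P(1) t] P(2) p(2)
    by (intro exI[of _ W] exI[of _ "\<lambda>x. \<Phi> (\<psi> x) t"]) auto
qed

text \<open>Compactness is carried over by the compact parameter sets, since continuity of the slice
  map is at hand only after composition with a parametrization.\<close>

lemma leaf_compact:
  assumes emb: "embedded_submanifold TYPE(real^'n) A S" "compactin (atlas_topology A) S"
    and t: "t \<in> flow_times S \<xi> V"
  shows "compactin (atlas_topology A) (leaf t)"
proof -
  obtain k :: nat and W \<psi> K where
    "(\<forall>i<k. local_parametrization A S (W i :: (real^'n) set) (\<psi> i) \<and> compact (K i) \<and> K i \<subseteq> W i) \<and>
    S = (\<Union>i<k. \<psi> i ` K i)"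
    using compact_submanifold_cover[OF emb] by (elim exE)
  then have *: "\<And>i. i < k \<Longrightarrow> local_parametrization A S (W i) (\<psi> i)"
    "\<And>i. i < k \<Longrightarrow> compact (K i)" "\<And>i. i < k \<Longrightarrow> K i \<subseteq> W i" and S: "S = (\<Union>i<k. \<psi> i ` K i)"
    by blast+
  have "compactin (atlas_topology A) ((\<lambda>x. \<Phi> (\<psi> i x) t) ` K i)" if i: "i < k" for i
  proof (rule image_compactin)
    show "compactin (top_of_set (W i)) (K i)" using *(2,3)[OF i] by (simp add: compactin_subtopology)
    show "continuous_map (top_of_set (W i)) (atlas_topology A) (\<lambda>x. \<Phi> (\<psi> i x) t)"
      by (rule smooth_to_continuous_map[OF local_parametrizationD(1)[OF leaf_parametrization[OF *(1)[OF i] t]]])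
  qed
  then have "compactin (atlas_topology A) (\<Union>((\<lambda>i. (\<lambda>x. \<Phi> (\<psi> i x) t) ` K i) ` {..<k}))"
    by (intro compactin_Union) auto
  moreover have "leaf t = (\<Union>i<k. (\<lambda>x. \<Phi> (\<psi> i x) t) ` K i)"
    unfolding leaf_eq by (subst S) (simp add: image_UN image_image)
  ultimately show ?thesis by simp
qed

section \<open>The expansion factor and the volume of a leaf\<close>

definition expansion_factor :: "real \<Rightarrow> 'a \<Rightarrow> real" where
  "expansion_factor t p = exp (LBINT s=0..t. expansion_scalar A g S \<xi> V (\<Phi> p s))"

text \<open>By star-shapedness all times between \<open>0\<close> and \<open>t\<close> are flow
  times, so \<open>\<theta> = - n \<mu>\<close> is available along the whole path of integration.
  The power form is the one that the determinant of a scaled matrix produces.\<close>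

lemma expansion_factor_eq:
  fixes W :: "(real^'n) set"
  assumes P: "local_parametrization A S W \<psi>" and x: "x \<in> W" and t: "t \<in> flow_times S \<xi> V"
  shows "expansion_factor t (\<psi> x) = exp (- (LBINT s=0..t. \<mu> (\<Phi> (\<psi> x) s))) ^ CARD('n)"
proof -
  have "(LBINT s=0..t. expansion_scalar A g S \<xi> V (\<Phi> (\<psi> x) s)) = (LBINT s=0..t. - real CARD('n) * \<mu> (\<Phi> (\<psi> x) s))"
  proof (rule interval_integral_cong)
    fix s assume "s \<in> einterval (min 0 (ereal t)) (max 0 (ereal t))"
    then have "s \<in> closed_segment 0 t"
      by (auto simp: einterval_def closed_segment_eq_real_ivl min_def max_def zero_ereal_def split: if_splits)
    then show "expansion_scalar A g S \<xi> V (\<Phi> (\<psi> x) s) = - real CARD('n) * \<mu> (\<Phi> (\<psi> x) s)"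
      by (intro expansion_scalar_eq[OF P x] flow_times_segment[OF t])
  qed
  also have "\<dots> = real CARD('n) * - (LBINT s=0..t. \<mu> (\<Phi> (\<psi> x) s))"
    by (subst interval_lebesgue_integral_mult_right) simp
  finally show ?thesis unfolding expansion_factor_def exp_of_nat_mult[symmetric] by simp
qed

text \<open>The evolution scales every row of the Gram matrix by \<open>?e\<^sup>2\<close>; the
  determinant picks up this factor once per dimension, and the square root halves the
  exponent.\<close>

lemma leaf_volume_density:
  fixes W :: "(real^'n) set"
  assumes P: "local_parametrization A S W \<psi>" and x: "x \<in> W" and t: "t \<in> flow_times S \<xi> V"
  shows "sqrt (det (gram_matrix (\<lambda>x. \<Phi> (\<psi> x) t) x)) = expansion_factor t (\<psi> x) * sqrt (det (gram_matrix \<psi> x))"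
proof -
  note D = local_parametrizationD[OF P]
  have dom: "(\<psi> x, t) \<in> dom" using flow_timesD[OF t] D(6) x by auto
  let ?e = "exp (- (LBINT s=0..t. \<mu> (\<Phi> (\<psi> x) s)))"
  have e2: "exp (- 2 * (LBINT s=0..t. \<mu> (\<Phi> (\<psi> x) s))) = ?e\<^sup>2"
    by (simp add: power2_eq_square flip: exp_add)
  have "gram_matrix (\<lambda>x. \<Phi> (\<psi> x) t) x = (\<chi> i. ?e\<^sup>2 *s gram_matrix \<psi> x $ i)"
    unfolding gram_matrix_def slice_metric_evolution[OF D(1,6) x dom] e2 by (simp add: vec_eq_iff)
  then have "det (gram_matrix (\<lambda>x. \<Phi> (\<psi> x) t) x) = (?e ^ CARD('n))\<^sup>2 * det (gram_matrix \<psi> x)"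
    using det_rows_mul[of "\<lambda>i. ?e\<^sup>2" "\<lambda>i. gram_matrix \<psi> x $ i"]
    by (simp add: power_mult[symmetric] mult.commute)
  then show ?thesis by (simp add: real_sqrt_mult expansion_factor_eq[OF P x t])
qed

text \<open>Parameter dependence of the integral is avoided: by the evolution law the factor is a
  power of the square root of the quotient of the evolved metric by the initial one on a fixed
  vector. Both are smooth in \<open>x\<close>, and the denominator is positive because
  \<open>S\<close> is spacelike.\<close>

lemma expansion_factor_continuous:
  fixes W :: "(real^'n) set"
  assumes P: "local_parametrization A S W \<psi>" and t: "t \<in> flow_times S \<xi> V"
  shows "continuous_on W (\<lambda>x. expansion_factor t (\<psi> x))"
proof -
  note D = local_parametrizationD[OF P]
  fix i :: 'n
  let ?u = "axis i 1 :: real^'n"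
  have u: "?u \<noteq> 0" by (simp add: axis_eq_0_iff)
  let ?h = "\<lambda>x. pullback_metric A g \<psi> x ?u ?u" and ?k = "\<lambda>x. pullback_metric A g (\<lambda>x. \<Phi> (\<psi> x) t) x ?u ?u"
  have pos: "?h x > 0" if "x \<in> W" for x by (rule parametrization_spacelike[OF P that u])
  have "continuous_on W (\<lambda>x. sqrt (?k x / ?h x) ^ CARD('n))"
    using pos local_parametrizationD(1)[OF leaf_parametrization[OF P t]]
    by (intro continuous_intros smooth_on_continuous_on pullback_smooth D(1)) fastforce+
  moreover have "sqrt (?k x / ?h x) ^ CARD('n) = expansion_factor t (\<psi> x)" if x: "x \<in> W" for x
  proof -
    have dom: "(\<psi> x, t) \<in> dom" using flow_timesD[OF t] D(6) x by auto
    let ?e = "exp (- (LBINT s=0..t. \<mu> (\<Phi> (\<psi> x) s)))"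
    have "?k x = exp (- 2 * (LBINT s=0..t. \<mu> (\<Phi> (\<psi> x) s))) * ?h x"
      by (rule slice_metric_evolution[OF D(1,6) x dom])
    moreover have "exp (- 2 * (LBINT s=0..t. \<mu> (\<Phi> (\<psi> x) s))) = ?e\<^sup>2"
      by (simp add: power2_eq_square flip: exp_add)
    ultimately have "?k x / ?h x = ?e\<^sup>2" using pos[OF x] by simp
    then show ?thesis by (simp add: expansion_factor_eq[OF P x t])
  qed
  ultimately show ?thesis by (simp cong: continuous_on_cong)
qed

theorem leaf_volume:
  assumes emb: "embedded_submanifold TYPE(real^'n) A S" "compactin (atlas_topology A) S"
    and t: "t \<in> flow_times S \<xi> V"
  shows "emeasure (induced_volume TYPE('n) A g (leaf t)) (leaf t)
    = ennreal (LINT p|induced_volume TYPE('n) A g S. expansion_factor t p)"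
proof -
  let ?M = "induced_volume TYPE('n) A g S" and ?M' = "induced_volume TYPE('n) A g (leaf t)"
  note emb' = leaf_embedded[OF emb(1) t] leaf_compact[OF emb t]
  have M: "volume_measure TYPE('n) A g S ?M" by (rule volume_measure_induced[OF emb])
  have M': "volume_measure TYPE('n) A g (leaf t) ?M'" by (rule volume_measure_induced[OF emb'])
  have nonneg: "0 \<le> expansion_factor t p" for p by (simp add: expansion_factor_def)
  have push: "expansion_factor t \<in> borel_measurable ?M"
    "emeasure ?M' (leaf t) = (\<integral>\<^sup>+p. ennreal (expansion_factor t p) \<partial>?M)"
    by (rule volume_measure_pushforward[OF M M' emb leaf_bij[OF t]];
        rule leaf_parametrization[OF _ t] expansion_factor_continuous[OF _ t] leaf_volume_density[OF _ _ t] nonneg;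
        assumption)+
  \<comment> \<open>The right-hand side of the claim is a Lebesgue integral, which is
    \<open>0\<close> by convention for nonintegrable functions. Integrability is read off from the
    finite volume of the compact leaf.\<close>
  have fin: "(\<integral>\<^sup>+p. ennreal (expansion_factor t p) \<partial>?M) < \<infinity>"
    using volume_measure_finite[OF emb' M'] push(2) by simp
  have "integrable ?M (expansion_factor t)"
    by (rule integrableI_nonneg[OF push(1) _ fin]) (intro AE_I2 nonneg)
  then have "(\<integral>\<^sup>+p. ennreal (expansion_factor t p) \<partial>?M) = ennreal (LINT p|?M. expansion_factor t p)"
    by (rule nn_integral_eq_integral) (intro AE_I2 nonneg)
  with push(2) show ?thesis by simp
qed

end

theorem theorem7p8:
  fixes A :: "('a, real^'m) atlas"
    and g :: "('a, real^'m) metric"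
    and S :: "'a set"
    and \<xi> :: "'a \<Rightarrow> real^'m"
    and V :: "('a \<times> (real^'m)) set"
    and n :: nat
    and t :: real
  assumes dim: "CARD('n::finite) = n" "CARD('m) = n + 2" "n + 2 \<ge> 4"
    and spacetime: "spacetime A g" "orientable A"
    and S: "embedded_submanifold TYPE(real^'n) A S" "spacelike A g S"
      "compactin (atlas_topology A) S" "connectedin (atlas_topology A) S"
    and \<xi>: "lightlike_normal_field A g S \<xi>"
    and V: "normal_exp_neighborhood A g S V"
    and umbilical: "totally_umbilical A g S \<xi> V"
    and t: "t \<in> flow_times S \<xi> V"
  shows "emeasure (induced_volume TYPE('n) A g (screen_leaf A g S \<xi> t)) (screen_leaf A g S \<xi> t) =
    ennreal (LINT p|induced_volume TYPE('n) A g S.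
      exp (LBINT s=0..t. expansion_scalar A g S \<xi> V (normal_flow A g \<xi> (p, s))))"
proof -
  obtain \<mu> where \<mu>: "smooth_map_on A euclidean_atlas (emanating_hypersurface A g S \<xi> V) \<mu>"
    "\<forall>q\<in>emanating_hypersurface A g S \<xi> V. \<forall>X\<in>tangent_space A (emanating_hypersurface A g S \<xi> V) q.
      \<forall>Y\<in>tangent_space A (emanating_hypersurface A g S \<xi> V) q. null_sff A g S \<xi> V q X Y = \<mu> q * g q X Y"
    using umbilical unfolding totally_umbilical_def Let_def by blast
  interpret umbilic_flow A g S \<xi> V \<mu>
  proof unfold_locales
    show "smooth_atlas A" "lorentzian_metric A g"
      using spacetime(1) by (auto simp: spacetime_def smooth_manifold_def)
    show "S \<subseteq> carrier_of A" using S(1) by (simp add: embedded_submanifold_def)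
  qed (use \<xi> V S \<mu> in auto)
  show ?thesis using leaf_volume[OF S(1,3) t] unfolding expansion_factor_def .
qed

end
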